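(* Let $G$ be an ample groupoid with Hausdorff unit space $G^{(0)}$, and let $A(G)$ be its complex Steinberg algebra. For $f\in A(G)$, the formula \[\|f\| = \sup \{\|\pi(f)\| \mid \pi:A(G) \to B(\mathscr{H})\text{ is a } *\text{-homomorphism for some Hilbert space } \mathscr{H}\}\] defines a C*-norm on $A(G)$ (in particular the supremum is finite for every $f$).
   Context: A topological groupoid $G$ (with unit space $G^{(0)}$, source $s(\gamma)=\gamma^{-1}\gamma$ and range $r(\gamma)=\gamma\gamma^{-1}$) is étale if $s$ (hence $r$) is a local homeomorphism. An open bisection is an open set $B\subseteq G$ such that $r|_B$ and $s|_B$ are homeomorphisms onto open subsets of $G^{(0)}$. $G$ is ample if it has a basis of compact open bisections; compact means every open cover has a finite subcover. $G$ itself need not be Hausdorff. The complex Steinberg algebra is $A(G)=\operatorname{span}_{\mathbb{C}}\{1_B : B\subseteq G \text{ a compact open bisection}\}$, a space of functions $G\to\mathbb{C}$ ($1_B$ is the characteristic function of $B$). It is a $*$-algebra under convolution $f*g(\gamma)=\sum_{\alpha\beta=\gamma}f(\alpha)g(\beta)$ and involution $f^*(\gamma)=\overline{f(\gamma^{-1})}$, so $1_B1_D=1_{BD}$ and $(1_B)^*=1_{B^{-1}}$. $\|\pi(f)\|$ is the operator norm on the bounded operators $B(\mathscr{H})$; $*$-homomorphisms are not assumed bounded or continuous. A C*-norm is a submultiplicative norm satisfying $\|f^*f\|=\|f\|^2$. *)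

theory Defs
  imports "HOL-Analysis.Analysis" "HOL-Algebra.Algebraic_Closure_Type"
begin

section \<open>Topological groupoids\<close>

text \<open>The underlying set of a groupoid is the underlying set of its topology. Products of
  non-composable pairs, and inverses of points outside the groupoid, are junk values.\<close>

record 'g top_groupoid =
  gtop :: "'g topology"
  gcomp :: "('g \<times> 'g) set"
  gmult :: "'g \<Rightarrow> 'g \<Rightarrow> 'g"
  ginv :: "'g \<Rightarrow> 'g"

abbreviation garrows :: "'g top_groupoid \<Rightarrow> 'g set" where
  "garrows G \<equiv> topspace (gtop G)"

definition gsource :: "'g top_groupoid \<Rightarrow> 'g \<Rightarrow> 'g" where
  "gsource G x = gmult G (ginv G x) x"

definition grange :: "'g top_groupoid \<Rightarrow> 'g \<Rightarrow> 'g" where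
  "grange G x = gmult G x (ginv G x)"

definition gunits :: "'g top_groupoid \<Rightarrow> 'g set" where
  "gunits G = gsource G ` garrows G"

definition unit_topology :: "'g top_groupoid \<Rightarrow> 'g topology" where
  "unit_topology G = subtopology (gtop G) (gunits G)"

text \<open>These algebraic axioms imply that \<open>x\<close> and \<open>y\<close> are composable iff the source of \<open>x\<close> is the
  range of \<open>y\<close>. No separation axiom is imposed on \<open>G\<close>.\<close>

locale topological_groupoid =
  fixes G :: "'g top_groupoid"
  assumes comp_subset: "gcomp G \<subseteq> garrows G \<times> garrows G"
    and mult_closed: "(x, y) \<in> gcomp G \<Longrightarrow> gmult G x y \<in> garrows G"
    and inv_closed: "x \<in> garrows G \<Longrightarrow> ginv G x \<in> garrows G"
    and inv_inv: "x \<in> garrows G \<Longrightarrow> ginv G (ginv G x) = x"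
    and comp_left: "\<lbrakk>(x, y) \<in> gcomp G; (y, z) \<in> gcomp G\<rbrakk> \<Longrightarrow> (gmult G x y, z) \<in> gcomp G"
    and comp_right: "\<lbrakk>(x, y) \<in> gcomp G; (y, z) \<in> gcomp G\<rbrakk> \<Longrightarrow> (x, gmult G y z) \<in> gcomp G"
    and mult_assoc: "\<lbrakk>(x, y) \<in> gcomp G; (y, z) \<in> gcomp G\<rbrakk>
      \<Longrightarrow> gmult G (gmult G x y) z = gmult G x (gmult G y z)"
    and inv_comp: "x \<in> garrows G \<Longrightarrow> (ginv G x, x) \<in> gcomp G"
    and inv_mult_cancel: "(x, y) \<in> gcomp G \<Longrightarrow> gmult G (ginv G x) (gmult G x y) = y"
    and mult_inv_cancel: "(x, y) \<in> gcomp G \<Longrightarrow> gmult G (gmult G x y) (ginv G y) = x"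
    and continuous_mult: "continuous_map (subtopology (prod_topology (gtop G) (gtop G)) (gcomp G))
      (gtop G) (\<lambda>(x, y). gmult G x y)"
    and continuous_inv: "continuous_map (gtop G) (gtop G) (ginv G)"

definition local_homeomorphism :: "'a topology \<Rightarrow> 'b topology \<Rightarrow> ('a \<Rightarrow> 'b) \<Rightarrow> bool" where
  "local_homeomorphism S T f \<longleftrightarrow> (\<forall>x\<in>topspace S. \<exists>U. openin S U \<and> x \<in> U \<and> openin T (f ` U) \<and>
     homeomorphic_map (subtopology S U) (subtopology T (f ` U)) f)"

definition open_bisection :: "'g top_groupoid \<Rightarrow> 'g set \<Rightarrow> bool" where
  "open_bisection G B \<longleftrightarrow> openin (gtop G) B \<and>
     (\<forall>f\<in>{grange G, gsource G}. openin (unit_topology G) (f ` B) \<and>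
        homeomorphic_map (subtopology (gtop G) B) (subtopology (unit_topology G) (f ` B)) f)"

definition compact_open_bisections :: "'g top_groupoid \<Rightarrow> 'g set set" where
  "compact_open_bisections G = {B. open_bisection G B \<and> compactin (gtop G) B}"

locale ample_groupoid = topological_groupoid +
  assumes etale: "local_homeomorphism (gtop G) (unit_topology G) (gsource G)"
    and basis: "\<lbrakk>openin (gtop G) U; x \<in> U\<rbrakk>
      \<Longrightarrow> \<exists>B\<in>compact_open_bisections G. x \<in> B \<and> B \<subseteq> U"


section \<open>The complex Steinberg algebra\<close>

definition steinberg_algebra :: "'g top_groupoid \<Rightarrow> ('g \<Rightarrow> complex) set" where
  "steinberg_algebra G = {f. \<exists>F c. finite F \<and> F \<subseteq> compact_open_bisections G \<and>
     f = (\<lambda>x. \<Sum>B\<in>F. c B * indicator B x)}"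

text \<open>For \<open>f\<close> and \<open>g\<close> in the Steinberg algebra only finitely many pairs contribute. The sum is
  restricted to the nonzero terms because \<^const>\<open>sum\<close> over an infinite set is 0 by convention.\<close>

definition convolution ::
    "'g top_groupoid \<Rightarrow> ('g \<Rightarrow> complex) \<Rightarrow> ('g \<Rightarrow> complex) \<Rightarrow> 'g \<Rightarrow> complex" where
  "convolution G f g x =
     (\<Sum>(a, b) | (a, b) \<in> gcomp G \<and> gmult G a b = x \<and> f a \<noteq> 0 \<and> g b \<noteq> 0. f a * g b)"

text \<open>Elements of the Steinberg algebra vanish outside the groupoid, and so must the involution.\<close>

definition involution :: "'g top_groupoid \<Rightarrow> ('g \<Rightarrow> complex) \<Rightarrow> 'g \<Rightarrow> complex" where
  "involution G f x = (if x \<in> garrows G then cnj (f (ginv G x)) else 0)"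


section \<open>Hilbert spaces and bounded operators\<close>

text \<open>Hilbert spaces are carrier-based, so that a single type of vectors accommodates Hilbert spaces
  of different dimensions, including the zero space. The fields for a multiplication and a unit that
  the record of modules inherits from rings are irrelevant.\<close>

record 'h hilbert = "(complex, 'h) module" +
  cinner :: "'h \<Rightarrow> 'h \<Rightarrow> complex"

definition hnorm :: "'h hilbert \<Rightarrow> 'h \<Rightarrow> real" where
  "hnorm H v = sqrt (Re (cinner H v v))"

locale hilbert_space = Module.module "ring_of_type_algebra :: complex ring" H
  for H :: "'h hilbert" (structure) +
  assumes cinner_add: "\<lbrakk>u \<in> carrier H; v \<in> carrier H; w \<in> carrier H\<rbrakk>
      \<Longrightarrow> cinner H (u \<oplus> v) w = cinner H u w + cinner H v w"
    and cinner_smult: "\<lbrakk>u \<in> carrier H; v \<in> carrier H\<rbrakk>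
      \<Longrightarrow> cinner H (a \<odot> u) v = a * cinner H u v"
    and cinner_commute: "\<lbrakk>u \<in> carrier H; v \<in> carrier H\<rbrakk> \<Longrightarrow> cinner H u v = cnj (cinner H v u)"
    and cinner_nonneg: "u \<in> carrier H \<Longrightarrow> 0 \<le> Re (cinner H u u)"
    and cinner_definite: "\<lbrakk>u \<in> carrier H; cinner H u u = 0\<rbrakk> \<Longrightarrow> u = \<zero>"
    and complete: "Metric_space.mcomplete (carrier H) (\<lambda>u v. hnorm H (u \<ominus> v))"

text \<open>Operators are considered only on the carrier; their values elsewhere are junk.\<close>

definition bounded_operator :: "'h hilbert \<Rightarrow> ('h \<Rightarrow> 'h) \<Rightarrow> bool" where
  "bounded_operator H T \<longleftrightarrow> T \<in> carrier H \<rightarrow> carrier H \<and>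
     (\<forall>u\<in>carrier H. \<forall>v\<in>carrier H. T (u \<oplus>\<^bsub>H\<^esub> v) = T u \<oplus>\<^bsub>H\<^esub> T v) \<and>
     (\<forall>a. \<forall>u\<in>carrier H. T (a \<odot>\<^bsub>H\<^esub> u) = a \<odot>\<^bsub>H\<^esub> T u) \<and>
     (\<exists>C. \<forall>u\<in>carrier H. hnorm H (T u) \<le> C * hnorm H u)"

definition operator_norm :: "'h hilbert \<Rightarrow> ('h \<Rightarrow> 'h) \<Rightarrow> real" where
  "operator_norm H T = Sup {hnorm H (T u) | u. u \<in> carrier H \<and> hnorm H u \<le> 1}"

definition is_adjoint :: "'h hilbert \<Rightarrow> ('h \<Rightarrow> 'h) \<Rightarrow> ('h \<Rightarrow> 'h) \<Rightarrow> bool" where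
  "is_adjoint H S T \<longleftrightarrow> (\<forall>u\<in>carrier H. \<forall>v\<in>carrier H. cinner H (S u) v = cinner H u (T v))"


section \<open>Representations and C*-norms\<close>

definition star_hom ::
    "'g top_groupoid \<Rightarrow> 'h hilbert \<Rightarrow> (('g \<Rightarrow> complex) \<Rightarrow> 'h \<Rightarrow> 'h) \<Rightarrow> bool" where
  "star_hom G H \<pi> \<longleftrightarrow>
     (\<forall>f\<in>steinberg_algebra G. bounded_operator H (\<pi> f)) \<and>
     (\<forall>f\<in>steinberg_algebra G. \<forall>g\<in>steinberg_algebra G. \<forall>u\<in>carrier H.
        \<pi> (\<lambda>x. f x + g x) u = \<pi> f u \<oplus>\<^bsub>H\<^esub> \<pi> g u) \<and>
     (\<forall>a. \<forall>f\<in>steinberg_algebra G. \<forall>u\<in>carrier H. \<pi> (\<lambda>x. a * f x) u = a \<odot>\<^bsub>H\<^esub> \<pi> f u) \<and>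
     (\<forall>f\<in>steinberg_algebra G. \<forall>g\<in>steinberg_algebra G. \<forall>u\<in>carrier H.
        \<pi> (convolution G f g) u = \<pi> f (\<pi> g u)) \<and>
     (\<forall>f\<in>steinberg_algebra G. is_adjoint H (\<pi> (involution G f)) (\<pi> f))"

text \<open>The values \<open>\<parallel>\<pi>(f)\<parallel>\<close> for all representations on Hilbert spaces whose vectors are
  taken from the type \<open>'h\<close>.\<close>

definition rep_norms :: "'g top_groupoid \<Rightarrow> 'h itself \<Rightarrow> ('g \<Rightarrow> complex) \<Rightarrow> real set" where
  "rep_norms G (T :: 'h itself) f =
     {operator_norm H (\<pi> f) | (H :: 'h hilbert) \<pi>. hilbert_space H \<and> star_hom G H \<pi>}"

text \<open>HOL cannot form the supremum over the Hilbert spaces of all types at once. It is taken over the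
  Hilbert spaces with vectors in one type, which is large enough to contain a copy of every Hilbert
  space carrying a cyclic representation: each vector of such a space is the limit of a sequence
  \<open>\<pi>(f\<^sub>n)\<xi>\<close> with all \<open>f\<^sub>n\<close> in the Steinberg algebra. That the result
  bounds the representations on Hilbert spaces of every type has to be proved.\<close>

definition full_norm :: "'g top_groupoid \<Rightarrow> ('g \<Rightarrow> complex) \<Rightarrow> real" where
  "full_norm G f = Sup (rep_norms G TYPE(nat \<Rightarrow> 'g \<Rightarrow> complex) f)"

definition cstar_norm_on ::
    "('g \<Rightarrow> complex) set \<Rightarrow> (('g \<Rightarrow> complex) \<Rightarrow> ('g \<Rightarrow> complex) \<Rightarrow> 'g \<Rightarrow> complex) \<Rightarrow>
     (('g \<Rightarrow> complex) \<Rightarrow> 'g \<Rightarrow> complex) \<Rightarrow> (('g \<Rightarrow> complex) \<Rightarrow> real) \<Rightarrow> bool" where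
  "cstar_norm_on A mul star N \<longleftrightarrow>
     (\<forall>f\<in>A. 0 \<le> N f) \<and>
     (\<forall>f\<in>A. N f = 0 \<longleftrightarrow> f = (\<lambda>x. 0)) \<and>
     (\<forall>a. \<forall>f\<in>A. N (\<lambda>x. a * f x) = cmod a * N f) \<and>
     (\<forall>f\<in>A. \<forall>g\<in>A. N (\<lambda>x. f x + g x) \<le> N f + N g) \<and>
     (\<forall>f\<in>A. \<forall>g\<in>A. N (mul f g) \<le> N f * N g) \<and>
     (\<forall>f\<in>A. N (mul (star f) f) = (N f)\<^sup>2)"

end

theory Submission
  imports Defs
begin

text \<open>
  \<^emph>\<open>The supremum is finite.\<close> If \<open>B\<close> is a compact open bisection, then
  \<open>(1\<^sub>B)\<^sup>* 1\<^sub>B\<close> is the characteristic function of the compact open set \<open>s(B)\<close> of units, a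
  self-adjoint idempotent. A \<open>*\<close>-homomorphism \<open>\<pi>\<close> therefore maps \<open>1\<^sub>B\<close> to a partial
  isometry, and \<open>\<parallel>\<pi>(f)\<parallel>\<close> is at most the sum of the \<open>\<bar>c\<^sub>B\<bar>\<close> for any expression of \<open>f\<close>
  as a combination of the \<open>1\<^sub>B\<close> with coefficients \<open>c\<^sub>B\<close>, whatever \<open>\<pi>\<close> is
  (\<open>indicator_contraction\<close>, \<open>uniform_bound\<close>).

  \<^emph>\<open>One type of vectors suffices.\<close> Let \<open>\<pi>\<close> be a representation on any type, \<open>u\<close> a vector and
  \<open>f\<close> in the algebra. Since \<open>f\<close> vanishes outside finitely many bisections, there is a compact open
  set \<open>V\<close> of units with \<open>f 1\<^sub>V = f\<close> (\<open>local_unit\<close>), so \<open>\<pi>(f)u = \<pi>(f)\<pi>(1\<^sub>V)u\<close>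
  involves only the cyclic subspace generated by \<open>u\<close>. That subspace is modelled by the algebra itself:
  \<open>\<langle>g, h\<rangle> = \<langle>\<pi>(g)u, \<pi>(h)u\<rangle>\<close> is a semi-inner product for which convolution from the left is
  a \<open>*\<close>-representation. Its Hausdorff completion is built from sequences of elements of the algebra, which
  are vectors of the type used in the definition of the norm (\<open>completion\<close>,
  \<open>rep_norm_dominates\<close>). The argument needs the algebra to be closed under convolution, hence
  the product of two compact open bisections \<open>B\<close> and \<open>D\<close> to be compact. The product is a
  continuous image of the intersection of \<open>s(B)\<close> and \<open>r(D)\<close>, which is compact because the unit space is
  Hausdorff (\<open>bisection_mult_closed\<close>).

  \<^emph>\<open>The norm is definite.\<close> The algebra acts by convolution on the finitely supported functions on
  the groupoid (\<open>regular_representation\<close>), and \<open>f\<close> applied to the point mass at \<open>s(x)\<close> has the value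
  \<open>f(x)\<close> at \<open>x\<close>. This space is in general not complete, but \<open>rep_norm_dominates\<close>
  is about all spaces with a semi-inner product and turns the action into a representation on a Hilbert space.

  The remaining C*-norm properties hold for each operator norm \<open>\<parallel>\<pi>(f)\<parallel>\<close> and pass to the supremum.
\<close>

section \<open>Semi-inner products\<close>

text \<open>The spaces to which representations are moved below are obtained by pulling an inner product back
  along \<open>g \<mapsto> \<pi>(g)u\<close>. Such a pull-back may be degenerate and is rarely complete.\<close>

locale semi_inner_space = Module.module "ring_of_type_algebra :: complex ring" H
  for H :: "'h hilbert" (structure) +
  assumes cinner_add: "\<lbrakk>u \<in> carrier H; v \<in> carrier H; w \<in> carrier H\<rbrakk>
      \<Longrightarrow> cinner H (u \<oplus> v) w = cinner H u w + cinner H v w"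
    and cinner_smult: "\<lbrakk>u \<in> carrier H; v \<in> carrier H\<rbrakk>
      \<Longrightarrow> cinner H (a \<odot> u) v = a * cinner H u v"
    and cinner_commute: "\<lbrakk>u \<in> carrier H; v \<in> carrier H\<rbrakk> \<Longrightarrow> cinner H u v = cnj (cinner H v u)"
    and cinner_nonneg: "u \<in> carrier H \<Longrightarrow> 0 \<le> Re (cinner H u u)"
begin

lemma smult_in_carrier [simp, intro]: "u \<in> carrier H \<Longrightarrow> a \<odot> u \<in> carrier H"
  by (rule smult_closed) (simp_all add: ring_of_type_algebra_def)

lemma uminus_eq_smult: "u \<in> carrier H \<Longrightarrow> \<ominus> u = (-1) \<odot> u"
proof -
  assume u: "u \<in> carrier H"
  have one: "1 \<odot> u = u"
    using smult_one[OF u] by (simp add: ring_of_type_algebra_def)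
  have "(1 + (-1)) \<odot> u = 1 \<odot> u \<oplus> (-1) \<odot> u"
    using smult_l_distr[of 1 "-1" u] u by (simp add: ring_of_type_algebra_def)
  moreover have "(0::complex) \<odot> u = \<zero>"
    using smult_l_null[OF u] by (simp add: ring_of_type_algebra_def)
  ultimately have "u \<oplus> (-1) \<odot> u = \<zero>"
    using one by simp
  then show ?thesis
    using u by (metis M.add.m_comm M.minus_equality smult_in_carrier)
qed

lemma cinner_zero_left [simp]: "u \<in> carrier H \<Longrightarrow> cinner H \<zero> u = 0"
  using cinner_add[of \<zero> \<zero> u] by simp

lemma cinner_zero_right [simp]: "u \<in> carrier H \<Longrightarrow> cinner H u \<zero> = 0"
  using cinner_commute[of u \<zero>] by simp

lemma cinner_add_right:
  "\<lbrakk>u \<in> carrier H; v \<in> carrier H; w \<in> carrier H\<rbrakk>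
    \<Longrightarrow> cinner H u (v \<oplus> w) = cinner H u v + cinner H u w"
  using cinner_commute[of u "v \<oplus> w"] cinner_commute[of u v] cinner_commute[of u w]
  by (simp add: cinner_add)

lemma cinner_smult_right:
  "\<lbrakk>u \<in> carrier H; v \<in> carrier H\<rbrakk> \<Longrightarrow> cinner H u (a \<odot> v) = cnj a * cinner H u v"
  using cinner_commute[of u "a \<odot> v"] cinner_commute[of u v] by (simp add: cinner_smult)

lemma cinner_diff:
  "\<lbrakk>u \<in> carrier H; v \<in> carrier H; w \<in> carrier H\<rbrakk>
    \<Longrightarrow> cinner H (u \<ominus> v) w = cinner H u w - cinner H v w"
  by (simp add: a_minus_def uminus_eq_smult cinner_add cinner_smult)

lemma cinner_diff_right:
  "\<lbrakk>u \<in> carrier H; v \<in> carrier H; w \<in> carrier H\<rbrakk>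
    \<Longrightarrow> cinner H u (v \<ominus> w) = cinner H u v - cinner H u w"
  by (simp add: a_minus_def uminus_eq_smult cinner_add_right cinner_smult_right)

lemma cinner_self:
  assumes "u \<in> carrier H"
  shows "cinner H u u = of_real ((hnorm H u)\<^sup>2)"
proof -
  have "Im (cinner H u u) = - Im (cinner H u u)"
    by (subst cinner_commute) (use assms in simp_all)
  then show ?thesis
    using cinner_nonneg[OF assms] by (simp add: hnorm_def complex_eq_iff)
qed

lemma hnorm_nonneg [simp]: "u \<in> carrier H \<Longrightarrow> 0 \<le> hnorm H u"
  by (simp add: hnorm_def cinner_nonneg)

lemma hnorm_zero [simp]: "hnorm H \<zero> = 0"
  by (simp add: hnorm_def)

lemma hnorm_smult: "u \<in> carrier H \<Longrightarrow> hnorm H (a \<odot> u) = cmod a * hnorm H u"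
proof -
  assume u: "u \<in> carrier H"
  have "complex_of_real ((hnorm H (a \<odot> u))\<^sup>2) = a * cnj a * of_real ((hnorm H u)\<^sup>2)"
    using u by (simp add: cinner_self[symmetric] cinner_smult cinner_smult_right flip: of_real_power)
  also have "\<dots> = of_real ((cmod a * hnorm H u)\<^sup>2)"
    by (simp add: complex_norm_square[symmetric] power_mult_distrib)
  finally have "(hnorm H (a \<odot> u))\<^sup>2 = (cmod a * hnorm H u)\<^sup>2"
    by (simp only: of_real_eq_iff)
  then show ?thesis
    using u by simp
qed

text \<open>The quadratic polynomial in \<open>t\<close> whose nonnegativity gives the Cauchy--Schwarz inequality.\<close>
lemma cinner_diff_self:
  assumes u: "u \<in> carrier H" and v: "v \<in> carrier H"
  shows "(hnorm H (u \<ominus> t \<odot> v))\<^sup>2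
    = (hnorm H u)\<^sup>2 - 2 * Re (cnj t * cinner H u v) + (cmod t)\<^sup>2 * (hnorm H v)\<^sup>2"
proof -
  have w: "u \<ominus> t \<odot> v \<in> carrier H" using u v by simp
  have "of_real ((hnorm H (u \<ominus> t \<odot> v))\<^sup>2) = cinner H (u \<ominus> t \<odot> v) (u \<ominus> t \<odot> v)"
    using cinner_self[OF w] by simp
  also have "\<dots> = cinner H u u - (cnj t * cinner H u v + cnj (cnj t * cinner H u v))
      + t * cnj t * cinner H v v"
    using u v cinner_commute[OF v u]
    by (simp add: cinner_diff cinner_diff_right cinner_smult cinner_smult_right algebra_simps)
  also have "\<dots> = of_real ((hnorm H u)\<^sup>2 - 2 * Re (cnj t * cinner H u v) + (cmod t)\<^sup>2 * (hnorm H v)\<^sup>2)"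
    using cinner_self[OF u] cinner_self[OF v]
    by (simp only: complex_add_cnj complex_norm_square[symmetric] of_real_mult of_real_add of_real_diff)
  finally show ?thesis by (simp only: of_real_eq_iff)
qed

text \<open>As \<open>v\<close> may be a nonzero vector of norm zero, the usual division by \<open>\<parallel>v\<parallel>\<close> is replaced in that case by
  letting the real parameter \<open>s\<close> grow: the polynomial becomes linear in \<open>s\<close>, so its slope must vanish.\<close>
lemma Cauchy_Schwarz:
  assumes u: "u \<in> carrier H" and v: "v \<in> carrier H"
  shows "cmod (cinner H u v) \<le> hnorm H u * hnorm H v"
proof -
  define c n where "c = cinner H u v" and "n = hnorm H v"
  have *: "0 \<le> (hnorm H u)\<^sup>2 - 2 * s * (cmod c)\<^sup>2 + s\<^sup>2 * (cmod c)\<^sup>2 * n\<^sup>2" for s :: real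
  proof -
    have "Re (cnj (of_real s * c) * c) = s * (cmod c)\<^sup>2"
      unfolding cmod_power2 by (simp add: power2_eq_square algebra_simps)
    then show ?thesis
      using cinner_diff_self[OF u v, of "of_real s * c"] zero_le_power2[of "hnorm H (u \<ominus> (of_real s * c) \<odot> v)"]
      unfolding c_def[symmetric] n_def[symmetric]
      by (simp add: norm_mult power_mult_distrib)
  qed
  have "(cmod c)\<^sup>2 \<le> (hnorm H u * n)\<^sup>2"
  proof (cases "n = 0")
    case True
    have "(cmod c)\<^sup>2 = 0"
    proof (rule ccontr)
      assume "(cmod c)\<^sup>2 \<noteq> 0"
      then have p: "(cmod c)\<^sup>2 > 0" by simp
      show False
        using *[of "((hnorm H u)\<^sup>2 + 1) / (2 * (cmod c)\<^sup>2)"] True p by simp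
    qed
    then show ?thesis by simp
  next
    case False
    then have n: "n\<^sup>2 > 0" by simp
    have "(1 / m)\<^sup>2 * x * m = x / m" if "m > 0" for m x :: real
      using that by (simp add: power2_eq_square)
    from this[OF n] have "(cmod c)\<^sup>2 / n\<^sup>2 \<le> (hnorm H u)\<^sup>2"
      using *[of "1 / n\<^sup>2"] by simp
    then show ?thesis
      using n by (simp add: pos_divide_le_eq power_mult_distrib)
  qed
  then have "cmod c \<le> hnorm H u * n"
    by (rule power2_le_imp_le) (use u v in \<open>simp add: n_def\<close>)
  then show ?thesis by (simp add: c_def n_def)
qed

lemma hnorm_triangle:
  assumes u: "u \<in> carrier H" and v: "v \<in> carrier H"
  shows "hnorm H (u \<oplus> v) \<le> hnorm H u + hnorm H v"
proof -
  have "complex_of_real ((hnorm H (u \<oplus> v))\<^sup>2) = cinner H (u \<oplus> v) (u \<oplus> v)"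
    using u v by (simp only: cinner_self M.add.m_closed)
  also have "\<dots> = of_real ((hnorm H u)\<^sup>2) + of_real ((hnorm H v)\<^sup>2) + (cinner H u v + cnj (cinner H u v))"
    using u v cinner_commute[OF v u] by (simp add: cinner_add cinner_add_right cinner_self[OF u] cinner_self[OF v])
  finally have "(hnorm H (u \<oplus> v))\<^sup>2 = (hnorm H u)\<^sup>2 + (hnorm H v)\<^sup>2 + 2 * Re (cinner H u v)"
    by (simp add: complex_eq_iff)
  also have "\<dots> \<le> (hnorm H u)\<^sup>2 + (hnorm H v)\<^sup>2 + 2 * (hnorm H u * hnorm H v)"
    using Cauchy_Schwarz[OF u v] complex_Re_le_cmod[of "cinner H u v"] by linarith
  also have "\<dots> = (hnorm H u + hnorm H v)\<^sup>2"
    by (simp add: power2_sum)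
  finally show ?thesis
    by (rule power2_le_imp_le) (use u v in simp)
qed

lemma hnorm_diff_commute:
  assumes "u \<in> carrier H" "v \<in> carrier H"
  shows "hnorm H (u \<ominus> v) = hnorm H (v \<ominus> u)"
proof -
  have "u \<ominus> v = \<ominus> (v \<ominus> u)"
    using assms by (simp add: a_minus_def M.minus_add M.add.m_comm)
  then show ?thesis
    using assms by (simp add: uminus_eq_smult hnorm_smult)
qed

lemma hnorm_diff_triangle:
  assumes "u \<in> carrier H" "v \<in> carrier H" "w \<in> carrier H"
  shows "hnorm H (u \<ominus> w) \<le> hnorm H (u \<ominus> v) + hnorm H (v \<ominus> w)"
proof -
  have "u \<ominus> w = (u \<ominus> v) \<oplus> (v \<ominus> w)"
    using assms unfolding a_minus_def by (simp add: M.a_assoc M.r_neg1 M.l_neg)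
  then show ?thesis
    using assms hnorm_triangle[of "u \<ominus> v" "v \<ominus> w"] by simp
qed

lemma hnorm_minus_self [simp]: "u \<in> carrier H \<Longrightarrow> hnorm H (u \<ominus> u) = 0"
  by (simp add: a_minus_def M.r_neg)

lemma minus_zero [simp]: "u \<in> carrier H \<Longrightarrow> u \<ominus> \<zero> = u"
  by (simp add: a_minus_def)

lemma hnorm_diff_ge:
  assumes "u \<in> carrier H" "v \<in> carrier H"
  shows "\<bar>hnorm H u - hnorm H v\<bar> \<le> hnorm H (u \<ominus> v)"
  using hnorm_diff_triangle[of u v \<zero>] hnorm_diff_triangle[of v u \<zero>]
    hnorm_diff_commute[of u v] assms by (simp add: minus_zero)

lemma hnorm_diff_add_le:
  assumes "u \<in> carrier H" "v \<in> carrier H" "u' \<in> carrier H" "v' \<in> carrier H"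
  shows "hnorm H ((u \<oplus> v) \<ominus> (u' \<oplus> v')) \<le> hnorm H (u \<ominus> u') + hnorm H (v \<ominus> v')"
proof -
  have "(u \<oplus> v) \<ominus> (u' \<oplus> v') = (u \<ominus> u') \<oplus> (v \<ominus> v')"
    using assms unfolding a_minus_def by (simp add: M.minus_add M.a_ac)
  then show ?thesis
    using assms hnorm_triangle[of "u \<ominus> u'" "v \<ominus> v'"] by simp
qed

lemma smult_diff:
  assumes "u \<in> carrier H" "v \<in> carrier H"
  shows "a \<odot> (u \<ominus> v) = a \<odot> u \<ominus> a \<odot> v"
  using smult_r_distr[of a u "\<ominus> v"] smult_r_minus[of a v] assms
  by (simp add: a_minus_def ring_of_type_algebra_def)

lemma cinner_diff_bound:
  assumes "u \<in> carrier H" "v \<in> carrier H" "u' \<in> carrier H" "v' \<in> carrier H"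
  shows "cmod (cinner H u v - cinner H u' v')
    \<le> hnorm H u * hnorm H (v \<ominus> v') + hnorm H (u \<ominus> u') * hnorm H v'"
proof -
  have "cinner H u v - cinner H u' v' = cinner H u (v \<ominus> v') + cinner H (u \<ominus> u') v'"
    using assms by (simp add: cinner_diff cinner_diff_right)
  also have "cmod \<dots> \<le> cmod (cinner H u (v \<ominus> v')) + cmod (cinner H (u \<ominus> u') v')"
    by (rule norm_triangle_ineq)
  finally show ?thesis
    using Cauchy_Schwarz[of u "v \<ominus> v'"] Cauchy_Schwarz[of "u \<ominus> u'" v'] assms by simp
qed

end

section \<open>The Hausdorff completion\<close>

definition cauchy_seqs :: "'h hilbert \<Rightarrow> (nat \<Rightarrow> 'h) set" where
  "cauchy_seqs H = {\<nu>. (\<forall>n. \<nu> n \<in> carrier H) \<and>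
     (\<forall>e>0. \<exists>N. \<forall>m\<ge>N. \<forall>n\<ge>N. hnorm H (\<nu> m \<ominus>\<^bsub>H\<^esub> \<nu> n) < e)}"

definition asymptotic :: "'h hilbert \<Rightarrow> (nat \<Rightarrow> 'h) \<Rightarrow> (nat \<Rightarrow> 'h) \<Rightarrow> bool" where
  "asymptotic H \<mu> \<nu> \<longleftrightarrow> (\<lambda>n. hnorm H (\<mu> n \<ominus>\<^bsub>H\<^esub> \<nu> n)) \<longlonglongrightarrow> 0"

text \<open>A point of the completion is a class of asymptotic Cauchy sequences, and it is encoded by a chosen member of the class.
  A sequence that is not Cauchy is sent to the representative of zero. As the map is total, all operations of
  the completion can be defined to depend on their arguments only through it.\<close>
definition limit_rep :: "'h hilbert \<Rightarrow> (nat \<Rightarrow> 'h) \<Rightarrow> nat \<Rightarrow> 'h" where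
  "limit_rep H \<nu> = (SOME \<mu>. \<mu> \<in> cauchy_seqs H \<and>
     asymptotic H \<mu> (if \<nu> \<in> cauchy_seqs H then \<nu> else (\<lambda>_. \<zero>\<^bsub>H\<^esub>)))"

definition completion :: "'h hilbert \<Rightarrow> (nat \<Rightarrow> 'h) hilbert" where
  "completion H = \<lparr>carrier = range (limit_rep H), monoid.mult = (\<lambda>x y. undefined), one = undefined,
     zero = limit_rep H (\<lambda>_. \<zero>\<^bsub>H\<^esub>),
     add = (\<lambda>x y. limit_rep H (\<lambda>n. limit_rep H x n \<oplus>\<^bsub>H\<^esub> limit_rep H y n)),
     smult = (\<lambda>a x. limit_rep H (\<lambda>n. a \<odot>\<^bsub>H\<^esub> limit_rep H x n)),
     cinner = (\<lambda>x y. lim (\<lambda>n. cinner H (limit_rep H x n) (limit_rep H y n)))\<rparr>"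

context semi_inner_space
begin

lemma cauchy_seqsI:
  assumes "\<And>n. \<nu> n \<in> carrier H"
    and "\<And>e. e > 0 \<Longrightarrow> \<exists>N. \<forall>m\<ge>N. \<forall>n\<ge>N. hnorm H (\<nu> m \<ominus> \<nu> n) < e"
  shows "\<nu> \<in> cauchy_seqs H"
  using assms by (simp add: cauchy_seqs_def)

lemma cauchy_seqs_const [simp]: "u \<in> carrier H \<Longrightarrow> (\<lambda>_. u) \<in> cauchy_seqs H"
  by (rule cauchy_seqsI) simp_all

lemma cauchy_seqs_carrier [simp]: "\<nu> \<in> cauchy_seqs H \<Longrightarrow> \<nu> n \<in> carrier H"
  by (simp add: cauchy_seqs_def)

text \<open>Continuity of the linear operations: scalar multiplication and bounded operators act on Cauchy sequences
  termwise, and both are Lipschitz maps.\<close>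
lemma cauchy_seqs_lipschitz:
  assumes \<nu>: "\<nu> \<in> cauchy_seqs H" and T: "\<And>u. u \<in> carrier H \<Longrightarrow> T u \<in> carrier H"
    and C: "\<And>u v. \<lbrakk>u \<in> carrier H; v \<in> carrier H\<rbrakk> \<Longrightarrow> hnorm H (T u \<ominus> T v) \<le> C * hnorm H (u \<ominus> v)"
  shows "(\<lambda>n. T (\<nu> n)) \<in> cauchy_seqs H"
proof -
  have "\<exists>N. \<forall>m\<ge>N. \<forall>n\<ge>N. hnorm H (T (\<nu> m) \<ominus> T (\<nu> n)) < e" if "e > 0" for e :: real
  proof -
    have "e / (\<bar>C\<bar> + 1) > 0" using that by simp
    then obtain N where N: "\<forall>m\<ge>N. \<forall>n\<ge>N. hnorm H (\<nu> m \<ominus> \<nu> n) < e / (\<bar>C\<bar> + 1)"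
      using \<nu> unfolding cauchy_seqs_def by blast
    have "hnorm H (T (\<nu> m) \<ominus> T (\<nu> n)) < e" if "m \<ge> N" "n \<ge> N" for m n
    proof -
      have "hnorm H (T (\<nu> m) \<ominus> T (\<nu> n)) \<le> C * hnorm H (\<nu> m \<ominus> \<nu> n)"
        using \<nu> by (intro C) auto
      also have "\<dots> \<le> (\<bar>C\<bar> + 1) * hnorm H (\<nu> m \<ominus> \<nu> n)"
        using \<nu> by (intro mult_right_mono) auto
      also have "\<dots> < (\<bar>C\<bar> + 1) * (e / (\<bar>C\<bar> + 1))"
        using N that by (intro mult_strict_left_mono) auto
      finally show ?thesis by simp
    qed
    then show ?thesis by blast
  qed
  then show ?thesis by (rule cauchy_seqsI[rotated]) (simp_all add: T \<nu>)
qed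

lemma hnorm_smult_diff:
  "\<lbrakk>u \<in> carrier H; v \<in> carrier H\<rbrakk> \<Longrightarrow> hnorm H (a \<odot> u \<ominus> a \<odot> v) = cmod a * hnorm H (u \<ominus> v)"
  by (simp only: smult_diff[symmetric] hnorm_smult M.minus_closed)

lemma cauchy_seqs_smult [simp]: "\<nu> \<in> cauchy_seqs H \<Longrightarrow> (\<lambda>n. a \<odot> \<nu> n) \<in> cauchy_seqs H"
  by (rule cauchy_seqs_lipschitz[where T = "\<lambda>u. a \<odot> u" and C = "cmod a"])
     (simp_all add: hnorm_smult_diff)

lemma cauchy_seqs_add [simp]:
  assumes "\<mu> \<in> cauchy_seqs H" "\<nu> \<in> cauchy_seqs H"
  shows "(\<lambda>n. \<mu> n \<oplus> \<nu> n) \<in> cauchy_seqs H"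
proof -
  have "\<exists>N. \<forall>m\<ge>N. \<forall>n\<ge>N. hnorm H ((\<mu> m \<oplus> \<nu> m) \<ominus> (\<mu> n \<oplus> \<nu> n)) < e" if e: "e > 0" for e :: real
  proof -
    obtain N N' where N: "\<forall>m\<ge>N. \<forall>n\<ge>N. hnorm H (\<mu> m \<ominus> \<mu> n) < e / 2"
      and N': "\<forall>m\<ge>N'. \<forall>n\<ge>N'. hnorm H (\<nu> m \<ominus> \<nu> n) < e / 2"
      using assms half_gt_zero[OF e] unfolding cauchy_seqs_def by blast
    have "hnorm H ((\<mu> m \<oplus> \<nu> m) \<ominus> (\<mu> n \<oplus> \<nu> n)) < e" if "m \<ge> max N N'" "n \<ge> max N N'" for m n
      using hnorm_diff_add_le[of "\<mu> m" "\<nu> m" "\<mu> n" "\<nu> n"] N[rule_format, of m n] N'[rule_format, of m n]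
        assms that by simp
    then show ?thesis by blast
  qed
  then show ?thesis by (rule cauchy_seqsI[rotated]) (simp_all add: assms)
qed

lemma cauchy_seqs_uminus [simp]: "\<nu> \<in> cauchy_seqs H \<Longrightarrow> (\<lambda>n. \<ominus> \<nu> n) \<in> cauchy_seqs H"
  using cauchy_seqs_smult[of \<nu> "-1"] by (simp add: uminus_eq_smult)

lemma cauchy_seqs_diff [simp]:
  assumes "\<mu> \<in> cauchy_seqs H" "\<nu> \<in> cauchy_seqs H"
  shows "(\<lambda>n. \<mu> n \<ominus> \<nu> n) \<in> cauchy_seqs H"
  using assms by (simp add: a_minus_def)

lemma asymptotic_refl [simp]: "\<nu> \<in> cauchy_seqs H \<Longrightarrow> asymptotic H \<nu> \<nu>"
  by (simp add: asymptotic_def)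

lemma asymptotic_sym:
  "\<lbrakk>asymptotic H \<mu> \<nu>; \<mu> \<in> cauchy_seqs H; \<nu> \<in> cauchy_seqs H\<rbrakk> \<Longrightarrow> asymptotic H \<nu> \<mu>"
  unfolding asymptotic_def by (subst hnorm_diff_commute) auto

lemma tendsto_zero_squeeze:
  fixes f g :: "nat \<Rightarrow> real"
  assumes "g \<longlonglongrightarrow> 0" "\<And>n. 0 \<le> f n" "\<And>n. f n \<le> g n"
  shows "f \<longlonglongrightarrow> 0"
  by (rule tendsto_sandwich[OF _ _ tendsto_const assms(1)]) (use assms in auto)

lemma asymptotic_trans:
  assumes "asymptotic H \<mu> \<nu>" "asymptotic H \<nu> \<rho>"
    "\<mu> \<in> cauchy_seqs H" "\<nu> \<in> cauchy_seqs H" "\<rho> \<in> cauchy_seqs H"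
  shows "asymptotic H \<mu> \<rho>"
  unfolding asymptotic_def
  by (rule tendsto_zero_squeeze[OF tendsto_add[OF assms(1,2)[unfolded asymptotic_def], simplified]])
     (use assms in \<open>auto intro!: hnorm_diff_triangle\<close>)

lemma asymptotic_add:
  assumes "asymptotic H \<mu> \<mu>'" "asymptotic H \<nu> \<nu>'" "\<mu> \<in> cauchy_seqs H" "\<nu> \<in> cauchy_seqs H"
    "\<mu>' \<in> cauchy_seqs H" "\<nu>' \<in> cauchy_seqs H"
  shows "asymptotic H (\<lambda>n. \<mu> n \<oplus> \<nu> n) (\<lambda>n. \<mu>' n \<oplus> \<nu>' n)"
  unfolding asymptotic_def
  by (rule tendsto_zero_squeeze[OF tendsto_add[OF assms(1,2)[unfolded asymptotic_def], simplified]])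
     (use assms in \<open>auto intro!: hnorm_diff_add_le\<close>)

lemma asymptotic_lipschitz:
  assumes "asymptotic H \<mu> \<nu>" "\<mu> \<in> cauchy_seqs H" "\<nu> \<in> cauchy_seqs H"
    and T: "\<And>u. u \<in> carrier H \<Longrightarrow> T u \<in> carrier H"
    and C: "\<And>u v. \<lbrakk>u \<in> carrier H; v \<in> carrier H\<rbrakk> \<Longrightarrow> hnorm H (T u \<ominus> T v) \<le> C * hnorm H (u \<ominus> v)"
  shows "asymptotic H (\<lambda>n. T (\<mu> n)) (\<lambda>n. T (\<nu> n))"
  unfolding asymptotic_def
  by (rule tendsto_zero_squeeze[OF tendsto_mult_right_zero[OF assms(1)[unfolded asymptotic_def], of C]])
     (use assms in auto)

lemma asymptotic_smult:
  assumes "asymptotic H \<mu> \<nu>" "\<mu> \<in> cauchy_seqs H" "\<nu> \<in> cauchy_seqs H"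
  shows "asymptotic H (\<lambda>n. a \<odot> \<mu> n) (\<lambda>n. a \<odot> \<nu> n)"
  by (rule asymptotic_lipschitz[where T = "\<lambda>u. a \<odot> u" and C = "cmod a", OF assms])
     (simp_all add: hnorm_smult_diff)

lemma limit_rep_spec:
  "limit_rep H \<nu> \<in> cauchy_seqs H \<and>
     asymptotic H (limit_rep H \<nu>) (if \<nu> \<in> cauchy_seqs H then \<nu> else (\<lambda>_. \<zero>))"
  unfolding limit_rep_def
  by (rule someI[of _ "if \<nu> \<in> cauchy_seqs H then \<nu> else (\<lambda>_. \<zero>)"]) simp

lemma limit_rep_cauchy [simp]: "limit_rep H \<nu> \<in> cauchy_seqs H"
  using limit_rep_spec by blast

lemma limit_rep_asymptotic: "\<nu> \<in> cauchy_seqs H \<Longrightarrow> asymptotic H (limit_rep H \<nu>) \<nu>"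
  using limit_rep_spec[of \<nu>] by simp

text \<open>This is what makes the completion Hausdorff: asymptotic sequences satisfy the same predicate in the choice of the
  representative, so the representatives are literally equal.\<close>
lemma limit_rep_eq_iff:
  assumes \<mu>: "\<mu> \<in> cauchy_seqs H" and \<nu>: "\<nu> \<in> cauchy_seqs H"
  shows "limit_rep H \<mu> = limit_rep H \<nu> \<longleftrightarrow> asymptotic H \<mu> \<nu>"
proof
  assume "limit_rep H \<mu> = limit_rep H \<nu>"
  then show "asymptotic H \<mu> \<nu>"
    using limit_rep_asymptotic[OF \<mu>] limit_rep_asymptotic[OF \<nu>] assms
    by (metis asymptotic_sym asymptotic_trans limit_rep_cauchy)
next
  assume *: "asymptotic H \<mu> \<nu>"
  have "asymptotic H \<rho> \<mu> \<longleftrightarrow> asymptotic H \<rho> \<nu>" if "\<rho> \<in> cauchy_seqs H" for \<rho>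
    using * that assms by (metis asymptotic_sym asymptotic_trans)
  then have "(\<lambda>\<rho>. \<rho> \<in> cauchy_seqs H \<and> asymptotic H \<rho> \<mu>) = (\<lambda>\<rho>. \<rho> \<in> cauchy_seqs H \<and> asymptotic H \<rho> \<nu>)"
    by auto
  then show "limit_rep H \<mu> = limit_rep H \<nu>"
    using assms by (simp add: limit_rep_def)
qed

lemma limit_rep_idem [simp]: "limit_rep H (limit_rep H \<nu>) = limit_rep H \<nu>"
proof (cases "\<nu> \<in> cauchy_seqs H")
  case True
  then show ?thesis by (simp add: limit_rep_eq_iff limit_rep_asymptotic)
next
  case False
  then have "limit_rep H \<nu> = limit_rep H (\<lambda>_. \<zero>)"
    by (simp add: limit_rep_def)
  moreover have "limit_rep H (limit_rep H (\<lambda>_. \<zero>)) = limit_rep H (\<lambda>_. \<zero>)"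
    by (subst limit_rep_eq_iff) (simp_all add: limit_rep_asymptotic)
  ultimately show ?thesis by simp
qed

lemma carrier_completion: "carrier (completion H) = limit_rep H ` cauchy_seqs H"
  unfolding completion_def by (auto simp: image_iff) (metis limit_rep_idem limit_rep_cauchy)

lemma limit_rep_in_completion [simp]: "limit_rep H \<nu> \<in> carrier (completion H)"
  by (simp add: completion_def)

lemma completionE:
  assumes "x \<in> carrier (completion H)"
  obtains \<nu> where "\<nu> \<in> cauchy_seqs H" "x = limit_rep H \<nu>"
  using assms by (auto simp: carrier_completion)

lemma limit_rep_fixed: "x \<in> carrier (completion H) \<Longrightarrow> limit_rep H x = x"
  by (auto simp: completion_def)

lemma completion_zero: "\<zero>\<^bsub>completion H\<^esub> = limit_rep H (\<lambda>_. \<zero>)"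
  by (simp add: completion_def)

lemma completion_add:
  assumes "\<mu> \<in> cauchy_seqs H" "\<nu> \<in> cauchy_seqs H"
  shows "limit_rep H \<mu> \<oplus>\<^bsub>completion H\<^esub> limit_rep H \<nu> = limit_rep H (\<lambda>n. \<mu> n \<oplus> \<nu> n)"
  using assms by (simp add: completion_def limit_rep_eq_iff asymptotic_add limit_rep_asymptotic)

lemma completion_smult:
  assumes "\<nu> \<in> cauchy_seqs H"
  shows "a \<odot>\<^bsub>completion H\<^esub> limit_rep H \<nu> = limit_rep H (\<lambda>n. a \<odot> \<nu> n)"
  using assms by (simp add: completion_def limit_rep_eq_iff asymptotic_smult limit_rep_asymptotic)

lemma cauchy_seqs_bounded:
  assumes \<nu>: "\<nu> \<in> cauchy_seqs H"
  obtains B where "\<And>n. hnorm H (\<nu> n) \<le> B"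
proof -
  obtain N where N: "\<forall>m\<ge>N. \<forall>n\<ge>N. hnorm H (\<nu> m \<ominus> \<nu> n) < 1"
    using \<nu> zero_less_one unfolding cauchy_seqs_def by blast
  have "hnorm H (\<nu> n) \<le> (\<Sum>k\<le>N. hnorm H (\<nu> k)) + 1" for n
  proof (cases "n \<le> N")
    case True
    then have "hnorm H (\<nu> n) \<le> (\<Sum>k\<le>N. hnorm H (\<nu> k))"
      using \<nu> by (intro member_le_sum) auto
    then show ?thesis by simp
  next
    case False
    have "hnorm H (\<nu> n) \<le> hnorm H (\<nu> N) + 1"
      using hnorm_diff_ge[of "\<nu> n" "\<nu> N"] N[rule_format, of n N] False \<nu> by simp
    also have "hnorm H (\<nu> N) \<le> (\<Sum>k\<le>N. hnorm H (\<nu> k))"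
      using \<nu> by (intro member_le_sum) auto
    finally show ?thesis by simp
  qed
  then show ?thesis using that by blast
qed

lemma cinner_convergent:
  assumes \<mu>: "\<mu> \<in> cauchy_seqs H" and \<nu>: "\<nu> \<in> cauchy_seqs H"
  shows "convergent (\<lambda>n. cinner H (\<mu> n) (\<nu> n))"
proof -
  obtain B where B: "\<And>n. hnorm H (\<mu> n) \<le> B" using \<mu> by (rule cauchy_seqs_bounded) blast
  obtain C where C: "\<And>n. hnorm H (\<nu> n) \<le> C" using \<nu> by (rule cauchy_seqs_bounded) blast
  have pos: "0 \<le> B" "0 \<le> C"
    using order_trans[OF hnorm_nonneg B] order_trans[OF hnorm_nonneg C] assms by auto
  have "Cauchy (\<lambda>n. cinner H (\<mu> n) (\<nu> n))"
  proof (rule CauchyI)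
    fix e :: real assume e: "0 < e"
    \<comment> \<open>The summand 1 keeps the denominator positive if both bounds vanish.\<close>
    define d where "d = e / (B + C + 1)"
    have d: "d > 0" using e pos by (simp add: d_def)
    then obtain N N' where N: "\<forall>m\<ge>N. \<forall>n\<ge>N. hnorm H (\<mu> m \<ominus> \<mu> n) < d"
      and N': "\<forall>m\<ge>N'. \<forall>n\<ge>N'. hnorm H (\<nu> m \<ominus> \<nu> n) < d"
      using assms unfolding cauchy_seqs_def by blast
    have "cmod (cinner H (\<mu> m) (\<nu> m) - cinner H (\<mu> n) (\<nu> n)) < e"
      if "m \<ge> max N N'" "n \<ge> max N N'" for m n
    proof -
      have "cmod (cinner H (\<mu> m) (\<nu> m) - cinner H (\<mu> n) (\<nu> n))
          \<le> hnorm H (\<mu> m) * hnorm H (\<nu> m \<ominus> \<nu> n) + hnorm H (\<mu> m \<ominus> \<mu> n) * hnorm H (\<nu> n)"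
        using assms by (intro cinner_diff_bound) auto
      also have "\<dots> \<le> B * d + d * C"
        using B C N N' that pos d assms by (intro add_mono mult_mono) (auto intro: less_imp_le)
      also have "\<dots> < d * (B + C + 1)" using d by (simp add: algebra_simps)
      also have "\<dots> = e" using pos by (simp add: d_def)
      finally show ?thesis .
    qed
    then show "\<exists>M. \<forall>m\<ge>M. \<forall>n\<ge>M. cmod (cinner H (\<mu> m) (\<nu> m) - cinner H (\<mu> n) (\<nu> n)) < e"
      by blast
  qed
  then show ?thesis by (rule Cauchy_convergent)
qed

lemma completion_cinner:
  assumes \<mu>: "\<mu> \<in> cauchy_seqs H" and \<nu>: "\<nu> \<in> cauchy_seqs H"
  shows "(\<lambda>n. cinner H (\<mu> n) (\<nu> n)) \<longlonglongrightarrow> cinner (completion H) (limit_rep H \<mu>) (limit_rep H \<nu>)"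
proof -
  let ?\<mu> = "limit_rep H \<mu>" and ?\<nu> = "limit_rep H \<nu>"
  obtain B where B: "\<And>n. hnorm H (\<mu> n) \<le> B" using \<mu> by (rule cauchy_seqs_bounded) blast
  obtain C where C: "\<And>n. hnorm H (?\<nu> n) \<le> C" by (rule cauchy_seqs_bounded[OF limit_rep_cauchy]) blast
  have pos: "0 \<le> B" "0 \<le> C"
    using order_trans[OF hnorm_nonneg B] order_trans[OF hnorm_nonneg C] assms by auto
  have lim: "(\<lambda>n. cinner H (?\<mu> n) (?\<nu> n)) \<longlonglongrightarrow> cinner (completion H) ?\<mu> ?\<nu>"
    using cinner_convergent[of ?\<mu> ?\<nu>] by (simp add: completion_def convergent_LIMSEQ_iff)
  have a: "asymptotic H \<mu> ?\<mu>" "asymptotic H \<nu> ?\<nu>"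
    using limit_rep_asymptotic assms by (auto intro: asymptotic_sym)
  have "(\<lambda>n. B * hnorm H (\<nu> n \<ominus> ?\<nu> n) + hnorm H (\<mu> n \<ominus> ?\<mu> n) * C) \<longlonglongrightarrow> B * 0 + 0 * C"
    using a unfolding asymptotic_def by (intro tendsto_intros)
  then have "(\<lambda>n. B * hnorm H (\<nu> n \<ominus> ?\<nu> n) + hnorm H (\<mu> n \<ominus> ?\<mu> n) * C) \<longlonglongrightarrow> 0"
    by simp
  moreover have "cmod (cinner H (\<mu> n) (\<nu> n) - cinner H (?\<mu> n) (?\<nu> n))
      \<le> B * hnorm H (\<nu> n \<ominus> ?\<nu> n) + hnorm H (\<mu> n \<ominus> ?\<mu> n) * C" for n
  proof -
    have "cmod (cinner H (\<mu> n) (\<nu> n) - cinner H (?\<mu> n) (?\<nu> n))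
        \<le> hnorm H (\<mu> n) * hnorm H (\<nu> n \<ominus> ?\<nu> n) + hnorm H (\<mu> n \<ominus> ?\<mu> n) * hnorm H (?\<nu> n)"
      using assms by (intro cinner_diff_bound) auto
    also have "\<dots> \<le> B * hnorm H (\<nu> n \<ominus> ?\<nu> n) + hnorm H (\<mu> n \<ominus> ?\<mu> n) * C"
      using B C pos assms by (intro add_mono mult_mono) auto
    finally show ?thesis .
  qed
  ultimately have "(\<lambda>n. cmod (cinner H (\<mu> n) (\<nu> n) - cinner H (?\<mu> n) (?\<nu> n))) \<longlonglongrightarrow> 0"
    by (rule tendsto_zero_squeeze[OF _ norm_ge_zero])
  then have "(\<lambda>n. cinner H (\<mu> n) (\<nu> n) - cinner H (?\<mu> n) (?\<nu> n)) \<longlonglongrightarrow> 0"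
    by (rule tendsto_norm_zero_cancel)
  from tendsto_add[OF this lim] show ?thesis by simp
qed

lemma completion_hnorm:
  assumes "\<nu> \<in> cauchy_seqs H"
  shows "(\<lambda>n. hnorm H (\<nu> n)) \<longlonglongrightarrow> hnorm (completion H) (limit_rep H \<nu>)"
  unfolding hnorm_def by (intro tendsto_intros completion_cinner assms)

lemma module_completion: "Module.module (ring_of_type_algebra :: complex ring) (completion H)"
proof (rule moduleI)
  show "cring (ring_of_type_algebra :: complex ring)" ..
  show "abelian_group (completion H)"
  proof (rule abelian_groupI)
    fix x y z assume x: "x \<in> carrier (completion H)" and y: "y \<in> carrier (completion H)"
    obtain \<mu> \<nu> where [simp]: "\<mu> \<in> cauchy_seqs H" "x = limit_rep H \<mu>" "\<nu> \<in> cauchy_seqs H" "y = limit_rep H \<nu>"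
      using completionE[OF x] completionE[OF y] by metis
    show "x \<oplus>\<^bsub>completion H\<^esub> y \<in> carrier (completion H)"
      by (simp add: completion_add)
    show "x \<oplus>\<^bsub>completion H\<^esub> y = y \<oplus>\<^bsub>completion H\<^esub> x"
      by (simp add: completion_add M.add.m_comm)
    show "\<zero>\<^bsub>completion H\<^esub> \<oplus>\<^bsub>completion H\<^esub> x = x"
      by (simp add: completion_add completion_zero)
    show "\<exists>y\<in>carrier (completion H). y \<oplus>\<^bsub>completion H\<^esub> x = \<zero>\<^bsub>completion H\<^esub>"
      by (rule bexI[of _ "limit_rep H (\<lambda>n. \<ominus> \<mu> n)"]) (simp_all add: completion_add completion_zero M.l_neg)
    assume z: "z \<in> carrier (completion H)"
    obtain \<rho> where [simp]: "\<rho> \<in> cauchy_seqs H" "z = limit_rep H \<rho>"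
      using completionE[OF z] by metis
    show "x \<oplus>\<^bsub>completion H\<^esub> y \<oplus>\<^bsub>completion H\<^esub> z = x \<oplus>\<^bsub>completion H\<^esub> (y \<oplus>\<^bsub>completion H\<^esub> z)"
      by (simp add: completion_add M.a_assoc)
  qed (simp add: completion_zero)
  fix a b :: complex and x y
  assume x: "x \<in> carrier (completion H)"
  obtain \<mu> where [simp]: "\<mu> \<in> cauchy_seqs H" "x = limit_rep H \<mu>"
    using completionE[OF x] by metis
  show "a \<odot>\<^bsub>completion H\<^esub> x \<in> carrier (completion H)"
    by (simp add: completion_smult)
  show "(a \<oplus>\<^bsub>ring_of_type_algebra\<^esub> b) \<odot>\<^bsub>completion H\<^esub> x = a \<odot>\<^bsub>completion H\<^esub> x \<oplus>\<^bsub>completion H\<^esub> b \<odot>\<^bsub>completion H\<^esub> x"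
    using smult_l_distr[of a b] by (simp add: completion_smult completion_add ring_of_type_algebra_def)
  show "(a \<otimes>\<^bsub>ring_of_type_algebra\<^esub> b) \<odot>\<^bsub>completion H\<^esub> x = a \<odot>\<^bsub>completion H\<^esub> (b \<odot>\<^bsub>completion H\<^esub> x)"
    using smult_assoc1[of a b] by (simp add: completion_smult ring_of_type_algebra_def)
  show "\<one>\<^bsub>ring_of_type_algebra\<^esub> \<odot>\<^bsub>completion H\<^esub> x = x"
    using smult_one by (simp add: completion_smult ring_of_type_algebra_def)
  assume y: "y \<in> carrier (completion H)"
  obtain \<nu> where [simp]: "\<nu> \<in> cauchy_seqs H" "y = limit_rep H \<nu>"
    using completionE[OF y] by metis
  show "a \<odot>\<^bsub>completion H\<^esub> (x \<oplus>\<^bsub>completion H\<^esub> y) = a \<odot>\<^bsub>completion H\<^esub> x \<oplus>\<^bsub>completion H\<^esub> a \<odot>\<^bsub>completion H\<^esub> y"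
    using smult_r_distr[of a] by (simp add: completion_smult completion_add ring_of_type_algebra_def)
qed

lemma semi_inner_space_completion: "semi_inner_space (completion H)"
proof (intro semi_inner_space.intro semi_inner_space_axioms.intro module_completion)
  fix u v w and a :: complex
  assume u: "u \<in> carrier (completion H)"
  obtain \<mu> where \<mu> [simp]: "\<mu> \<in> cauchy_seqs H" and [simp]: "u = limit_rep H \<mu>"
    using completionE[OF u] by metis
  have "(\<lambda>n. Re (cinner H (\<mu> n) (\<mu> n))) \<longlonglongrightarrow> Re (cinner (completion H) u u)"
    by (auto intro!: tendsto_intros completion_cinner)
  then show "0 \<le> Re (cinner (completion H) u u)"
    by (rule LIMSEQ_le_const) (auto intro!: cinner_nonneg)
  assume v: "v \<in> carrier (completion H)"
  obtain \<nu> where \<nu> [simp]: "\<nu> \<in> cauchy_seqs H" and [simp]: "v = limit_rep H \<nu>"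
    using completionE[OF v] by metis
  have uv: "(\<lambda>n. cinner H (\<mu> n) (\<nu> n)) \<longlonglongrightarrow> cinner (completion H) u v"
    by (simp add: completion_cinner)
  have "(\<lambda>n. cinner H (a \<odot> \<mu> n) (\<nu> n)) \<longlonglongrightarrow> cinner (completion H) (a \<odot>\<^bsub>completion H\<^esub> u) v"
    using completion_cinner[of "\<lambda>n. a \<odot> \<mu> n" \<nu>] by (simp add: completion_smult)
  moreover have "(\<lambda>n. cinner H (a \<odot> \<mu> n) (\<nu> n)) \<longlonglongrightarrow> a * cinner (completion H) u v"
    using tendsto_mult_left[OF uv] by (simp add: cinner_smult)
  ultimately show "cinner (completion H) (a \<odot>\<^bsub>completion H\<^esub> u) v = a * cinner (completion H) u v"
    by (rule LIMSEQ_unique)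
  have "(\<lambda>n. cnj (cinner H (\<nu> n) (\<mu> n))) \<longlonglongrightarrow> cnj (cinner (completion H) v u)"
    by (auto intro!: tendsto_intros completion_cinner)
  moreover have "(\<lambda>n. cnj (cinner H (\<nu> n) (\<mu> n))) = (\<lambda>n. cinner H (\<mu> n) (\<nu> n))"
    using cinner_commute[of "\<mu> _" "\<nu> _"] by auto
  ultimately show "cinner (completion H) u v = cnj (cinner (completion H) v u)"
    using LIMSEQ_unique uv by metis
  assume w: "w \<in> carrier (completion H)"
  obtain \<rho> where \<rho> [simp]: "\<rho> \<in> cauchy_seqs H" and [simp]: "w = limit_rep H \<rho>"
    using completionE[OF w] by metis
  have "(\<lambda>n. cinner H (\<mu> n \<oplus> \<nu> n) (\<rho> n)) \<longlonglongrightarrow> cinner (completion H) (u \<oplus>\<^bsub>completion H\<^esub> v) w"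
    using completion_cinner[of "\<lambda>n. \<mu> n \<oplus> \<nu> n" \<rho>] by (simp add: completion_add)
  moreover have "(\<lambda>n. cinner H (\<mu> n \<oplus> \<nu> n) (\<rho> n)) \<longlonglongrightarrow> cinner (completion H) u w + cinner (completion H) v w"
    using tendsto_add[OF completion_cinner[OF \<mu> \<rho>] completion_cinner[OF \<nu> \<rho>]] by (simp add: cinner_add)
  ultimately show "cinner (completion H) (u \<oplus>\<^bsub>completion H\<^esub> v) w
      = cinner (completion H) u w + cinner (completion H) v w"
    by (rule LIMSEQ_unique)
qed

text \<open>The additive inverse in an abelian group is given by a definite description, which is junk for most arguments
  outside the carrier. Here it is determined everywhere, because addition sees its arguments only through
  \<^const>\<open>limit_rep\<close>.\<close>
lemma completion_uminus: "\<ominus>\<^bsub>completion H\<^esub> x = limit_rep H (\<lambda>n. \<ominus> limit_rep H x n)"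
proof -
  interpret C: Module.module "ring_of_type_algebra :: complex ring" "completion H"
    by (rule module_completion)
  have [simp]: "add (completion H) x y = limit_rep H x \<oplus>\<^bsub>completion H\<^esub> y"
    "add (completion H) y x = y \<oplus>\<^bsub>completion H\<^esub> limit_rep H x" for y
    by (simp_all add: completion_def)
  have "\<ominus>\<^bsub>completion H\<^esub> x = \<ominus>\<^bsub>completion H\<^esub> (limit_rep H x)"
    by (simp add: a_inv_def m_inv_def)
  also have "\<dots> = limit_rep H (\<lambda>n. \<ominus> limit_rep H x n)"
    by (rule C.M.minus_equality)
      (use completion_add[of "\<lambda>n. \<ominus> limit_rep H x n" "limit_rep H x"] in
        \<open>simp_all add: completion_zero M.l_neg\<close>)
  finally show ?thesis .
qed

lemma completion_diff:
  "x \<ominus>\<^bsub>completion H\<^esub> y = limit_rep H (\<lambda>n. limit_rep H x n \<ominus> limit_rep H y n)"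
proof -
  have "x \<ominus>\<^bsub>completion H\<^esub> y = limit_rep H x \<oplus>\<^bsub>completion H\<^esub> limit_rep H (\<lambda>n. \<ominus> limit_rep H y n)"
    unfolding a_minus_def completion_uminus by (simp add: completion_def)
  also have "\<dots> = limit_rep H (\<lambda>n. limit_rep H x n \<oplus> \<ominus> limit_rep H y n)"
    using completion_add[of "limit_rep H x" "\<lambda>n. \<ominus> limit_rep H y n"] by simp
  finally show ?thesis by (simp add: a_minus_def)
qed

lemma completion_dist:
  assumes "\<mu> \<in> cauchy_seqs H" "\<nu> \<in> cauchy_seqs H"
  shows "(\<lambda>n. hnorm H (\<mu> n \<ominus> \<nu> n))
    \<longlonglongrightarrow> hnorm (completion H) (limit_rep H \<mu> \<ominus>\<^bsub>completion H\<^esub> limit_rep H \<nu>)"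
proof -
  have "limit_rep H \<mu> \<ominus>\<^bsub>completion H\<^esub> limit_rep H \<nu> = limit_rep H (\<lambda>n. \<mu> n \<ominus> \<nu> n)"
    unfolding completion_diff using assms
    by (simp add: limit_rep_eq_iff a_minus_def asymptotic_add asymptotic_smult uminus_eq_smult limit_rep_asymptotic)
  then show ?thesis using completion_hnorm[of "\<lambda>n. \<mu> n \<ominus> \<nu> n"] assms by simp
qed

text \<open>The distance of a metric space must be nonnegative and symmetric on the whole type. Outside the carrier this
  relies on \<open>completion_diff\<close>, which holds for all arguments.\<close>
lemma Metric_space_completion:
  "Metric_space (carrier (completion H)) (\<lambda>u v. hnorm (completion H) (u \<ominus>\<^bsub>completion H\<^esub> v))"
proof -
  interpret C: semi_inner_space "completion H"
    by (rule semi_inner_space_completion)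
  have d: "hnorm (completion H) (x \<ominus>\<^bsub>completion H\<^esub> y)
      = hnorm (completion H) (limit_rep H x \<ominus>\<^bsub>completion H\<^esub> limit_rep H y)" for x y
    by (simp add: completion_diff)
  show ?thesis
  proof
    fix x y
    show "0 \<le> hnorm (completion H) (x \<ominus>\<^bsub>completion H\<^esub> y)"
      by (subst d) simp
    show "hnorm (completion H) (x \<ominus>\<^bsub>completion H\<^esub> y) = hnorm (completion H) (y \<ominus>\<^bsub>completion H\<^esub> x)"
      unfolding d[of x y] d[of y x] by (simp add: C.hnorm_diff_commute)
    assume "x \<in> carrier (completion H)" "y \<in> carrier (completion H)"
    then obtain \<mu> \<nu> where *: "\<mu> \<in> cauchy_seqs H" "x = limit_rep H \<mu>" "\<nu> \<in> cauchy_seqs H" "y = limit_rep H \<nu>"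
      by (metis completionE)
    show "hnorm (completion H) (x \<ominus>\<^bsub>completion H\<^esub> y) = 0 \<longleftrightarrow> x = y"
      using * completion_dist[of \<mu> \<nu>] LIMSEQ_unique
      by (fastforce simp: limit_rep_eq_iff asymptotic_def)
  qed (use C.hnorm_diff_triangle in blast)
qed

lemma limit_rep_const_dist:
  "\<lbrakk>u \<in> carrier H; v \<in> carrier H\<rbrakk>
    \<Longrightarrow> hnorm (completion H) (limit_rep H (\<lambda>_. u) \<ominus>\<^bsub>completion H\<^esub> limit_rep H (\<lambda>_. v)) = hnorm H (u \<ominus> v)"
  using completion_dist[of "\<lambda>_. u" "\<lambda>_. v"] by (simp add: LIMSEQ_const_iff)

lemma hnorm_limit_rep_const:
  "u \<in> carrier H \<Longrightarrow> hnorm (completion H) (limit_rep H (\<lambda>_. u)) = hnorm H u"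
  using completion_hnorm[of "\<lambda>_. u"] by (simp add: LIMSEQ_const_iff)

lemma completion_dist_le:
  assumes "\<mu> \<in> cauchy_seqs H" "\<nu> \<in> cauchy_seqs H" "\<And>n. n \<ge> N \<Longrightarrow> hnorm H (\<mu> n \<ominus> \<nu> n) \<le> e"
  shows "hnorm (completion H) (limit_rep H \<mu> \<ominus>\<^bsub>completion H\<^esub> limit_rep H \<nu>) \<le> e"
  by (rule LIMSEQ_le_const2[OF completion_dist]) (use assms in auto)

text \<open>Diagonal argument: from the \<open>k\<close>-th term of a Cauchy sequence in the completion, itself a Cauchy sequence
  in the original space, take an entry \<open>\<delta>\<^sub>k\<close> beyond which all entries are within \<open>1/(k+1)\<close> of each other.
  Then \<open>\<delta>\<close> is Cauchy, and its class is the limit.\<close>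
lemma mcomplete_completion:
  "Metric_space.mcomplete (carrier (completion H)) (\<lambda>u v. hnorm (completion H) (u \<ominus>\<^bsub>completion H\<^esub> v))"
proof -
  let ?d = "\<lambda>u v. hnorm (completion H) (u \<ominus>\<^bsub>completion H\<^esub> v)"
  interpret C: Metric_space "carrier (completion H)" ?d
    by (rule Metric_space_completion)
  define \<iota> where "\<iota> u = limit_rep H (\<lambda>_. u)" for u
  show ?thesis
    unfolding C.mcomplete_def
  proof (intro allI impI)
    fix \<sigma> assume \<sigma>: "C.MCauchy \<sigma>"
    then have car: "\<sigma> k \<in> carrier (completion H)" for k
      by (auto simp: C.MCauchy_def)
    have fix_\<sigma>: "limit_rep H (\<sigma> k) = \<sigma> k" for k
      using car by (rule limit_rep_fixed)
    have seq: "\<sigma> k \<in> cauchy_seqs H" for k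
      using fix_\<sigma>[of k] limit_rep_cauchy[of "\<sigma> k"] by simp
    have "\<exists>N. \<forall>m\<ge>N. \<forall>n\<ge>N. hnorm H (\<sigma> k m \<ominus> \<sigma> k n) < 1 / real (Suc k)" for k
      using seq[of k] unfolding cauchy_seqs_def by simp
    then obtain N where N: "\<And>k m n. \<lbrakk>m \<ge> N k; n \<ge> N k\<rbrakk> \<Longrightarrow> hnorm H (\<sigma> k m \<ominus> \<sigma> k n) < 1 / real (Suc k)"
      by metis
    define \<delta> where "\<delta> k = \<sigma> k (N k)" for k
    have \<delta>_car [simp]: "\<delta> k \<in> carrier H" for k
      using seq by (simp add: \<delta>_def)
    have \<iota>_car [simp]: "\<iota> u \<in> carrier (completion H)" for u
      by (simp add: \<iota>_def)
    \<comment> \<open>The original space, embedded by constant sequences, is dense.\<close>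
    have near: "?d (\<sigma> k) (\<iota> (\<delta> k)) \<le> 1 / real (Suc k)" for k
      using completion_dist_le[OF seq[of k] cauchy_seqs_const[OF \<delta>_car], of "N k" k "1 / real (Suc k)"]
        N[of k _ "N k"] by (simp add: fix_\<sigma> \<iota>_def \<delta>_def less_imp_le)
    have \<delta>: "\<delta> \<in> cauchy_seqs H"
    proof (rule cauchy_seqsI[OF \<delta>_car])
      fix e :: real assume e: "e > 0"
      then obtain M where M: "\<And>k l. \<lbrakk>k \<ge> M; l \<ge> M\<rbrakk> \<Longrightarrow> ?d (\<sigma> k) (\<sigma> l) < e / 3"
        using \<sigma> unfolding C.MCauchy_def by (metis zero_less_divide_iff zero_less_numeral)
      obtain K where K: "1 / real (Suc K) < e / 3"
        using e nat_approx_posE[of "e / 3"] by (metis zero_less_divide_iff zero_less_numeral)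
      have "hnorm H (\<delta> k \<ominus> \<delta> l) < e" if kl: "k \<ge> max M K" "l \<ge> max M K" for k l
      proof -
        have small: "1 / real (Suc j) < e / 3" if "j \<ge> K" for j
          by (rule order.strict_trans1[OF _ K]) (use that in \<open>simp add: frac_le\<close>)
        have "hnorm H (\<delta> k \<ominus> \<delta> l) = ?d (\<iota> (\<delta> k)) (\<iota> (\<delta> l))"
          by (simp add: \<iota>_def limit_rep_const_dist)
        also have "\<dots> \<le> ?d (\<iota> (\<delta> k)) (\<sigma> k) + ?d (\<sigma> k) (\<iota> (\<delta> l))"
          by (rule C.triangle) (simp_all add: car)
        also have "?d (\<sigma> k) (\<iota> (\<delta> l)) \<le> ?d (\<sigma> k) (\<sigma> l) + ?d (\<sigma> l) (\<iota> (\<delta> l))"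
          by (rule C.triangle) (simp_all add: car)
        finally show ?thesis
          using near[of k] near[of l] M[of k l] small[of k] small[of l] kl
            C.commute[of "\<iota> (\<delta> k)" "\<sigma> k"] by simp
      qed
      then show "\<exists>N. \<forall>m\<ge>N. \<forall>n\<ge>N. hnorm H (\<delta> m \<ominus> \<delta> n) < e"
        by blast
    qed
    have "\<exists>M. \<forall>k\<ge>M. ?d (\<sigma> k) (limit_rep H \<delta>) < e" if e: "e > 0" for e :: real
    proof -
      have "e / 3 > 0" using e by simp
      then obtain M where M: "\<forall>m\<ge>M. \<forall>n\<ge>M. hnorm H (\<delta> m \<ominus> \<delta> n) < e / 3"
        using \<delta> unfolding cauchy_seqs_def by blast
      obtain K where K: "1 / real (Suc K) < e / 3"
        using e nat_approx_posE[of "e / 3"] by (metis zero_less_divide_iff zero_less_numeral)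
      have "?d (\<sigma> k) (limit_rep H \<delta>) < e" if k: "k \<ge> max M K" for k
      proof -
        have small: "1 / real (Suc k) < e / 3"
          by (rule order.strict_trans1[OF _ K]) (use k in \<open>simp add: frac_le\<close>)
        have "?d (\<sigma> k) (limit_rep H \<delta>) \<le> ?d (\<sigma> k) (\<iota> (\<delta> k)) + ?d (\<iota> (\<delta> k)) (limit_rep H \<delta>)"
          by (rule C.triangle) (simp_all add: car)
        also have "?d (\<iota> (\<delta> k)) (limit_rep H \<delta>) \<le> e / 3"
          unfolding \<iota>_def using k by (intro completion_dist_le[OF _ \<delta>, of _ M]) (use M in \<open>auto intro: less_imp_le\<close>)
        finally show ?thesis
          using near[of k] small e by simp
      qed
      then show ?thesis by blast
    qed
    then have "limitin C.mtopology \<sigma> (limit_rep H \<delta>) sequentially"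
      by (simp add: C.limit_metric_sequentially car)
    then show "\<exists>x. limitin C.mtopology \<sigma> x sequentially"
      by (intro exI[of _ "limit_rep H \<delta>"])
  qed
qed

theorem hilbert_space_completion: "hilbert_space (completion H)"
proof -
  interpret C: semi_inner_space "completion H"
    by (rule semi_inner_space_completion)
  have "u = \<zero>\<^bsub>completion H\<^esub>" if u: "u \<in> carrier (completion H)" and 0: "cinner (completion H) u u = 0" for u
  proof -
    obtain \<nu> where \<nu>: "\<nu> \<in> cauchy_seqs H" "u = limit_rep H \<nu>"
      using completionE[OF u] by metis
    have "hnorm (completion H) u = 0"
      by (simp add: hnorm_def 0)
    then have "asymptotic H \<nu> (\<lambda>_. \<zero>)"
      using completion_hnorm[OF \<nu>(1)] \<nu> by (simp add: asymptotic_def)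
    then show ?thesis
      using \<nu> by (simp add: completion_zero limit_rep_eq_iff)
  qed
  then show ?thesis
    by (intro hilbert_space.intro hilbert_space_axioms.intro module_completion mcomplete_completion
        C.cinner_add C.cinner_smult C.cinner_commute C.cinner_nonneg)
qed

end

section \<open>Operators and their extension to the completion\<close>

definition extend_op :: "'h hilbert \<Rightarrow> ('h \<Rightarrow> 'h) \<Rightarrow> (nat \<Rightarrow> 'h) \<Rightarrow> nat \<Rightarrow> 'h" where
  "extend_op H T x = limit_rep H (\<lambda>n. T (limit_rep H x n))"

lemma bounded_operatorD:
  assumes "bounded_operator H T"
  shows "u \<in> carrier H \<Longrightarrow> T u \<in> carrier H"
    and "\<lbrakk>u \<in> carrier H; v \<in> carrier H\<rbrakk> \<Longrightarrow> T (u \<oplus>\<^bsub>H\<^esub> v) = T u \<oplus>\<^bsub>H\<^esub> T v"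
    and "u \<in> carrier H \<Longrightarrow> T (a \<odot>\<^bsub>H\<^esub> u) = a \<odot>\<^bsub>H\<^esub> T u"
  using assms by (auto simp: bounded_operator_def)

lemma star_homD:
  assumes "star_hom G H \<pi>" "f \<in> steinberg_algebra G"
  shows "bounded_operator H (\<pi> f)"
    and "\<lbrakk>g \<in> steinberg_algebra G; u \<in> carrier H\<rbrakk> \<Longrightarrow> \<pi> (\<lambda>x. f x + g x) u = \<pi> f u \<oplus>\<^bsub>H\<^esub> \<pi> g u"
    and "u \<in> carrier H \<Longrightarrow> \<pi> (\<lambda>x. a * f x) u = a \<odot>\<^bsub>H\<^esub> \<pi> f u"
    and "\<lbrakk>g \<in> steinberg_algebra G; u \<in> carrier H\<rbrakk> \<Longrightarrow> \<pi> (convolution G f g) u = \<pi> f (\<pi> g u)"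
    and "\<lbrakk>u \<in> carrier H; v \<in> carrier H\<rbrakk> \<Longrightarrow> cinner H (\<pi> (involution G f) u) v = cinner H u (\<pi> f v)"
  using assms unfolding star_hom_def is_adjoint_def by blast+

context semi_inner_space
begin

lemma bounded_operator_diff:
  assumes T: "bounded_operator H T" and "u \<in> carrier H" "v \<in> carrier H"
  shows "T (u \<ominus> v) = T u \<ominus> T v"
  using assms bounded_operatorD[OF T] by (simp add: a_minus_def uminus_eq_smult)

lemma bounded_operator_lipschitz:
  assumes T: "bounded_operator H T"
  obtains C where "\<And>u v. \<lbrakk>u \<in> carrier H; v \<in> carrier H\<rbrakk> \<Longrightarrow> hnorm H (T u \<ominus> T v) \<le> C * hnorm H (u \<ominus> v)"
proof -
  obtain C where C: "\<forall>u\<in>carrier H. hnorm H (T u) \<le> C * hnorm H u"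
    using T by (auto simp: bounded_operator_def)
  have "hnorm H (T u \<ominus> T v) \<le> C * hnorm H (u \<ominus> v)" if "u \<in> carrier H" "v \<in> carrier H" for u v
    using C[rule_format, of "u \<ominus> v"] that by (simp add: bounded_operator_diff[OF T])
  then show ?thesis using that by blast
qed

lemma operator_norm_bdd:
  assumes T: "bounded_operator H T"
  shows "bdd_above {hnorm H (T u) | u. u \<in> carrier H \<and> hnorm H u \<le> 1}"
proof -
  obtain C where C: "\<forall>u\<in>carrier H. hnorm H (T u) \<le> C * hnorm H u"
    using T by (auto simp: bounded_operator_def)
  have "hnorm H (T u) \<le> \<bar>C\<bar>" if u: "u \<in> carrier H" "hnorm H u \<le> 1" for u
  proof -
    have "hnorm H (T u) \<le> C * hnorm H u" using C u by blast
    also have "\<dots> \<le> \<bar>C\<bar> * hnorm H u" using u by (intro mult_right_mono) auto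
    also have "\<dots> \<le> \<bar>C\<bar> * 1" using u by (intro mult_left_mono) auto
    finally show ?thesis by simp
  qed
  then show ?thesis by (intro bdd_aboveI[where M = "\<bar>C\<bar>"]) auto
qed

lemma operator_norm_upper:
  assumes "bounded_operator H T" "u \<in> carrier H" "hnorm H u \<le> 1"
  shows "hnorm H (T u) \<le> operator_norm H T"
  unfolding operator_norm_def by (rule cSup_upper) (use assms operator_norm_bdd in auto)

lemma operator_norm_least:
  assumes "\<And>u. \<lbrakk>u \<in> carrier H; hnorm H u \<le> 1\<rbrakk> \<Longrightarrow> hnorm H (T u) \<le> C"
  shows "operator_norm H T \<le> C"
  unfolding operator_norm_def
proof (rule cSup_least)
  have "hnorm H (T \<zero>) \<in> {hnorm H (T u) | u. u \<in> carrier H \<and> hnorm H u \<le> 1}"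
    by (rule CollectI, rule exI[of _ \<zero>]) simp
  then show "{hnorm H (T u) | u. u \<in> carrier H \<and> hnorm H u \<le> 1} \<noteq> {}" by blast
qed (use assms in auto)

lemma operator_norm_nonneg:
  assumes "bounded_operator H T"
  shows "0 \<le> operator_norm H T"
  using operator_norm_upper[OF assms, of \<zero>] hnorm_nonneg[OF bounded_operatorD(1)[OF assms, of \<zero>]]
  by simp

text \<open>A vector of norm zero cannot be normalised, but a bounded operator maps it to a vector of norm zero.\<close>
lemma operator_norm_bound:
  assumes T: "bounded_operator H T" and u: "u \<in> carrier H"
  shows "hnorm H (T u) \<le> operator_norm H T * hnorm H u"
proof (cases "hnorm H u = 0")
  case True
  obtain C where "\<forall>u\<in>carrier H. hnorm H (T u) \<le> C * hnorm H u"
    using T by (auto simp: bounded_operator_def)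
  then show ?thesis using True u by force
next
  case False
  then have pos: "hnorm H u > 0" using hnorm_nonneg[OF u] by simp
  define a where "a = complex_of_real (1 / hnorm H u)"
  have a: "cmod a = 1 / hnorm H u" using pos by (simp add: a_def norm_divide)
  have "hnorm H (T (a \<odot> u)) \<le> operator_norm H T"
    using pos u by (intro operator_norm_upper T) (simp_all add: hnorm_smult a)
  then have "cmod a * hnorm H (T u) \<le> operator_norm H T"
    using bounded_operatorD[OF T] u by (simp add: hnorm_smult)
  then show ?thesis using pos by (simp add: a divide_le_eq)
qed

lemma operator_norm_cong: "(\<And>u. u \<in> carrier H \<Longrightarrow> S u = T u) \<Longrightarrow> operator_norm H S = operator_norm H T"
  unfolding operator_norm_def by (rule arg_cong[where f = Sup]) (auto, metis+)

lemma operator_norm_adjoint_le: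
  assumes S: "bounded_operator H S" and T: "bounded_operator H T" and adj: "is_adjoint H S T"
  shows "operator_norm H S \<le> operator_norm H T"
proof (rule operator_norm_least)
  fix u assume u: "u \<in> carrier H" "hnorm H u \<le> 1"
  have Su: "S u \<in> carrier H" using S u by (simp add: bounded_operatorD)
  have "(hnorm H (S u))\<^sup>2 = cmod (cinner H (S u) (S u))"
    using cinner_self[OF Su] by (simp add: norm_power)
  also have "\<dots> = cmod (cinner H u (T (S u)))"
    using adj u Su by (simp add: is_adjoint_def)
  also have "\<dots> \<le> hnorm H u * hnorm H (T (S u))"
    using u Su T by (intro Cauchy_Schwarz) (simp_all add: bounded_operatorD)
  also have "\<dots> \<le> 1 * (operator_norm H T * hnorm H (S u))"
    using u Su T by (intro mult_mono operator_norm_bound) (simp_all add: bounded_operatorD)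
  finally have "hnorm H (S u) * hnorm H (S u) \<le> operator_norm H T * hnorm H (S u)"
    by (simp add: power2_eq_square)
  then show "hnorm H (S u) \<le> operator_norm H T"
    using Su operator_norm_nonneg[OF T] hnorm_nonneg[OF Su] by (cases "hnorm H (S u) = 0") auto
qed

text \<open>The C*-identity for operators, from \<open>\<parallel>Tu\<parallel>\<^sup>2 = \<langle>S T u, u\<rangle>\<close> and from \<open>\<parallel>S\<parallel> \<le> \<parallel>T\<parallel>\<close>.\<close>
lemma operator_norm_adjoint_comp:
  assumes S: "bounded_operator H S" and T: "bounded_operator H T" and adj: "is_adjoint H S T"
  shows "operator_norm H (\<lambda>u. S (T u)) = (operator_norm H T)\<^sup>2"
proof (rule antisym)
  show "operator_norm H (\<lambda>u. S (T u)) \<le> (operator_norm H T)\<^sup>2"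
  proof (rule operator_norm_least)
    fix u assume u: "u \<in> carrier H" "hnorm H u \<le> 1"
    have "hnorm H (S (T u)) \<le> operator_norm H S * hnorm H (T u)"
      using S T u by (intro operator_norm_bound) (simp_all add: bounded_operatorD)
    also have "\<dots> \<le> operator_norm H T * operator_norm H T"
      using S T u by (intro mult_mono operator_norm_adjoint_le adj operator_norm_upper)
        (simp_all add: bounded_operatorD operator_norm_nonneg)
    finally show "hnorm H (S (T u)) \<le> (operator_norm H T)\<^sup>2"
      by (simp add: power2_eq_square)
  qed
  have bdd: "bounded_operator H (\<lambda>u. S (T u))"
  proof -
    have "hnorm H (S (T u)) \<le> (operator_norm H S * operator_norm H T) * hnorm H u" if u: "u \<in> carrier H" for u
      using operator_norm_bound[OF S, of "T u"] operator_norm_bound[OF T u] operator_norm_nonneg[OF S]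
        mult_left_mono[OF operator_norm_bound[OF T u] operator_norm_nonneg[OF S]] T u
      by (simp add: bounded_operatorD mult.assoc)
    then show ?thesis
      using S T unfolding bounded_operator_def by (auto simp: Pi_iff)
  qed
  have "operator_norm H T \<le> sqrt (operator_norm H (\<lambda>u. S (T u)))"
  proof (rule operator_norm_least)
    fix u assume u: "u \<in> carrier H" "hnorm H u \<le> 1"
    have Tu: "T u \<in> carrier H" "S (T u) \<in> carrier H" using S T u by (simp_all add: bounded_operatorD)
    have "(hnorm H (T u))\<^sup>2 = cmod (cinner H (T u) (T u))"
      using cinner_self[OF Tu(1)] by (simp add: norm_power)
    also have "\<dots> = cmod (cinner H (S (T u)) u)"
      using adj u Tu by (simp add: is_adjoint_def)
    also have "\<dots> \<le> hnorm H (S (T u)) * hnorm H u"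
      using u Tu by (intro Cauchy_Schwarz)
    also have "\<dots> \<le> operator_norm H (\<lambda>u. S (T u)) * 1"
      using u Tu operator_norm_upper[OF bdd, of u] operator_norm_nonneg[OF bdd] by (intro mult_mono) auto
    finally show "hnorm H (T u) \<le> sqrt (operator_norm H (\<lambda>u. S (T u)))"
      using Tu by (simp add: real_le_rsqrt)
  qed
  then have "(operator_norm H T)\<^sup>2 \<le> (sqrt (operator_norm H (\<lambda>u. S (T u))))\<^sup>2"
    by (rule power_mono) (rule operator_norm_nonneg[OF T])
  then show "(operator_norm H T)\<^sup>2 \<le> operator_norm H (\<lambda>u. S (T u))"
    using operator_norm_nonneg[OF bdd] by simp
qed

lemma cauchy_seqs_op:
  assumes T: "bounded_operator H T" and \<nu>: "\<nu> \<in> cauchy_seqs H"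
  shows "(\<lambda>n. T (\<nu> n)) \<in> cauchy_seqs H"
proof -
  obtain C where C: "\<And>u v. \<lbrakk>u \<in> carrier H; v \<in> carrier H\<rbrakk> \<Longrightarrow> hnorm H (T u \<ominus> T v) \<le> C * hnorm H (u \<ominus> v)"
    using T by (rule bounded_operator_lipschitz) blast
  show ?thesis
    by (rule cauchy_seqs_lipschitz[OF \<nu> _ C]) (use T in \<open>simp_all add: bounded_operatorD\<close>)
qed

lemma extend_op_limit_rep:
  assumes T: "bounded_operator H T" and \<nu>: "\<nu> \<in> cauchy_seqs H"
  shows "extend_op H T (limit_rep H \<nu>) = limit_rep H (\<lambda>n. T (\<nu> n))"
proof -
  obtain C where C: "\<And>u v. \<lbrakk>u \<in> carrier H; v \<in> carrier H\<rbrakk> \<Longrightarrow> hnorm H (T u \<ominus> T v) \<le> C * hnorm H (u \<ominus> v)"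
    using T by (rule bounded_operator_lipschitz) blast
  have "asymptotic H (\<lambda>n. T (limit_rep H \<nu> n)) (\<lambda>n. T (\<nu> n))"
    by (rule asymptotic_lipschitz[OF limit_rep_asymptotic[OF \<nu>] limit_rep_cauchy \<nu> _ C])
      (use T in \<open>simp_all add: bounded_operatorD\<close>)
  then show ?thesis
    using T \<nu> by (simp add: extend_op_def limit_rep_eq_iff cauchy_seqs_op)
qed

lemma bounded_extend_op:
  assumes T: "bounded_operator H T"
  shows "bounded_operator (completion H) (extend_op H T)"
proof -
  obtain C where C: "\<forall>u\<in>carrier H. hnorm H (T u) \<le> C * hnorm H u"
    using T by (auto simp: bounded_operator_def)
  note T' = bounded_operatorD[OF T]
  show ?thesis
    unfolding bounded_operator_def
  proof (intro conjI ballI allI exI[of _ C])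
    show "extend_op H T \<in> carrier (completion H) \<rightarrow> carrier (completion H)"
      by (simp add: extend_op_def)
  next
    fix x y assume x: "x \<in> carrier (completion H)" and y: "y \<in> carrier (completion H)"
    obtain \<mu> \<nu> where *: "\<mu> \<in> cauchy_seqs H" "x = limit_rep H \<mu>" "\<nu> \<in> cauchy_seqs H" "y = limit_rep H \<nu>"
      using completionE[OF x] completionE[OF y] by metis
    then show "extend_op H T (x \<oplus>\<^bsub>completion H\<^esub> y) = extend_op H T x \<oplus>\<^bsub>completion H\<^esub> extend_op H T y"
      using T by (simp add: extend_op_limit_rep completion_add cauchy_seqs_op T')
  next
    fix a x assume x: "x \<in> carrier (completion H)"
    obtain \<mu> where *: "\<mu> \<in> cauchy_seqs H" "x = limit_rep H \<mu>"
      using completionE[OF x] by metis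
    then show "extend_op H T (a \<odot>\<^bsub>completion H\<^esub> x) = a \<odot>\<^bsub>completion H\<^esub> extend_op H T x"
      using T by (simp add: extend_op_limit_rep completion_smult cauchy_seqs_op T')
  next
    fix x assume x: "x \<in> carrier (completion H)"
    obtain \<mu> where *: "\<mu> \<in> cauchy_seqs H" "x = limit_rep H \<mu>"
      using completionE[OF x] by metis
    have "(\<lambda>n. hnorm H (T (\<mu> n))) \<longlonglongrightarrow> hnorm (completion H) (extend_op H T x)"
      using completion_hnorm[OF cauchy_seqs_op[OF T *(1)]] T * by (simp add: extend_op_limit_rep)
    moreover have "(\<lambda>n. C * hnorm H (\<mu> n)) \<longlonglongrightarrow> C * hnorm (completion H) x"
      using * by (intro tendsto_intros) (simp add: completion_hnorm)
    ultimately show "hnorm (completion H) (extend_op H T x) \<le> C * hnorm (completion H) x"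
      by (rule LIMSEQ_le) (use C * in auto)
  qed
qed

text \<open>Every identity required of a representation holds termwise for Cauchy sequences. By the closure
  properties of the algebra, \<open>\<pi>\<close> is bounded on all the functions involved, and its extension is given there by continuity.\<close>
lemma star_hom_completion:
  assumes \<pi>: "star_hom G H \<pi>"
    and conv: "\<And>f g. \<lbrakk>f \<in> steinberg_algebra G; g \<in> steinberg_algebra G\<rbrakk> \<Longrightarrow> convolution G f g \<in> steinberg_algebra G"
    and inv: "\<And>f. f \<in> steinberg_algebra G \<Longrightarrow> involution G f \<in> steinberg_algebra G"
    and add: "\<And>f g. \<lbrakk>f \<in> steinberg_algebra G; g \<in> steinberg_algebra G\<rbrakk> \<Longrightarrow> (\<lambda>x. f x + g x) \<in> steinberg_algebra G"
    and scale: "\<And>a f. f \<in> steinberg_algebra G \<Longrightarrow> (\<lambda>x. a * f x) \<in> steinberg_algebra G"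
  shows "star_hom G (completion H) (\<lambda>f. extend_op H (\<pi> f))"
proof -
  note [simp] = conv inv add scale
  note b = star_homD(1)[OF \<pi>]
  have ext: "extend_op H (\<pi> f) (limit_rep H \<nu>) = limit_rep H (\<lambda>n. \<pi> f (\<nu> n))"
    and seq: "(\<lambda>n. \<pi> f (\<nu> n)) \<in> cauchy_seqs H"
    if "f \<in> steinberg_algebra G" "\<nu> \<in> cauchy_seqs H" for f \<nu>
    using that by (simp_all add: extend_op_limit_rep cauchy_seqs_op b)
  show ?thesis
    unfolding star_hom_def is_adjoint_def
  proof (intro conjI ballI allI)
    fix f assume f: "f \<in> steinberg_algebra G"
    then show "bounded_operator (completion H) (extend_op H (\<pi> f))"
      by (intro bounded_extend_op b)
    fix g x assume g: "g \<in> steinberg_algebra G" and x: "x \<in> carrier (completion H)"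
    obtain \<mu> where \<mu>: "\<mu> \<in> cauchy_seqs H" "x = limit_rep H \<mu>"
      using completionE[OF x] by metis
    show "extend_op H (\<pi> (\<lambda>x. f x + g x)) x = extend_op H (\<pi> f) x \<oplus>\<^bsub>completion H\<^esub> extend_op H (\<pi> g) x"
      using f g \<mu> by (simp add: ext completion_add seq star_homD(2)[OF \<pi>])
    show "extend_op H (\<pi> (convolution G f g)) x = extend_op H (\<pi> f) (extend_op H (\<pi> g) x)"
      using f g \<mu> by (simp add: ext seq star_homD(4)[OF \<pi>])
  next
    fix f x a assume f: "f \<in> steinberg_algebra G" and x: "x \<in> carrier (completion H)"
    obtain \<mu> where \<mu>: "\<mu> \<in> cauchy_seqs H" "x = limit_rep H \<mu>"
      using completionE[OF x] by metis
    show "extend_op H (\<pi> (\<lambda>x. a * f x)) x = a \<odot>\<^bsub>completion H\<^esub> extend_op H (\<pi> f) x"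
      using f \<mu> by (simp add: ext completion_smult seq star_homD(3)[OF \<pi>])
  next
    fix f x y assume f: "f \<in> steinberg_algebra G" and x: "x \<in> carrier (completion H)" and y: "y \<in> carrier (completion H)"
    obtain \<mu> where \<mu>: "\<mu> \<in> cauchy_seqs H" "x = limit_rep H \<mu>"
      using completionE[OF x] by metis
    obtain \<nu> where \<nu>: "\<nu> \<in> cauchy_seqs H" "y = limit_rep H \<nu>"
      using completionE[OF y] by metis
    have "(\<lambda>n. cinner H (\<pi> (involution G f) (\<mu> n)) (\<nu> n)) \<longlonglongrightarrow> cinner (completion H) (extend_op H (\<pi> (involution G f)) x) y"
      using completion_cinner[OF seq[of "involution G f" \<mu>] \<nu>(1)] f \<mu> \<nu> by (simp add: ext)
    moreover have "(\<lambda>n. cinner H (\<mu> n) (\<pi> f (\<nu> n))) \<longlonglongrightarrow> cinner (completion H) x (extend_op H (\<pi> f) y)"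
      using completion_cinner[OF \<mu>(1) seq[of f \<nu>]] f \<mu> \<nu> by (simp add: ext)
    ultimately show "cinner (completion H) (extend_op H (\<pi> (involution G f)) x) y = cinner (completion H) x (extend_op H (\<pi> f) y)"
      using f \<mu> \<nu> by (simp add: star_homD(5)[OF \<pi>] LIMSEQ_unique)
  qed
qed

end

section \<open>Ample groupoids and compact open bisections\<close>

context topological_groupoid
begin

lemma comp_arrows: "(x, y) \<in> gcomp G \<Longrightarrow> x \<in> garrows G" "(x, y) \<in> gcomp G \<Longrightarrow> y \<in> garrows G"
  using comp_subset by auto

lemma comp_inv: "x \<in> garrows G \<Longrightarrow> (x, ginv G x) \<in> gcomp G"
  using inv_comp[of "ginv G x"] inv_closed[of x] inv_inv[of x] by simp

lemma source_inv [simp]: "x \<in> garrows G \<Longrightarrow> gsource G (ginv G x) = grange G x"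
  by (simp add: gsource_def grange_def inv_inv)

lemma range_inv [simp]: "x \<in> garrows G \<Longrightarrow> grange G (ginv G x) = gsource G x"
  by (simp add: gsource_def grange_def inv_inv)

text \<open>Cancelling \<open>y\<close> on the right of \<open>(x\<^sup>-\<^sup>1 x) y = y\<close> leaves \<open>x\<^sup>-\<^sup>1 x = y y\<^sup>-\<^sup>1\<close>.\<close>
lemma comp_imp_source_eq_range:
  assumes xy: "(x, y) \<in> gcomp G"
  shows "gsource G x = grange G y"
proof -
  have x: "x \<in> garrows G" and y: "y \<in> garrows G" using xy by (auto dest: comp_arrows)
  have c: "(gsource G x, y) \<in> gcomp G"
    unfolding gsource_def by (rule comp_left[OF inv_comp[OF x] xy])
  have "gmult G (gsource G x) y = y"
    unfolding gsource_def using mult_assoc[OF inv_comp[OF x] xy] inv_mult_cancel[OF xy] by simp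
  then show ?thesis
    using mult_inv_cancel[OF c] by (simp add: grange_def)
qed

lemma mult_source [simp]: "x \<in> garrows G \<Longrightarrow> gmult G x (gsource G x) = x"
  unfolding gsource_def
  using inv_mult_cancel[OF inv_comp[of x]] inv_inv[of x] by simp

lemma range_mult_self [simp]: "x \<in> garrows G \<Longrightarrow> gmult G (grange G x) x = x"
  unfolding grange_def
  using mult_inv_cancel[OF comp_inv[of x]] inv_inv[of x] by simp

lemma comp_source: "x \<in> garrows G \<Longrightarrow> (x, gsource G x) \<in> gcomp G"
  unfolding gsource_def by (rule comp_right[OF comp_inv inv_comp])

lemma range_comp: "x \<in> garrows G \<Longrightarrow> (grange G x, x) \<in> gcomp G"
  unfolding grange_def by (rule comp_left[OF comp_inv inv_comp])

lemma comp_iff: "(x, y) \<in> gcomp G \<longleftrightarrow> x \<in> garrows G \<and> y \<in> garrows G \<and> gsource G x = grange G y"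
proof safe
  assume x: "x \<in> garrows G" and y: "y \<in> garrows G" and eq: "gsource G x = grange G y"
  have "(gmult G x (gsource G x), y) \<in> gcomp G"
    by (rule comp_left[OF comp_source[OF x]]) (simp add: eq range_comp[OF y])
  then show "(x, y) \<in> gcomp G" using x by simp
qed (auto dest: comp_arrows comp_imp_source_eq_range)

lemma source_closed [simp]: "x \<in> garrows G \<Longrightarrow> gsource G x \<in> garrows G"
  and range_closed [simp]: "x \<in> garrows G \<Longrightarrow> grange G x \<in> garrows G"
  using comp_source range_comp comp_arrows by blast+

lemma range_source [simp]: "x \<in> garrows G \<Longrightarrow> grange G (gsource G x) = gsource G x"
  and source_range [simp]: "x \<in> garrows G \<Longrightarrow> gsource G (grange G x) = grange G x"
  using comp_source[of x] range_comp[of x] by (simp_all add: comp_iff)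

lemma range_mult: "(x, y) \<in> gcomp G \<Longrightarrow> grange G (gmult G x y) = grange G x"
  using comp_right[OF inv_comp[of x], of y] by (simp add: comp_iff)

lemma source_mult: "(x, y) \<in> gcomp G \<Longrightarrow> gsource G (gmult G x y) = gsource G y"
  using comp_left[of x y "ginv G y", OF _ comp_inv] by (simp add: comp_iff)

lemma source_source [simp]: "x \<in> garrows G \<Longrightarrow> gsource G (gsource G x) = gsource G x"
  using source_mult[OF comp_source[of x]] by simp

lemma units_iff: "u \<in> gunits G \<longleftrightarrow> u \<in> garrows G \<and> gsource G u = u"
  unfolding gunits_def by (auto simp: image_iff) metis

lemma range_unit: "u \<in> gunits G \<Longrightarrow> grange G u = u"
  by (metis units_iff range_source)

lemma units_subset: "gunits G \<subseteq> garrows G"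
  by (auto simp: units_iff)

lemma source_in_units [simp]: "x \<in> garrows G \<Longrightarrow> gsource G x \<in> gunits G"
  and range_in_units [simp]: "x \<in> garrows G \<Longrightarrow> grange G x \<in> gunits G"
  by (simp_all add: units_iff)

lemma inv_unit: "u \<in> gunits G \<Longrightarrow> ginv G u = u"
  by (metis inv_closed mult_source range_inv range_unit range_mult_self source_inv units_iff grange_def)

lemma comp_inv_left: "\<lbrakk>a \<in> garrows G; z \<in> garrows G; grange G a = grange G z\<rbrakk> \<Longrightarrow> (ginv G a, z) \<in> gcomp G"
  by (simp add: comp_iff inv_closed)

lemma mult_inv_mult: "\<lbrakk>a \<in> garrows G; z \<in> garrows G; grange G a = grange G z\<rbrakk>
    \<Longrightarrow> gmult G a (gmult G (ginv G a) z) = z"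
  using inv_mult_cancel[OF comp_inv_left, of a z] by (simp add: inv_inv)

lemma comp_inv_mult: "\<lbrakk>a \<in> garrows G; z \<in> garrows G; grange G a = grange G z\<rbrakk>
    \<Longrightarrow> (a, gmult G (ginv G a) z) \<in> gcomp G"
  using range_mult[OF comp_inv_left] mult_closed[OF comp_inv_left] by (simp add: comp_iff)

lemma continuous_map_mult:
  assumes "continuous_map T (gtop G) f" "continuous_map T (gtop G) g"
    and "\<And>x. x \<in> topspace T \<Longrightarrow> (f x, g x) \<in> gcomp G"
  shows "continuous_map T (gtop G) (\<lambda>x. gmult G (f x) (g x))"
proof -
  have "continuous_map T (subtopology (prod_topology (gtop G) (gtop G)) (gcomp G)) (\<lambda>x. (f x, g x))"
    using assms by (intro continuous_map_into_subtopology continuous_map_pairedI) auto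
  from continuous_map_compose[OF this continuous_mult] show ?thesis
    by (simp add: o_def)
qed

lemma continuous_source: "continuous_map (gtop G) (gtop G) (gsource G)"
  unfolding gsource_def[abs_def]
  by (rule continuous_map_mult[OF continuous_inv continuous_map_id[unfolded id_def]]) (simp add: inv_comp)

lemma continuous_range: "continuous_map (gtop G) (gtop G) (grange G)"
  unfolding grange_def[abs_def]
  by (rule continuous_map_mult[OF continuous_map_id[unfolded id_def] continuous_inv]) (simp add: comp_inv)

end

context ample_groupoid
begin

lemma bisectionD:
  assumes "B \<in> compact_open_bisections G"
  shows "openin (gtop G) B" "compactin (gtop G) B" "inj_on (gsource G) B" "inj_on (grange G) B"
    and "openin (unit_topology G) (gsource G ` B)" "openin (unit_topology G) (grange G ` B)"
    and "\<And>x. x \<in> B \<Longrightarrow> x \<in> garrows G"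
proof -
  have B: "open_bisection G B" and c: "compactin (gtop G) B"
    using assms by (auto simp: compact_open_bisections_def)
  show o: "openin (gtop G) B" using B by (simp add: open_bisection_def)
  show "compactin (gtop G) B" by fact
  have "topspace (subtopology (gtop G) B) = B" using openin_subset[OF o] by auto
  then show "inj_on (gsource G) B" "inj_on (grange G) B"
    using B unfolding open_bisection_def
    by (metis homeomorphic_imp_injective_map insertCI)+
  show "openin (unit_topology G) (gsource G ` B)" "openin (unit_topology G) (grange G ` B)"
    using B by (auto simp: open_bisection_def)
  show "\<And>x. x \<in> B \<Longrightarrow> x \<in> garrows G" using openin_subset[OF o] by auto
qed

text \<open>Near a unit \<open>u\<close> the source map is injective; as \<open>s(x)\<close> and \<open>x\<close> have the same source, every \<open>x\<close>
  for which both lie near \<open>u\<close> is a unit.\<close>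
lemma open_units: "openin (gtop G) (gunits G)"
proof (subst openin_subopen, intro ballI)
  fix u assume u: "u \<in> gunits G"
  then obtain B where B: "B \<in> compact_open_bisections G" "u \<in> B"
    using basis[of "garrows G" u] units_subset by auto
  define V where "V = B \<inter> {x \<in> garrows G. gsource G x \<in> B}"
  have "openin (gtop G) V"
    unfolding V_def using bisectionD(1)[OF B(1)]
    by (intro openin_Int openin_continuous_map_preimage[OF continuous_source])
  moreover have "u \<in> V" using B u by (auto simp: V_def units_iff)
  moreover have "V \<subseteq> gunits G"
    using inj_onD[OF bisectionD(3)[OF B(1)]] by (auto simp: V_def units_iff)
  ultimately show "\<exists>T. openin (gtop G) T \<and> u \<in> T \<and> T \<subseteq> gunits G" by blast
qed

lemma openin_unit_topology: "openin (unit_topology G) W \<longleftrightarrow> openin (gtop G) W \<and> W \<subseteq> gunits G"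
  unfolding unit_topology_def by (rule openin_open_subtopology[OF open_units])

lemma open_image_source: "openin (gtop G) U \<Longrightarrow> openin (unit_topology G) (gsource G ` U)"
  and open_image_range: "openin (gtop G) U \<Longrightarrow> openin (unit_topology G) (grange G ` U)"
proof -
  have "openin (unit_topology G) (f ` U)" if U: "openin (gtop G) U"
    and f: "\<And>B. B \<in> compact_open_bisections G \<Longrightarrow> openin (unit_topology G) (f ` B)" for f
  proof (subst openin_subopen, intro ballI)
    fix y assume "y \<in> f ` U"
    then obtain x where x: "x \<in> U" "y = f x" by blast
    then obtain B where B: "B \<in> compact_open_bisections G" "x \<in> B" "B \<subseteq> U"
      using basis[OF U] by blast
    then show "\<exists>T. openin (unit_topology G) T \<and> y \<in> T \<and> T \<subseteq> f ` U"
      using f[OF B(1)] x by blast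
  qed
  then show "openin (gtop G) U \<Longrightarrow> openin (unit_topology G) (gsource G ` U)"
    and "openin (gtop G) U \<Longrightarrow> openin (unit_topology G) (grange G ` U)"
    using bisectionD(5,6) by blast+
qed

text \<open>The range and source maps are continuous and open, so for a compact open set only injectivity is left to check.\<close>
lemma bisectionI:
  assumes o: "openin (gtop G) B" and c: "compactin (gtop G) B"
    and s: "inj_on (gsource G) B" and r: "inj_on (grange G) B"
  shows "B \<in> compact_open_bisections G"
proof -
  have BA: "B \<subseteq> garrows G" using openin_subset[OF o] .
  have "homeomorphic_map (subtopology (gtop G) B) (subtopology (unit_topology G) (f ` B)) f"
    if inj: "inj_on f B" and cont: "continuous_map (gtop G) (gtop G) f"
      and op: "\<And>U. openin (gtop G) U \<Longrightarrow> openin (unit_topology G) (f ` U)" for f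
  proof (rule bijective_open_imp_homeomorphic_map)
    have fB: "f ` B \<subseteq> gunits G" using op[OF o] by (simp add: openin_unit_topology)
    show "continuous_map (subtopology (gtop G) B) (subtopology (unit_topology G) (f ` B)) f"
      unfolding unit_topology_def
      using fB BA by (intro continuous_map_into_subtopology continuous_map_from_subtopology cont) auto
    show "open_map (subtopology (gtop G) B) (subtopology (unit_topology G) (f ` B)) f"
      unfolding open_map_def
    proof (intro allI impI)
      fix U assume "openin (subtopology (gtop G) B) U"
      then have "openin (gtop G) U" "U \<subseteq> B" by (simp_all add: openin_open_subtopology[OF o])
      then show "openin (subtopology (unit_topology G) (f ` B)) (f ` U)"
        using op by (simp add: openin_open_subtopology[OF op[OF o]] image_mono)
    qed
    show "f ` topspace (subtopology (gtop G) B) = topspace (subtopology (unit_topology G) (f ` B))"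
      using fB BA units_subset by (auto simp: unit_topology_def)
    show "inj_on f (topspace (subtopology (gtop G) B))"
      using inj by (rule inj_on_subset) auto
  qed
  then show ?thesis
    unfolding compact_open_bisections_def open_bisection_def
    using o c s r open_image_source[OF o] open_image_range[OF o] continuous_source continuous_range
      open_image_source open_image_range by auto
qed

text \<open>The inverse of the range or source map on a bisection is a continuous local section.\<close>
lemma section_continuous:
  assumes B: "B \<in> compact_open_bisections G" and f: "f \<in> {grange G, gsource G}"
  shows "continuous_map (subtopology (gtop G) (f ` B)) (gtop G) (inv_into B f)"
proof -
  have BA: "B \<subseteq> garrows G" using bisectionD(7)[OF B] by blast
  have fB: "f ` B \<subseteq> gunits G" using f BA by auto
  have inj: "inj_on f B" using f bisectionD(3,4)[OF B] by auto
  have "homeomorphic_map (subtopology (gtop G) B) (subtopology (unit_topology G) (f ` B)) f"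
    using B f by (auto simp: compact_open_bisections_def open_bisection_def)
  then obtain g where g: "homeomorphic_maps (subtopology (gtop G) B) (subtopology (unit_topology G) (f ` B)) f g"
    by (auto simp: homeomorphic_map_maps)
  have top: "subtopology (unit_topology G) (f ` B) = subtopology (gtop G) (f ` B)"
    using fB by (simp add: unit_topology_def subtopology_subtopology Int_absorb1)
  have "continuous_map (subtopology (gtop G) (f ` B)) (gtop G) g"
    using g unfolding homeomorphic_maps_def top by (simp add: continuous_map_in_subtopology)
  moreover have "g y = inv_into B f y" if y: "y \<in> topspace (subtopology (gtop G) (f ` B))" for y
  proof -
    obtain x where x: "x \<in> B" "y = f x" using y by auto
    then have "g (f x) = x"
      using g BA unfolding homeomorphic_maps_def by auto
    then show ?thesis using x inj by simp
  qed
  ultimately show ?thesis by (rule continuous_map_eq)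
qed

definition bisection_inv :: "'a set \<Rightarrow> 'a set" where
  "bisection_inv B = ginv G ` B"

definition bisection_mult :: "'a set \<Rightarrow> 'a set \<Rightarrow> 'a set" where
  "bisection_mult B D = {gmult G x y | x y. x \<in> B \<and> y \<in> D \<and> (x, y) \<in> gcomp G}"

lemma bisection_inv_closed:
  assumes B: "B \<in> compact_open_bisections G"
  shows "bisection_inv B \<in> compact_open_bisections G"
proof (rule bisectionI)
  note BA = bisectionD(7)[OF B]
  have "bisection_inv B = {x \<in> garrows G. ginv G x \<in> B}"
    using BA inv_closed inv_inv by (force simp: bisection_inv_def)
  then show "openin (gtop G) (bisection_inv B)"
    using openin_continuous_map_preimage[OF continuous_inv bisectionD(1)[OF B]] by simp
  show "compactin (gtop G) (bisection_inv B)"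
    unfolding bisection_inv_def by (rule image_compactin[OF bisectionD(2)[OF B] continuous_inv])
  show "inj_on (gsource G) (bisection_inv B)" "inj_on (grange G) (bisection_inv B)"
    using bisectionD(3,4)[OF B] BA by (auto simp: bisection_inv_def inj_on_def)
qed

lemma unit_set_bisection:
  assumes "openin (gtop G) V" "compactin (gtop G) V" "V \<subseteq> gunits G"
  shows "V \<in> compact_open_bisections G"
  by (rule bisectionI) (use assms in \<open>auto simp: inj_on_def units_iff subset_iff range_unit\<close>)

lemma compact_images:
  assumes B: "B \<in> compact_open_bisections G"
  shows "compactin (gtop G) (gsource G ` B)" "compactin (gtop G) (grange G ` B)"
  using image_compactin[OF bisectionD(2)[OF B]] continuous_source continuous_range by auto

lemma source_bisection:
  assumes B: "B \<in> compact_open_bisections G"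
  shows "gsource G ` B \<in> compact_open_bisections G"
  using bisectionD(5)[OF B] compact_images(1)[OF B]
  by (intro unit_set_bisection) (auto simp: openin_unit_topology)

text \<open>With \<open>\<beta>\<close> the section of the range map over \<open>r(B)\<close>, a point \<open>z\<close> lies in \<open>BD\<close> iff \<open>\<beta>(r(z))\<^sup>-\<^sup>1 z\<close> lies in \<open>D\<close>;
  hence the product is open. It is also the image of \<open>W = s(B) \<inter> r(D)\<close> under the continuous map that multiplies the
  point of \<open>B\<close> with source \<open>w\<close> by the point of \<open>D\<close> with range \<open>w\<close>; hence it is compact, as soon as \<open>W\<close> is.\<close>
lemma bisection_mult_closed:
  assumes haus: "Hausdorff_space (unit_topology G)"
    and B: "B \<in> compact_open_bisections G" and D: "D \<in> compact_open_bisections G"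
  shows "bisection_mult B D \<in> compact_open_bisections G"
proof (rule bisectionI)
  note BA = bisectionD(7)[OF B] and DA = bisectionD(7)[OF D]
  define U where "U = {z \<in> garrows G. grange G z \<in> grange G ` B}"
  define \<beta> where "\<beta> = inv_into B (grange G)"
  have \<beta>: "\<beta> (grange G b) = b" if "b \<in> B" for b
    unfolding \<beta>_def using bisectionD(4)[OF B] that by simp
  have U: "openin (gtop G) U"
    unfolding U_def using open_image_range[OF bisectionD(1)[OF B]]
    by (intro openin_continuous_map_preimage[OF continuous_range]) (simp add: openin_unit_topology)
  have \<beta>U: "\<beta> (grange G z) \<in> B" "grange G (\<beta> (grange G z)) = grange G z" if "z \<in> U" for z
    using that \<beta> by (auto simp: U_def)
  have cont: "continuous_map (subtopology (gtop G) U) (gtop G) (\<lambda>z. gmult G (ginv G (\<beta> (grange G z))) z)"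
  proof (rule continuous_map_mult)
    have "continuous_map (subtopology (gtop G) U) (subtopology (gtop G) (grange G ` B)) (grange G)"
      by (intro continuous_map_into_subtopology continuous_map_from_subtopology continuous_range)
        (auto simp: U_def)
    moreover have "continuous_map (subtopology (gtop G) (grange G ` B)) (gtop G) \<beta>"
      unfolding \<beta>_def by (rule section_continuous[OF B]) simp
    ultimately show "continuous_map (subtopology (gtop G) U) (gtop G) (\<lambda>z. ginv G (\<beta> (grange G z)))"
      using continuous_map_compose[OF continuous_map_compose continuous_inv] by (simp add: o_def)
    show "continuous_map (subtopology (gtop G) U) (gtop G) (\<lambda>z. z)"
      by (rule continuous_map_from_subtopology) (rule continuous_map_id[unfolded id_def])
    fix z assume "z \<in> topspace (subtopology (gtop G) U)"
    then show "(ginv G (\<beta> (grange G z)), z) \<in> gcomp G"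
      using \<beta>U BA by (intro comp_inv_left) auto
  qed
  have "bisection_mult B D = {z \<in> topspace (subtopology (gtop G) U). gmult G (ginv G (\<beta> (grange G z))) z \<in> D}"
  proof safe
    fix z assume "z \<in> bisection_mult B D"
    then obtain x y where xy: "x \<in> B" "y \<in> D" "(x, y) \<in> gcomp G" "z = gmult G x y"
      by (auto simp: bisection_mult_def)
    then have r: "grange G z = grange G x" by (simp add: range_mult)
    show "z \<in> topspace (subtopology (gtop G) U)"
      using xy r mult_closed by (auto simp: U_def)
    show "gmult G (ginv G (\<beta> (grange G z))) z \<in> D"
      unfolding r \<beta>[OF xy(1)] using xy by (simp add: inv_mult_cancel)
  next
    fix z assume "z \<in> topspace (subtopology (gtop G) U)" and D: "gmult G (ginv G (\<beta> (grange G z))) z \<in> D"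
    then have z: "z \<in> U" "z \<in> garrows G" by auto
    have b: "\<beta> (grange G z) \<in> garrows G" using \<beta>U[OF z(1)] BA by blast
    show "z \<in> bisection_mult B D"
      unfolding bisection_mult_def
      using D \<beta>U[OF z(1)] mult_inv_mult[OF b z(2)] comp_inv_mult[OF b z(2)] by (intro CollectI exI conjI) auto
  qed
  then have "openin (subtopology (gtop G) U) (bisection_mult B D)"
    using openin_continuous_map_preimage[OF cont bisectionD(1)[OF D]] by simp
  then show "openin (gtop G) (bisection_mult B D)"
    using U by (simp add: openin_open_subtopology)

  define W where "W = gsource G ` B \<inter> grange G ` D"
  have "compactin (unit_topology G) (gsource G ` B)" "compactin (unit_topology G) (grange G ` D)"
    unfolding unit_topology_def
    using compact_images(1)[OF B] compact_images(2)[OF D] BA DA by (auto simp: compactin_subtopology)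
  then have "compactin (unit_topology G) W"
    unfolding W_def using haus by (intro closed_Int_compactin compactin_imp_closedin)
  then have W: "compactin (gtop G) W"
    by (simp add: unit_topology_def compactin_subtopology)
  have "continuous_map (subtopology (gtop G) W) (gtop G)
      (\<lambda>w. gmult G (inv_into B (gsource G) w) (inv_into D (grange G) w))"
  proof (rule continuous_map_mult)
    show "continuous_map (subtopology (gtop G) W) (gtop G) (inv_into B (gsource G))"
      using section_continuous[OF B, of "gsource G"] continuous_map_from_subtopology_mono[of "gtop G" "gsource G ` B" _ _ W]
      by (auto simp: W_def)
    show "continuous_map (subtopology (gtop G) W) (gtop G) (inv_into D (grange G))"
      using section_continuous[OF D, of "grange G"] continuous_map_from_subtopology_mono[of "gtop G" "grange G ` D" _ _ W]
      by (auto simp: W_def)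
    fix w assume "w \<in> topspace (subtopology (gtop G) W)"
    then have w: "w \<in> gsource G ` B" "w \<in> grange G ` D" by (auto simp: W_def)
    show "(inv_into B (gsource G) w, inv_into D (grange G) w) \<in> gcomp G"
      unfolding comp_iff f_inv_into_f[OF w(1)] f_inv_into_f[OF w(2)]
      using BA[OF inv_into_into[OF w(1)]] DA[OF inv_into_into[OF w(2)]] by simp
  qed
  then have "compactin (gtop G) ((\<lambda>w. gmult G (inv_into B (gsource G) w) (inv_into D (grange G) w)) ` W)"
    by (rule image_compactin[rotated]) (simp add: W compactin_subtopology)
  moreover have "(\<lambda>w. gmult G (inv_into B (gsource G) w) (inv_into D (grange G) w)) ` W = bisection_mult B D"
  proof safe
    fix w assume "w \<in> W"
    then have w: "w \<in> gsource G ` B" "w \<in> grange G ` D" by (auto simp: W_def)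
    have "(inv_into B (gsource G) w, inv_into D (grange G) w) \<in> gcomp G"
      unfolding comp_iff f_inv_into_f[OF w(1)] f_inv_into_f[OF w(2)]
      using BA[OF inv_into_into[OF w(1)]] DA[OF inv_into_into[OF w(2)]] by simp
    then show "gmult G (inv_into B (gsource G) w) (inv_into D (grange G) w) \<in> bisection_mult B D"
      unfolding bisection_mult_def
      using inv_into_into[OF w(1)] inv_into_into[OF w(2)] by blast
  next
    fix z assume "z \<in> bisection_mult B D"
    then obtain x y where xy: "x \<in> B" "y \<in> D" "(x, y) \<in> gcomp G" "z = gmult G x y"
      by (auto simp: bisection_mult_def)
    then have eq: "gsource G x = grange G y" by (simp add: comp_iff)
    have "inv_into B (gsource G) (gsource G x) = x" "inv_into D (grange G) (gsource G x) = y"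
      using xy bisectionD(3)[OF B] bisectionD(4)[OF D] by (simp, simp add: eq)
    moreover have "gsource G x \<in> W"
      unfolding W_def using imageI[OF xy(1), of "gsource G"] imageI[OF xy(2), of "grange G"] eq by simp
    ultimately show "z \<in> (\<lambda>w. gmult G (inv_into B (gsource G) w) (inv_into D (grange G) w)) ` W"
      using xy by (intro image_eqI[of _ _ "gsource G x"]) simp_all
  qed
  ultimately show "compactin (gtop G) (bisection_mult B D)" by simp
  show "inj_on (gsource G) (bisection_mult B D)"
  proof (rule inj_onI)
    fix z z' assume "z \<in> bisection_mult B D" "z' \<in> bisection_mult B D" and eq: "gsource G z = gsource G z'"
    then obtain x y x' y' where *: "x \<in> B" "y \<in> D" "(x, y) \<in> gcomp G" "z = gmult G x y"
      "x' \<in> B" "y' \<in> D" "(x', y') \<in> gcomp G" "z' = gmult G x' y'"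
      unfolding bisection_mult_def by blast
    then have "gsource G y = gsource G y'" using eq by (simp add: source_mult)
    then have y: "y = y'" using * inj_onD[OF bisectionD(3)[OF D]] by blast
    then have "gsource G x = gsource G x'" using * by (simp add: comp_iff)
    then have "x = x'" using * inj_onD[OF bisectionD(3)[OF B]] by blast
    with y show "z = z'" using * by simp
  qed
  show "inj_on (grange G) (bisection_mult B D)"
  proof (rule inj_onI)
    fix z z' assume "z \<in> bisection_mult B D" "z' \<in> bisection_mult B D" and eq: "grange G z = grange G z'"
    then obtain x y x' y' where *: "x \<in> B" "y \<in> D" "(x, y) \<in> gcomp G" "z = gmult G x y"
      "x' \<in> B" "y' \<in> D" "(x', y') \<in> gcomp G" "z' = gmult G x' y'"
      unfolding bisection_mult_def by blast
    then have "grange G x = grange G x'" using eq by (simp add: range_mult)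
    then have x: "x = x'" using * inj_onD[OF bisectionD(4)[OF B]] by blast
    then have "grange G y = grange G y'" using * by (simp add: comp_iff)
    then have "y = y'" using * inj_onD[OF bisectionD(4)[OF D]] by blast
    with x show "z = z'" using * by simp
  qed
qed

end

section \<open>The Steinberg algebra\<close>

context ample_groupoid
begin

lemma steinberg_zero: "(\<lambda>_. 0) \<in> steinberg_algebra G"
  unfolding steinberg_algebra_def by (rule CollectI, rule exI[of _ "{}"]) simp

lemma steinberg_scale:
  assumes "f \<in> steinberg_algebra G"
  shows "(\<lambda>x. a * f x) \<in> steinberg_algebra G"
proof -
  obtain F c where "finite F" "F \<subseteq> compact_open_bisections G" "f = (\<lambda>x. \<Sum>B\<in>F. c B * indicator B x)"
    using assms by (auto simp: steinberg_algebra_def)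
  then show ?thesis
    unfolding steinberg_algebra_def
    by (intro CollectI exI[of _ F] exI[of _ "\<lambda>B. a * c B"]) (simp_all only: sum_distrib_left mult.assoc simp_thms)
qed

lemma steinberg_add:
  assumes "f \<in> steinberg_algebra G" "g \<in> steinberg_algebra G"
  shows "(\<lambda>x. f x + g x) \<in> steinberg_algebra G"
proof -
  obtain F c where F: "finite F" "F \<subseteq> compact_open_bisections G" "f = (\<lambda>x. \<Sum>B\<in>F. c B * indicator B x)"
    using assms(1) by (auto simp: steinberg_algebra_def)
  obtain E d where E: "finite E" "E \<subseteq> compact_open_bisections G" "g = (\<lambda>x. \<Sum>B\<in>E. d B * indicator B x)"
    using assms(2) by (auto simp: steinberg_algebra_def)
  let ?c = "\<lambda>B. (if B \<in> F then c B else 0) + (if B \<in> E then d B else 0)"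
  have ext: "(\<Sum>B\<in>A. b B * indicator B x) = (\<Sum>B\<in>F \<union> E. (if B \<in> A then b B else 0) * indicator B x)"
    if "A \<subseteq> F \<union> E" for A and b :: "'a set \<Rightarrow> complex" and x
    using F E that by (intro sum.mono_neutral_cong_left) auto
  have "f x + g x = (\<Sum>B\<in>F \<union> E. ?c B * indicator B x)" for x
    unfolding F(3) E(3) ext[of F, OF Un_upper1] ext[of E, OF Un_upper2]
    by (simp only: distrib_right sum.distrib)
  then show ?thesis
    unfolding steinberg_algebra_def using F E
    by (intro CollectI exI[of _ "F \<union> E"] exI[of _ ?c]) auto
qed

lemma indicator_in_steinberg:
  assumes "B \<in> compact_open_bisections G"
  shows "indicator B \<in> steinberg_algebra G"
  unfolding steinberg_algebra_def
  using assms by (intro CollectI exI[of _ "{B}"] exI[of _ "\<lambda>_. 1"]) auto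

text \<open>Proofs about the algebra proceed by linearity from characteristic functions of bisections.\<close>
lemma steinberg_induct [consumes 1, case_names zero add]:
  assumes f: "f \<in> steinberg_algebra G"
    and zero: "P (\<lambda>_. 0)"
    and add: "\<And>B c f. \<lbrakk>B \<in> compact_open_bisections G; f \<in> steinberg_algebra G; P f\<rbrakk>
      \<Longrightarrow> P (\<lambda>x. c * indicator B x + f x)"
  shows "P f"
proof -
  obtain F c where F: "finite F" "F \<subseteq> compact_open_bisections G" and eq: "f = (\<lambda>x. \<Sum>B\<in>F. c B * indicator B x)"
    using f by (auto simp: steinberg_algebra_def)
  from F show ?thesis
    unfolding eq
  proof (induction F)
    case empty
    then show ?case using zero by simp
  next
    case (insert B F)
    have "(\<lambda>x. \<Sum>B\<in>F. c B * indicator B x) \<in> steinberg_algebra G"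
      unfolding steinberg_algebra_def using insert.hyps insert.prems by blast
    then have "P (\<lambda>x. c B * indicator B x + (\<Sum>B\<in>F. c B * indicator B x))"
      using insert.IH insert.prems by (intro add) simp_all
    then show ?case
      unfolding sum.insert[OF insert.hyps] .
  qed
qed

lemma steinberg_fibre_finite:
  assumes "f \<in> steinberg_algebra G"
  shows "finite {a \<in> garrows G. grange G a = v \<and> f a \<noteq> 0}"
  using assms
proof (induction f rule: steinberg_induct)
  case (add B c f)
  have inj: "inj_on (grange G) {a \<in> B. grange G a = v}"
    by (rule inj_on_subset[OF bisectionD(4)[OF add(1)]]) auto
  have "finite {a \<in> B. grange G a = v}"
    by (rule inj_on_finite[OF inj, of "{v}"]) auto
  then have "finite ({a \<in> B. grange G a = v} \<union> {a \<in> garrows G. grange G a = v \<and> f a \<noteq> 0})"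
    using add.IH by simp
  then show ?case
    by (rule finite_subset[rotated]) (auto simp: indicator_def)
qed simp

lemma convolution_outside: "z \<notin> garrows G \<Longrightarrow> convolution G f \<xi> z = 0"
proof -
  assume z: "z \<notin> garrows G"
  have "{(a, b). (a, b) \<in> gcomp G \<and> gmult G a b = z \<and> f a \<noteq> 0 \<and> \<xi> b \<noteq> 0} = {}"
    using mult_closed z by blast
  then show ?thesis unfolding convolution_def by (simp only: sum.empty)
qed

text \<open>A pair with product \<open>z\<close> is determined by its first entry \<open>a\<close>, which ranges over the fibre of \<open>r\<close> through
  \<open>z\<close>. The function \<open>\<xi>\<close> is arbitrary, so convolution also serves as the action of the algebra on functions.
  The freedom in \<open>F\<close> allows several functions to be summed over the same set.\<close>
lemma convolution_eq_sum:
  assumes z: "z \<in> garrows G" and F: "finite F" "F \<subseteq> {a \<in> garrows G. grange G a = grange G z}"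
    and supp: "{a \<in> garrows G. grange G a = grange G z \<and> f a \<noteq> 0} \<subseteq> F"
  shows "convolution G f \<xi> z = (\<Sum>a\<in>F. f a * \<xi> (gmult G (ginv G a) z))"
proof -
  let ?S = "{(a, b). (a, b) \<in> gcomp G \<and> gmult G a b = z \<and> f a \<noteq> 0 \<and> \<xi> b \<noteq> 0}"
  let ?F = "{a \<in> F. f a \<noteq> 0 \<and> \<xi> (gmult G (ginv G a) z) \<noteq> 0}"
  let ?h = "\<lambda>a. (a, gmult G (ginv G a) z)"
  have img: "?S = ?h ` ?F"
  proof (intro equalityI subsetI)
    fix p assume "p \<in> ?S"
    then obtain a b where p: "p = (a, b)" and *: "(a, b) \<in> gcomp G" "gmult G a b = z" "f a \<noteq> 0" "\<xi> b \<noteq> 0"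
      by auto
    have "a \<in> F" using supp comp_arrows[OF *(1)] * by (auto simp: range_mult)
    moreover have "gmult G (ginv G a) z = b" using inv_mult_cancel[OF *(1)] * by simp
    ultimately show "p \<in> ?h ` ?F" using * p by (intro image_eqI[of _ _ a]) auto
  next
    fix p assume "p \<in> ?h ` ?F"
    then show "p \<in> ?S" using F z by (auto simp: comp_inv_mult mult_inv_mult)
  qed
  have "convolution G f \<xi> z = (\<Sum>a\<in>?F. f a * \<xi> (gmult G (ginv G a) z))"
    unfolding convolution_def img by (subst sum.reindex) (auto simp: inj_on_def)
  also have "\<dots> = (\<Sum>a\<in>F. f a * \<xi> (gmult G (ginv G a) z))"
    using F by (intro sum.mono_neutral_left) auto
  finally show ?thesis .
qed

lemma convolution_steinberg:
  assumes "f \<in> steinberg_algebra G" "z \<in> garrows G"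
  shows "convolution G f \<xi> z
    = (\<Sum>a | a \<in> garrows G \<and> grange G a = grange G z \<and> f a \<noteq> 0. f a * \<xi> (gmult G (ginv G a) z))"
  by (rule convolution_eq_sum) (use assms steinberg_fibre_finite[OF assms(1)] in auto)

lemma convolution_zero_left [simp]: "convolution G (\<lambda>_. 0) \<xi> = (\<lambda>_. 0)"
  by (simp add: convolution_def fun_eq_iff)

lemma convolution_zero_right [simp]: "convolution G f (\<lambda>_. 0) = (\<lambda>_. 0)"
  by (simp add: convolution_def fun_eq_iff)

lemma convolution_add_left:
  assumes f: "f \<in> steinberg_algebra G" and g: "g \<in> steinberg_algebra G"
  shows "convolution G (\<lambda>x. f x + g x) \<xi> = (\<lambda>x. convolution G f \<xi> x + convolution G g \<xi> x)"
proof
  fix z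
  show "convolution G (\<lambda>x. f x + g x) \<xi> z = convolution G f \<xi> z + convolution G g \<xi> z"
  proof (cases "z \<in> garrows G")
    case True
    let ?F = "{a \<in> garrows G. grange G a = grange G z \<and> f a \<noteq> 0} \<union> {a \<in> garrows G. grange G a = grange G z \<and> g a \<noteq> 0}"
    have fin: "finite ?F" using f g by (intro finite_UnI steinberg_fibre_finite)
    have "convolution G h \<xi> z = (\<Sum>a\<in>?F. h a * \<xi> (gmult G (ginv G a) z))"
      if "\<And>a. f a = 0 \<Longrightarrow> g a = 0 \<Longrightarrow> h a = 0" for h
      using that by (intro convolution_eq_sum[OF True fin]) auto
    from this[of f] this[of g] this[of "\<lambda>x. f x + g x"] show ?thesis
      by (simp add: sum.distrib distrib_right)
  qed (simp add: convolution_outside)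
qed

lemma convolution_scale_left:
  assumes f: "f \<in> steinberg_algebra G"
  shows "convolution G (\<lambda>x. c * f x) \<xi> = (\<lambda>x. c * convolution G f \<xi> x)"
proof
  fix z
  show "convolution G (\<lambda>x. c * f x) \<xi> z = c * convolution G f \<xi> z"
  proof (cases "z \<in> garrows G")
    case True
    let ?F = "{a \<in> garrows G. grange G a = grange G z \<and> f a \<noteq> 0}"
    have fin: "finite ?F" using f by (rule steinberg_fibre_finite)
    have "convolution G h \<xi> z = (\<Sum>a\<in>?F. h a * \<xi> (gmult G (ginv G a) z))"
      if "\<And>a. f a = 0 \<Longrightarrow> h a = 0" for h
      using that by (intro convolution_eq_sum[OF True fin]) auto
    from this[of f] this[of "\<lambda>x. c * f x"] show ?thesis
      by (simp add: sum_distrib_left mult.assoc)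
  qed (simp add: convolution_outside)
qed

lemma convolution_add_right:
  assumes f: "f \<in> steinberg_algebra G"
  shows "convolution G f (\<lambda>x. \<xi> x + \<eta> x) = (\<lambda>x. convolution G f \<xi> x + convolution G f \<eta> x)"
proof
  fix z
  show "convolution G f (\<lambda>x. \<xi> x + \<eta> x) z = convolution G f \<xi> z + convolution G f \<eta> z"
    by (cases "z \<in> garrows G")
      (simp_all add: convolution_outside convolution_steinberg[OF f] sum.distrib distrib_left)
qed

lemma convolution_scale_right:
  assumes f: "f \<in> steinberg_algebra G"
  shows "convolution G f (\<lambda>x. c * \<xi> x) = (\<lambda>x. c * convolution G f \<xi> x)"
proof
  fix z
  show "convolution G f (\<lambda>x. c * \<xi> x) z = c * convolution G f \<xi> z"
    by (cases "z \<in> garrows G")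
      (simp_all add: convolution_outside convolution_steinberg[OF f] sum_distrib_left mult.left_commute)
qed

text \<open>Convolution by \<open>1\<^sub>B\<close> moves values along the partial bijection \<open>w \<mapsto> b w\<close>, where \<open>b\<close> is the point of
  \<open>B\<close> with source \<open>r(w)\<close>, and is zero off the image of that bijection. Every statement about convolution is
  reduced to this one and to \<open>convolution_indicator_0\<close>.\<close>
lemma convolution_indicator:
  assumes B: "B \<in> compact_open_bisections G" and b: "b \<in> B" and bw: "(b, w) \<in> gcomp G"
  shows "convolution G (indicator B) \<xi> (gmult G b w) = \<xi> w"
proof -
  have uniq: "a = b" if "a \<in> B" "grange G a = grange G b" for a
    using that b inj_onD[OF bisectionD(4)[OF B]] by blast
  have "convolution G (indicator B) \<xi> (gmult G b w)
      = (\<Sum>a\<in>{b}. indicator B a * \<xi> (gmult G (ginv G a) (gmult G b w)))"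
    using bisectionD(7)[OF B b] bw
    by (intro convolution_eq_sum) (auto simp: mult_closed range_mult indicator_def uniq split: if_splits)
  then show ?thesis using b bw by (simp add: inv_mult_cancel)
qed

lemma convolution_indicator_0:
  assumes B: "B \<in> compact_open_bisections G"
    and "\<And>b w. \<lbrakk>b \<in> B; (b, w) \<in> gcomp G; z = gmult G b w\<rbrakk> \<Longrightarrow> False"
  shows "convolution G (indicator B) \<xi> z = 0"
proof -
  have "{(a, b). (a, b) \<in> gcomp G \<and> gmult G a b = z \<and> indicator B a \<noteq> (0::complex) \<and> \<xi> b \<noteq> 0} = {}"
    using assms(2) by (simp add: indicator_eq_0_iff) blast
  then show ?thesis unfolding convolution_def by (simp only: sum.empty)
qed

lemma left_mult_cancel:
  assumes B: "B \<in> compact_open_bisections G" and "b \<in> B" "b' \<in> B"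
    and bw: "(b, w) \<in> gcomp G" "(b', w') \<in> gcomp G" and eq: "gmult G b w = gmult G b' w'"
  shows "b = b'" "w = w'"
proof -
  have "grange G b = grange G b'"
    using range_mult[OF bw(1)] range_mult[OF bw(2)] eq by simp
  then show b: "b = b'"
    by (rule inj_onD[OF bisectionD(4)[OF B]]) fact+
  show "w = w'"
    using inv_mult_cancel[OF bw(1)] inv_mult_cancel[OF bw(2)] b eq by metis
qed

lemma convolution_indicator_indicator:
  assumes B: "B \<in> compact_open_bisections G"
  shows "convolution G (indicator B) (indicator D) = indicator (bisection_mult B D)"
proof
  fix z
  show "convolution G (indicator B) (indicator D) z = indicator (bisection_mult B D) z"
  proof (cases "\<exists>b w. b \<in> B \<and> (b, w) \<in> gcomp G \<and> z = gmult G b w")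
    case True
    then obtain b w where *: "b \<in> B" "(b, w) \<in> gcomp G" "z = gmult G b w" by blast
    have "z \<in> bisection_mult B D \<longleftrightarrow> w \<in> D"
    proof
      assume "z \<in> bisection_mult B D"
      then obtain b' w' where "b' \<in> B" "w' \<in> D" "(b', w') \<in> gcomp G" "z = gmult G b' w'"
        unfolding bisection_mult_def by blast
      then show "w \<in> D" using left_mult_cancel(2)[OF B *(1) _ *(2)] *(3) by metis
    next
      assume "w \<in> D"
      then show "z \<in> bisection_mult B D" unfolding bisection_mult_def using * by blast
    qed
    then show ?thesis using * by (simp add: convolution_indicator[OF B] indicator_def)
  next
    case False
    then have "z \<notin> bisection_mult B D" by (auto simp: bisection_mult_def)
    then show ?thesis using False by (subst convolution_indicator_0[OF B]) auto
  qed
qed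

text \<open>Associativity for characteristic functions. Both sides carry the value of \<open>\<xi>\<close> at \<open>w\<close> to the point
  \<open>b (d w) = (b d) w\<close> and vanish off the set of these points.\<close>
lemma convolution_indicator_bisection_mult:
  assumes B: "B \<in> compact_open_bisections G" and D: "D \<in> compact_open_bisections G"
    and BD: "bisection_mult B D \<in> compact_open_bisections G"
  shows "convolution G (indicator (bisection_mult B D)) \<xi>
    = convolution G (indicator B) (convolution G (indicator D) \<xi>)"
proof
  fix z
  let ?R = "convolution G (indicator D) \<xi>"
  show "convolution G (indicator (bisection_mult B D)) \<xi> z = convolution G (indicator B) ?R z"
  proof (cases "\<exists>b d w. b \<in> B \<and> d \<in> D \<and> (b, d) \<in> gcomp G \<and> (d, w) \<in> gcomp G \<and> z = gmult G b (gmult G d w)")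
    case True
    then obtain b d w where *: "b \<in> B" "d \<in> D" "(b, d) \<in> gcomp G" "(d, w) \<in> gcomp G"
      "z = gmult G b (gmult G d w)" by blast
    have "z = gmult G (gmult G b d) w" using * by (simp add: mult_assoc)
    moreover have "gmult G b d \<in> bisection_mult B D" using * by (auto simp: bisection_mult_def)
    ultimately have "convolution G (indicator (bisection_mult B D)) \<xi> z = \<xi> w"
      using convolution_indicator[OF BD _ comp_left] * by simp
    moreover have "convolution G (indicator B) ?R z = \<xi> w"
      using * convolution_indicator[OF B *(1) comp_right[OF *(3,4)]] convolution_indicator[OF D *(2,4)]
      by simp
    ultimately show ?thesis by simp
  next
    case False
    have "convolution G (indicator (bisection_mult B D)) \<xi> z = 0"
    proof (rule convolution_indicator_0[OF BD])
      fix c w assume "c \<in> bisection_mult B D" and cw: "(c, w) \<in> gcomp G" "z = gmult G c w"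
      then obtain b d where bd: "b \<in> B" "d \<in> D" "(b, d) \<in> gcomp G" "c = gmult G b d"
        by (auto simp: bisection_mult_def)
      then have dw: "(d, w) \<in> gcomp G" using cw by (auto simp: comp_iff source_mult)
      show False using False bd dw cw by (auto simp: mult_assoc)
    qed
    moreover have "convolution G (indicator B) ?R z = 0"
    proof (cases "\<exists>b w. b \<in> B \<and> (b, w) \<in> gcomp G \<and> z = gmult G b w")
      case True
      then obtain b w where bw: "b \<in> B" "(b, w) \<in> gcomp G" "z = gmult G b w" by blast
      have "?R w = 0"
      proof (rule convolution_indicator_0[OF D])
        fix d v assume "d \<in> D" "(d, v) \<in> gcomp G" "w = gmult G d v"
        moreover from this have "(b, d) \<in> gcomp G" using bw by (auto simp: comp_iff range_mult)
        ultimately show False using False bw by blast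
      qed
      then show ?thesis using bw by (simp add: convolution_indicator[OF B])
    qed (auto intro: convolution_indicator_0[OF B])
    ultimately show ?thesis by simp
  qed
qed

lemma steinberg_convolution:
  assumes haus: "Hausdorff_space (unit_topology G)"
    and f: "f \<in> steinberg_algebra G" and g: "g \<in> steinberg_algebra G"
  shows "convolution G f g \<in> steinberg_algebra G"
proof -
  have *: "convolution G (indicator B) g \<in> steinberg_algebra G"
    if B: "B \<in> compact_open_bisections G" for B
    using g
  proof (induction g rule: steinberg_induct)
    case (add D c g)
    then show ?case
      using indicator_in_steinberg[OF B] bisection_mult_closed[OF haus B add(1)]
      by (simp add: convolution_add_right convolution_scale_right convolution_indicator_indicator[OF B]
          steinberg_add steinberg_scale indicator_in_steinberg)
  qed (simp add: steinberg_zero)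
  show ?thesis
    using f
  proof (induction f rule: steinberg_induct)
    case (add B c f)
    then show ?case
      using indicator_in_steinberg[OF add(1)] *[OF add(1)]
      by (simp add: convolution_add_left convolution_scale_left steinberg_add steinberg_scale)
  qed (simp add: steinberg_zero)
qed

lemma convolution_assoc:
  assumes haus: "Hausdorff_space (unit_topology G)"
    and f: "f \<in> steinberg_algebra G" and g: "g \<in> steinberg_algebra G"
  shows "convolution G (convolution G f g) \<xi> = convolution G f (convolution G g \<xi>)"
proof -
  note [simp] = steinberg_convolution[OF haus] steinberg_add steinberg_scale indicator_in_steinberg
    convolution_add_left convolution_scale_left convolution_add_right convolution_scale_right
  have *: "convolution G (convolution G (indicator B) g) \<xi> = convolution G (indicator B) (convolution G g \<xi>)"
    if B: "B \<in> compact_open_bisections G" for B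
    using g
  proof (induction g rule: steinberg_induct)
    case (add D c g)
    then show ?case
      using B bisection_mult_closed[OF haus B add(1)] convolution_indicator_bisection_mult[OF B add(1)]
      by (simp add: convolution_indicator_indicator[OF B])
  qed simp
  show ?thesis
    using f
  proof (induction f rule: steinberg_induct)
    case (add B c f)
    then show ?case
      using g by (simp add: *)
  qed simp
qed

lemma involution_indicator:
  assumes B: "B \<in> compact_open_bisections G"
  shows "involution G (indicator B) = indicator (bisection_inv B)"
proof
  fix x
  have "x \<in> garrows G \<and> ginv G x \<in> B \<longleftrightarrow> x \<in> bisection_inv B"
    using bisectionD(7)[OF B] inv_closed inv_inv by (force simp: bisection_inv_def)
  then show "involution G (indicator B) x = indicator (bisection_inv B) x"
    by (auto simp: involution_def indicator_def)
qed

lemma involution_add_scale: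
  "involution G (\<lambda>x. c * f x + g x) = (\<lambda>x. cnj c * involution G f x + involution G g x)"
  by (auto simp: involution_def)

lemma steinberg_involution:
  assumes "f \<in> steinberg_algebra G"
  shows "involution G f \<in> steinberg_algebra G"
  using assms
proof (induction f rule: steinberg_induct)
  case zero
  have "involution G (\<lambda>_. 0) = (\<lambda>_. 0)" by (auto simp: involution_def)
  then show ?case by (simp add: steinberg_zero)
next
  case (add B c f)
  then show ?case
    by (simp add: involution_add_scale involution_indicator steinberg_add steinberg_scale
        indicator_in_steinberg bisection_inv_closed)
qed

text \<open>The reason why \<open>1\<^sub>B\<close> acts as a partial isometry: \<open>B\<^sup>-\<^sup>1 B\<close> consists of units.\<close>
lemma bisection_inv_mult_self:
  assumes B: "B \<in> compact_open_bisections G"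
  shows "bisection_mult (bisection_inv B) B = gsource G ` B"
proof safe
  fix z assume "z \<in> bisection_mult (bisection_inv B) B"
  then obtain x y where xy: "x \<in> B" "y \<in> B" "(ginv G x, y) \<in> gcomp G" "z = gmult G (ginv G x) y"
    by (auto simp: bisection_mult_def bisection_inv_def)
  then have "grange G x = grange G y" using bisectionD(7)[OF B] by (simp add: comp_iff)
  then have "x = y" using xy inj_onD[OF bisectionD(4)[OF B]] by blast
  then show "z \<in> gsource G ` B" using xy by (simp add: gsource_def)
next
  fix x assume "x \<in> B"
  then show "gsource G x \<in> bisection_mult (bisection_inv B) B"
    using inv_comp bisectionD(7)[OF B] by (auto simp: bisection_mult_def bisection_inv_def gsource_def)
qed

lemma unit_set_projection:
  assumes V: "V \<in> compact_open_bisections G" "V \<subseteq> gunits G"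
  shows "involution G (indicator V) = indicator V"
    and "convolution G (indicator V) (indicator V) = indicator V"
proof -
  have inv: "bisection_inv V = V"
    using V(2) inv_unit by (force simp: bisection_inv_def image_iff)
  then show "involution G (indicator V) = indicator V"
    using involution_indicator[OF V(1)] by simp
  have "gsource G ` V = V" using V(2) by (force simp: units_iff image_iff)
  then show "convolution G (indicator V) (indicator V) = indicator V"
    using convolution_indicator_indicator[OF V(1), of V] bisection_inv_mult_self[OF V(1)] inv by simp
qed

lemma steinberg_support:
  assumes "f \<in> steinberg_algebra G"
  shows "\<exists>V\<in>compact_open_bisections G. V \<subseteq> gunits G \<and> (\<forall>x. f x \<noteq> 0 \<longrightarrow> x \<in> garrows G \<and> gsource G x \<in> V)"
  using assms
proof (induction f rule: steinberg_induct)
  case zero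
  have "{} \<in> compact_open_bisections G" by (intro unit_set_bisection) auto
  then show ?case by auto
next
  case (add B c f)
  then obtain V where V: "V \<in> compact_open_bisections G" "V \<subseteq> gunits G"
    "\<forall>x. f x \<noteq> 0 \<longrightarrow> x \<in> garrows G \<and> gsource G x \<in> V" by blast
  have sB: "gsource G ` B \<subseteq> gunits G" using bisectionD(7)[OF add(1)] by auto
  have "V \<union> gsource G ` B \<in> compact_open_bisections G"
    using bisectionD(1,2)[OF V(1)] bisectionD(1,2)[OF source_bisection[OF add(1)]] V(2) sB
    by (intro unit_set_bisection openin_Un compactin_Un) auto
  moreover have "c * indicator B x + f x \<noteq> 0 \<Longrightarrow> x \<in> garrows G \<and> gsource G x \<in> V \<union> gsource G ` B" for x
    using V(3) bisectionD(7)[OF add(1)] by (cases "x \<in> B") auto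
  ultimately show ?case using V(2) sB by (intro bexI[of _ "V \<union> gsource G ` B"]) auto
qed

text \<open>Multiplication from the right by a set of units restricts a function to the arrows whose source lies in that set.\<close>
lemma convolution_unit_indicator:
  assumes f: "f \<in> steinberg_algebra G" and V: "V \<subseteq> gunits G"
  shows "convolution G f (indicator V) z = f z * indicator V (gsource G z)"
proof (cases "z \<in> garrows G")
  case z: True
  let ?F = "{a \<in> garrows G. grange G a = grange G z \<and> f a \<noteq> 0}"
  have "f a * indicator V (gmult G (ginv G a) z) = (if a = z then f z * indicator V (gsource G z) else 0)"
    if a: "a \<in> ?F" for a
  proof (cases "a = z")
    case False
    have "gmult G (ginv G a) z \<notin> V"
    proof
      assume "gmult G (ginv G a) z \<in> V"
      then have u: "gmult G (ginv G a) z \<in> gunits G" using V by blast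
      have c: "(a, gmult G (ginv G a) z) \<in> gcomp G"
        using a z by (intro comp_inv_mult) auto
      then have "gmult G (ginv G a) z = gsource G a"
        using range_unit[OF u] by (simp add: comp_iff)
      then show False
        using mult_inv_mult[of a z] a z False by simp
    qed
    then show ?thesis using False by simp
  qed (simp add: gsource_def)
  then have "convolution G f (indicator V) z = (\<Sum>a\<in>?F. if a = z then f z * indicator V (gsource G z) else 0)"
    by (subst convolution_steinberg[OF f z]) (rule sum.cong, auto)
  also have "\<dots> = f z * indicator V (gsource G z)"
    using steinberg_fibre_finite[OF f, of "grange G z"] z by (auto simp: sum.delta)
  finally show ?thesis .
next
  case False
  then show ?thesis using steinberg_support[OF f] by (auto simp: convolution_outside)
qed

lemma local_unit:
  assumes f: "f \<in> steinberg_algebra G"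
  obtains V where "V \<in> compact_open_bisections G" "V \<subseteq> gunits G" "convolution G f (indicator V) = f"
proof -
  obtain V where V: "V \<in> compact_open_bisections G" "V \<subseteq> gunits G"
    and supp: "\<And>x. f x \<noteq> 0 \<Longrightarrow> x \<in> garrows G \<and> gsource G x \<in> V"
    using steinberg_support[OF f] by blast
  have "convolution G f (indicator V) z = f z" for z
    using supp[of z] by (cases "f z = 0") (simp_all add: convolution_unit_indicator[OF f V(2)])
  then show ?thesis using that V by blast
qed

end

section \<open>Bounding representations and the cyclic model\<close>

text \<open>The conditions of \<^const>\<open>star_hom\<close> without continuity of the operators, which is automatic by
  \<open>star_homI\<close>.\<close>
definition algebraic_star_hom ::
    "'g top_groupoid \<Rightarrow> 'h hilbert \<Rightarrow> (('g \<Rightarrow> complex) \<Rightarrow> 'h \<Rightarrow> 'h) \<Rightarrow> bool" where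
  "algebraic_star_hom G H \<pi> \<longleftrightarrow>
     (\<forall>f\<in>steinberg_algebra G. \<pi> f \<in> carrier H \<rightarrow> carrier H \<and>
        (\<forall>u\<in>carrier H. \<forall>v\<in>carrier H. \<pi> f (u \<oplus>\<^bsub>H\<^esub> v) = \<pi> f u \<oplus>\<^bsub>H\<^esub> \<pi> f v) \<and>
        (\<forall>a. \<forall>u\<in>carrier H. \<pi> f (a \<odot>\<^bsub>H\<^esub> u) = a \<odot>\<^bsub>H\<^esub> \<pi> f u)) \<and>
     (\<forall>f\<in>steinberg_algebra G. \<forall>g\<in>steinberg_algebra G. \<forall>u\<in>carrier H.
        \<pi> (\<lambda>x. f x + g x) u = \<pi> f u \<oplus>\<^bsub>H\<^esub> \<pi> g u) \<and>
     (\<forall>a. \<forall>f\<in>steinberg_algebra G. \<forall>u\<in>carrier H. \<pi> (\<lambda>x. a * f x) u = a \<odot>\<^bsub>H\<^esub> \<pi> f u) \<and>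
     (\<forall>f\<in>steinberg_algebra G. \<forall>g\<in>steinberg_algebra G. \<forall>u\<in>carrier H.
        \<pi> (convolution G f g) u = \<pi> f (\<pi> g u)) \<and>
     (\<forall>f\<in>steinberg_algebra G. is_adjoint H (\<pi> (involution G f)) (\<pi> f))"

lemma algebraic_star_homD:
  assumes "algebraic_star_hom G H \<pi>" "f \<in> steinberg_algebra G"
  shows "u \<in> carrier H \<Longrightarrow> \<pi> f u \<in> carrier H"
    and "\<lbrakk>g \<in> steinberg_algebra G; u \<in> carrier H\<rbrakk> \<Longrightarrow> \<pi> (\<lambda>x. f x + g x) u = \<pi> f u \<oplus>\<^bsub>H\<^esub> \<pi> g u"
    and "u \<in> carrier H \<Longrightarrow> \<pi> (\<lambda>x. a * f x) u = a \<odot>\<^bsub>H\<^esub> \<pi> f u"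
    and "\<lbrakk>g \<in> steinberg_algebra G; u \<in> carrier H\<rbrakk> \<Longrightarrow> \<pi> (convolution G f g) u = \<pi> f (\<pi> g u)"
    and "\<lbrakk>u \<in> carrier H; v \<in> carrier H\<rbrakk> \<Longrightarrow> cinner H (\<pi> (involution G f) u) v = cinner H u (\<pi> f v)"
  using assms unfolding algebraic_star_hom_def is_adjoint_def Pi_iff by blast+

lemma star_hom_iff: "star_hom G H \<pi> \<longleftrightarrow> algebraic_star_hom G H \<pi> \<and>
    (\<forall>f\<in>steinberg_algebra G. \<exists>C. \<forall>u\<in>carrier H. hnorm H (\<pi> f u) \<le> C * hnorm H u)"
  unfolding star_hom_def algebraic_star_hom_def bounded_operator_def by blast

lemma hilbert_space_imp_semi_inner_space:
  assumes "hilbert_space H"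
  shows "semi_inner_space H"
proof -
  interpret H: hilbert_space H by fact
  show ?thesis
    by (intro semi_inner_space.intro semi_inner_space_axioms.intro H.module_axioms
        H.cinner_add H.cinner_smult H.cinner_commute H.cinner_nonneg)
qed

text \<open>The cyclic subspace generated by \<open>u\<close>, with \<open>g\<close> standing for \<open>\<pi>(g)u\<close> as in the construction of Gelfand,
  Naimark and Segal. Vectors are not identified when they represent the same element.\<close>
definition gns_space ::
    "'g top_groupoid \<Rightarrow> 'h hilbert \<Rightarrow> (('g \<Rightarrow> complex) \<Rightarrow> 'h \<Rightarrow> 'h) \<Rightarrow> 'h \<Rightarrow> ('g \<Rightarrow> complex) hilbert" where
  "gns_space G H \<pi> u = \<lparr>carrier = steinberg_algebra G, monoid.mult = (\<lambda>f g. undefined), one = undefined,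
     zero = (\<lambda>x. 0), add = (\<lambda>f g x. f x + g x), smult = (\<lambda>a f x. a * f x),
     cinner = (\<lambda>f g. cinner H (\<pi> f u) (\<pi> g u))\<rparr>"

definition finite_support_space :: "'g top_groupoid \<Rightarrow> ('g \<Rightarrow> complex) hilbert" where
  "finite_support_space G = \<lparr>carrier = {\<xi>. finite {x. \<xi> x \<noteq> 0} \<and> {x. \<xi> x \<noteq> 0} \<subseteq> garrows G},
     monoid.mult = (\<lambda>f g. undefined), one = undefined,
     zero = (\<lambda>x. 0), add = (\<lambda>f g x. f x + g x), smult = (\<lambda>a f x. a * f x),
     cinner = (\<lambda>\<xi> \<eta>. \<Sum>x | \<xi> x \<noteq> 0. \<xi> x * cnj (\<eta> x))\<rparr>"

lemma module_of_functions:
  fixes M :: "('x \<Rightarrow> complex) hilbert"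
  assumes zero: "\<zero>\<^bsub>M\<^esub> = (\<lambda>x. 0)" and add: "add M = (\<lambda>f g x. f x + g x)"
    and smult: "smult M = (\<lambda>a f x. a * f x)"
    and "(\<lambda>x. 0) \<in> carrier M"
    and "\<And>f g. \<lbrakk>f \<in> carrier M; g \<in> carrier M\<rbrakk> \<Longrightarrow> (\<lambda>x. f x + g x) \<in> carrier M"
    and scale: "\<And>a f. f \<in> carrier M \<Longrightarrow> (\<lambda>x. a * f x) \<in> carrier M"
  shows "Module.module (ring_of_type_algebra :: complex ring) M"
proof (rule moduleI)
  show "cring (ring_of_type_algebra :: complex ring)" ..
  show "abelian_group M"
  proof (rule abelian_groupI)
    fix f assume "f \<in> carrier M"
    then show "\<exists>g\<in>carrier M. g \<oplus>\<^bsub>M\<^esub> f = \<zero>\<^bsub>M\<^esub>"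
      using scale[of f "-1"] by (intro bexI[of _ "\<lambda>x. - 1 * f x"]) (simp_all add: zero add)
  qed (use assms in \<open>simp_all add: algebra_simps\<close>)
qed (use assms in \<open>simp_all add: ring_of_type_algebra_def algebra_simps\<close>)

context ample_groupoid
begin

text \<open>Let \<open>p = \<pi>(1\<^sub>V)u\<close> with \<open>V = s(B)\<close>. The identities \<open>(1\<^sub>B)\<^sup>* 1\<^sub>B = 1\<^sub>V = (1\<^sub>V)\<^sup>* 1\<^sub>V\<close> show that
  \<open>\<pi>(1\<^sub>B)u\<close> and \<open>p\<close> both have squared norm \<open>\<langle>p, u\<rangle>\<close>; now apply the Cauchy--Schwarz
  inequality, first to \<open>p\<close>.\<close>
lemma indicator_contraction:
  assumes H: "semi_inner_space H" and \<pi>: "algebraic_star_hom G H \<pi>"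
    and B: "B \<in> compact_open_bisections G" and u: "u \<in> carrier H"
  shows "hnorm H (\<pi> (indicator B) u) \<le> hnorm H u"
proof -
  interpret H: semi_inner_space H by fact
  note D = algebraic_star_homD[OF \<pi>]
  let ?V = "gsource G ` B"
  have V: "?V \<in> compact_open_bisections G" "?V \<subseteq> gunits G"
    using source_bisection[OF B] bisectionD(7)[OF B] by auto
  note I [simp] = indicator_in_steinberg[OF B] indicator_in_steinberg[OF V(1)]
  define b p where "b = \<pi> (indicator B) u" and "p = \<pi> (indicator ?V) u"
  have car: "b \<in> carrier H" "p \<in> carrier H" using u by (simp_all add: b_def p_def D)
  have "cinner H p p = cinner H (\<pi> (indicator ?V) p) u"
    using D(5)[OF I(2), of p u] unit_set_projection(1)[OF V] car u by (simp add: p_def)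
  also have "\<pi> (indicator ?V) p = p"
    using D(4)[OF I(2) I(2), of u] unit_set_projection(2)[OF V] u by (simp add: p_def)
  finally have pp: "cinner H p p = cinner H p u" .
  have "cinner H b b = cinner H (\<pi> (involution G (indicator B)) b) u"
    using D(5)[OF I(1), of b u] car u by (simp add: b_def)
  also have "\<pi> (involution G (indicator B)) b = \<pi> (convolution G (involution G (indicator B)) (indicator B)) u"
    using D(4)[OF steinberg_involution[OF I(1)] I(1), of u] u by (simp add: b_def)
  also have "convolution G (involution G (indicator B)) (indicator B) = indicator ?V"
    by (simp add: involution_indicator[OF B] convolution_indicator_indicator[OF bisection_inv_closed[OF B]]
        bisection_inv_mult_self[OF B])
  finally have bb: "cinner H b b = cinner H p u"
    by (simp add: p_def)
  have sq: "(hnorm H v)\<^sup>2 \<le> hnorm H p * hnorm H u" if "v \<in> carrier H" "cinner H v v = cinner H p u" for v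
    using H.Cauchy_Schwarz[OF car(2) u] H.cinner_self[OF that(1)] that(2)
    by (metis abs_power2 norm_of_real)
  have "hnorm H p \<le> hnorm H u"
    using sq[OF car(2) pp] H.hnorm_nonneg[OF car(2)] H.hnorm_nonneg[OF u]
    by (cases "hnorm H p = 0") (simp_all add: power2_eq_square)
  then have "hnorm H p * hnorm H u \<le> hnorm H u * hnorm H u"
    using H.hnorm_nonneg[OF u] by (rule mult_right_mono)
  then have "(hnorm H b)\<^sup>2 \<le> (hnorm H u)\<^sup>2"
    using sq[OF car(1) bb] by (simp add: power2_eq_square)
  then show ?thesis
    unfolding b_def[symmetric] by (rule power2_le_imp_le) (simp add: u)
qed

text \<open>The bound is chosen before the space and the representation, so it serves both for the
  continuity of each operator and for the finiteness of the supremum.\<close>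
lemma uniform_bound:
  assumes "f \<in> steinberg_algebra G"
  shows "\<exists>C. \<forall>(H :: 'h hilbert) \<pi> u. semi_inner_space H \<longrightarrow> algebraic_star_hom G H \<pi> \<longrightarrow> u \<in> carrier H \<longrightarrow>
    hnorm H (\<pi> f u) \<le> C * hnorm H u"
  using assms
proof (induction f rule: steinberg_induct)
  case zero
  have "hnorm H (\<pi> (\<lambda>_. 0) u) \<le> 0 * hnorm H u"
    if "semi_inner_space H" "algebraic_star_hom G H \<pi>" "u \<in> carrier H" for H :: "'h hilbert" and \<pi> u
  proof -
    interpret H: semi_inner_space H by fact
    have "\<pi> (\<lambda>_. 0) u = 0 \<odot>\<^bsub>H\<^esub> \<pi> (\<lambda>_. 0) u"
      using algebraic_star_homD(3)[OF that(2) steinberg_zero, of u 0] that by simp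
    then have "hnorm H (\<pi> (\<lambda>_. 0) u) = cmod 0 * hnorm H (\<pi> (\<lambda>_. 0) u)"
      using H.hnorm_smult[of "\<pi> (\<lambda>_. 0) u" 0] algebraic_star_homD(1)[OF that(2) steinberg_zero that(3)] by metis
    then show ?thesis by simp
  qed
  then show ?case by blast
next
  case (add B c f)
  then obtain C where C: "\<And>(H :: 'h hilbert) \<pi> u. \<lbrakk>semi_inner_space H; algebraic_star_hom G H \<pi>; u \<in> carrier H\<rbrakk>
      \<Longrightarrow> hnorm H (\<pi> f u) \<le> C * hnorm H u" by blast
  have "hnorm H (\<pi> (\<lambda>x. c * indicator B x + f x) u) \<le> (cmod c + C) * hnorm H u"
    if "semi_inner_space H" "algebraic_star_hom G H \<pi>" "u \<in> carrier H" for H :: "'h hilbert" and \<pi> u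
  proof -
    interpret H: semi_inner_space H by fact
    note D = algebraic_star_homD[OF that(2)]
    note I = indicator_in_steinberg[OF add(1)]
    have "\<pi> (\<lambda>x. c * indicator B x + f x) u = c \<odot>\<^bsub>H\<^esub> \<pi> (indicator B) u \<oplus>\<^bsub>H\<^esub> \<pi> f u"
      using D(2)[OF steinberg_scale[OF I] add(2) that(3)] D(3)[OF I that(3)] by simp
    moreover have "hnorm H (c \<odot>\<^bsub>H\<^esub> \<pi> (indicator B) u \<oplus>\<^bsub>H\<^esub> \<pi> f u)
        \<le> cmod c * hnorm H (\<pi> (indicator B) u) + hnorm H (\<pi> f u)"
      using H.hnorm_triangle[of "c \<odot>\<^bsub>H\<^esub> \<pi> (indicator B) u" "\<pi> f u"] D(1)[OF I that(3)] D(1)[OF add(2) that(3)]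
      by (simp add: H.hnorm_smult)
    moreover have "cmod c * hnorm H (\<pi> (indicator B) u) \<le> cmod c * hnorm H u"
      by (intro mult_left_mono indicator_contraction add that) simp
    ultimately show ?thesis
      using C[OF that] by (simp add: distrib_right)
  qed
  then show ?case by blast
qed

lemma star_homI:
  fixes H :: "'h hilbert"
  assumes H: "semi_inner_space H" and \<pi>: "algebraic_star_hom G H \<pi>"
  shows "star_hom G H \<pi>"
  unfolding star_hom_iff
proof (intro conjI ballI \<pi>)
  fix f assume f: "f \<in> steinberg_algebra G"
  obtain C where C: "\<forall>(H :: 'h hilbert) \<pi> u. semi_inner_space H \<longrightarrow> algebraic_star_hom G H \<pi> \<longrightarrow>
      u \<in> carrier H \<longrightarrow> hnorm H (\<pi> f u) \<le> C * hnorm H u"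
    using uniform_bound[OF f] by (rule exE)
  show "\<exists>C. \<forall>u\<in>carrier H. hnorm H (\<pi> f u) \<le> C * hnorm H u"
    by (intro exI[of _ C] ballI C[rule_format] H \<pi>)
qed

lemma bdd_above_rep_norms:
  assumes f: "f \<in> steinberg_algebra G"
  shows "bdd_above (rep_norms G TYPE('h) f)"
proof -
  obtain C where C: "\<forall>(H :: 'h hilbert) \<pi> u. semi_inner_space H \<longrightarrow> algebraic_star_hom G H \<pi> \<longrightarrow>
      u \<in> carrier H \<longrightarrow> hnorm H (\<pi> f u) \<le> C * hnorm H u"
    using uniform_bound[OF f] by (rule exE)
  have "operator_norm H (\<pi> f) \<le> \<bar>C\<bar>" if "hilbert_space H" "star_hom G H \<pi>" for H :: "'h hilbert" and \<pi>
  proof -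
    interpret H: semi_inner_space H using that(1) by (rule hilbert_space_imp_semi_inner_space)
    show ?thesis
    proof (rule H.operator_norm_least)
      fix u assume u: "u \<in> carrier H" "hnorm H u \<le> 1"
      have "hnorm H (\<pi> f u) \<le> C * hnorm H u"
        using that u by (intro C[rule_format] H.semi_inner_space_axioms) (simp_all add: star_hom_iff)
      also have "\<dots> \<le> \<bar>C\<bar> * 1" using u by (intro mult_mono) auto
      finally show "hnorm H (\<pi> f u) \<le> \<bar>C\<bar>" by simp
    qed
  qed
  then show ?thesis unfolding rep_norms_def by (intro bdd_aboveI[where M = "\<bar>C\<bar>"]) blast
qed

context
  assumes haus: "Hausdorff_space (unit_topology G)"
begin

text \<open>Left convolution by \<open>f\<close> corresponds to \<open>\<pi>(f)\<close> on the cyclic subspace.\<close>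
lemma gns_representation:
  assumes H: "semi_inner_space H" and \<pi>: "algebraic_star_hom G H \<pi>" and u: "u \<in> carrier H"
  shows "semi_inner_space (gns_space G H \<pi> u)" "star_hom G (gns_space G H \<pi> u) (convolution G)"
proof -
  interpret H: semi_inner_space H by fact
  note D = algebraic_star_homD[OF \<pi>]
  let ?M = "gns_space G H \<pi> u"
  have c: "carrier ?M = steinberg_algebra G" by (simp add: gns_space_def)
  have i: "cinner ?M = (\<lambda>f g. cinner H (\<pi> f u) (\<pi> g u))" by (simp add: gns_space_def)
  have ops: "add ?M = (\<lambda>f g x. f x + g x)" "smult ?M = (\<lambda>a f x. a * f x)" by (simp_all add: gns_space_def)
  note [simp] = D(1)[OF _ u]
  show M: "semi_inner_space ?M"
  proof (intro semi_inner_space.intro semi_inner_space_axioms.intro)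
    show "Module.module ring_of_type_algebra ?M"
      by (rule module_of_functions) (simp_all add: gns_space_def steinberg_zero steinberg_add steinberg_scale)
  next
    fix f g assume "f \<in> carrier ?M" "g \<in> carrier ?M"
    then show "cinner ?M f g = cnj (cinner ?M g f)"
      unfolding c i by (intro H.cinner_commute) simp_all
  qed (simp_all add: c i ops u D H.cinner_add H.cinner_smult H.cinner_nonneg)
  have adj: "cinner H (\<pi> (convolution G (involution G f) g) u) (\<pi> h u) = cinner H (\<pi> g u) (\<pi> (convolution G f h) u)"
    if "f \<in> steinberg_algebra G" "g \<in> steinberg_algebra G" "h \<in> steinberg_algebra G" for f g h
    using that u by (simp add: D(4,5) steinberg_involution)
  show "star_hom G ?M (convolution G)"
  proof (rule star_homI[OF M])
    show "algebraic_star_hom G ?M (convolution G)"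
      unfolding algebraic_star_hom_def is_adjoint_def c i ops
      by (auto simp: steinberg_convolution[OF haus] convolution_add_left convolution_add_right
          convolution_scale_left convolution_scale_right convolution_assoc[OF haus] adj)
  qed
qed

text \<open>The completion of the cyclic model consists of sequences in the algebra. In it the class of the constant sequence
  \<open>1\<^sub>V\<close> has the norm of \<open>\<pi>(1\<^sub>V)u\<close>, at most that of \<open>u\<close>, and is mapped by \<open>f\<close> to a
  vector with the norm of \<open>\<pi>(f)u\<close>.\<close>
lemma rep_norm_dominates:
  assumes H: "semi_inner_space H" and \<pi>: "algebraic_star_hom G H \<pi>" and u: "u \<in> carrier H"
    and f: "f \<in> steinberg_algebra G"
  shows "\<exists>t\<in>rep_norms G TYPE(nat \<Rightarrow> 'a \<Rightarrow> complex) f. hnorm H (\<pi> f u) \<le> t * hnorm H u"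
proof -
  interpret H: semi_inner_space H by fact
  let ?M = "gns_space G H \<pi> u"
  interpret M: semi_inner_space ?M by (rule gns_representation(1)[OF H \<pi> u])
  interpret C: semi_inner_space "completion ?M" by (rule M.semi_inner_space_completion)
  have carM: "carrier ?M = steinberg_algebra G" by (simp add: gns_space_def)
  have normM: "hnorm ?M g = hnorm H (\<pi> g u)" for g by (simp add: hnorm_def gns_space_def)
  let ?T = "extend_op ?M (convolution G f)"
  have hom: "star_hom G (completion ?M) (\<lambda>f. extend_op ?M (convolution G f))"
    by (rule M.star_hom_completion[OF gns_representation(2)[OF H \<pi> u]])
      (simp_all add: steinberg_convolution[OF haus] steinberg_involution steinberg_add steinberg_scale)
  define t where "t = operator_norm (completion ?M) ?T"
  have t: "t \<in> rep_norms G TYPE(nat \<Rightarrow> 'a \<Rightarrow> complex) f"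
    unfolding rep_norms_def t_def using M.hilbert_space_completion hom
    by (intro CollectI exI[of _ "completion ?M"] exI[of _ "\<lambda>f. extend_op ?M (convolution G f)"]) simp
  obtain V where V: "V \<in> compact_open_bisections G" "convolution G f (indicator V) = f"
    using local_unit[OF f] by metis
  have bdd: "bounded_operator (completion ?M) ?T" using star_homD(1)[OF hom f] .
  let ?x = "limit_rep ?M (\<lambda>_. indicator V)"
  have iV: "indicator V \<in> carrier ?M" using V by (simp add: carM indicator_in_steinberg)
  have "?T ?x = limit_rep ?M (\<lambda>_. f)"
    using M.extend_op_limit_rep[OF star_homD(1)[OF gns_representation(2)[OF H \<pi> u] f] M.cauchy_seqs_const[OF iV]] V
    by simp
  then have "hnorm H (\<pi> f u) = hnorm (completion ?M) (?T ?x)"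
    using M.hnorm_limit_rep_const[of f] f by (simp add: normM carM)
  also have "\<dots> \<le> t * hnorm (completion ?M) ?x"
    unfolding t_def by (rule C.operator_norm_bound[OF bdd]) simp
  also have "hnorm (completion ?M) ?x = hnorm H (\<pi> (indicator V) u)"
    using M.hnorm_limit_rep_const[OF iV] by (simp add: normM)
  also have "t * \<dots> \<le> t * hnorm H u"
    unfolding t_def by (intro mult_left_mono indicator_contraction H \<pi> V u C.operator_norm_nonneg bdd)
  finally show ?thesis using t by blast
qed

end

end

section \<open>The regular representation\<close>

context ample_groupoid
begin

lemma carrier_finite_support_space:
  "\<xi> \<in> carrier (finite_support_space G) \<longleftrightarrow> finite {x. \<xi> x \<noteq> 0} \<and> {x. \<xi> x \<noteq> 0} \<subseteq> garrows G"
  by (simp add: finite_support_space_def)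

lemma finite_support_ops:
  "add (finite_support_space G) = (\<lambda>f g x. f x + g x)"
  "smult (finite_support_space G) = (\<lambda>a f x. a * f x)"
  by (simp_all add: finite_support_space_def)

text \<open>The set over which the sum is taken may be any finite set containing the common support of \<open>\<xi>\<close> and
  \<open>\<eta>\<close>, as suits the calculation.\<close>
lemma finite_support_cinner:
  assumes "finite {x. \<xi> x \<noteq> 0}" "finite F" "\<And>x. \<lbrakk>\<xi> x \<noteq> 0; \<eta> x \<noteq> 0\<rbrakk> \<Longrightarrow> x \<in> F"
  shows "cinner (finite_support_space G) \<xi> \<eta> = (\<Sum>x\<in>F. \<xi> x * cnj (\<eta> x))"
  unfolding finite_support_space_def hilbert.simps
  by (rule sum.mono_neutral_cong) (use assms in auto)

lemma finite_support_closed: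
  assumes "\<xi> \<in> carrier (finite_support_space G)"
  shows "(\<lambda>x. a * \<xi> x) \<in> carrier (finite_support_space G)"
    and "\<eta> \<in> carrier (finite_support_space G) \<Longrightarrow> (\<lambda>x. \<xi> x + \<eta> x) \<in> carrier (finite_support_space G)"
proof -
  have "{x. a * \<xi> x \<noteq> 0} \<subseteq> {x. \<xi> x \<noteq> 0}" by auto
  then show "(\<lambda>x. a * \<xi> x) \<in> carrier (finite_support_space G)"
    using assms unfolding carrier_finite_support_space by (meson finite_subset order_trans)
  assume \<eta>: "\<eta> \<in> carrier (finite_support_space G)"
  have "{x. \<xi> x + \<eta> x \<noteq> 0} \<subseteq> {x. \<xi> x \<noteq> 0} \<union> {x. \<eta> x \<noteq> 0}" by auto
  moreover have "finite ({x. \<xi> x \<noteq> 0} \<union> {x. \<eta> x \<noteq> 0})" "{x. \<xi> x \<noteq> 0} \<union> {x. \<eta> x \<noteq> 0} \<subseteq> garrows G"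
    using assms \<eta> unfolding carrier_finite_support_space by auto
  ultimately show "(\<lambda>x. \<xi> x + \<eta> x) \<in> carrier (finite_support_space G)"
    unfolding carrier_finite_support_space by (meson finite_subset order_trans)
qed

lemma semi_inner_finite_support: "semi_inner_space (finite_support_space G)"
proof (intro semi_inner_space.intro semi_inner_space_axioms.intro)
  show "Module.module ring_of_type_algebra (finite_support_space G)"
    by (rule module_of_functions)
      (simp_all add: finite_support_ops finite_support_closed, simp_all add: finite_support_space_def)
next
  fix u v w and a :: complex
  assume u: "u \<in> carrier (finite_support_space G)"
  then have fu: "finite {x. u x \<noteq> 0}" by (simp add: carrier_finite_support_space)
  show "0 \<le> Re (cinner (finite_support_space G) u u)"
    unfolding finite_support_space_def by (auto intro!: sum_nonneg)
  assume v: "v \<in> carrier (finite_support_space G)"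
  then have fv: "finite {x. v x \<noteq> 0}" by (simp add: carrier_finite_support_space)
  have "finite {x. a * u x \<noteq> 0}" by (rule finite_subset[OF _ fu]) auto
  then show "cinner (finite_support_space G) (a \<odot>\<^bsub>finite_support_space G\<^esub> u) v = a * cinner (finite_support_space G) u v"
    using finite_support_cinner[of "\<lambda>x. a * u x" "{x. u x \<noteq> 0}" v]
      finite_support_cinner[of u "{x. u x \<noteq> 0}" v] fu
    by (simp add: finite_support_ops sum_distrib_left mult.assoc)
  show "cinner (finite_support_space G) u v = cnj (cinner (finite_support_space G) v u)"
    using finite_support_cinner[OF fu, of "{x. u x \<noteq> 0} \<union> {x. v x \<noteq> 0}" v]
      finite_support_cinner[OF fv, of "{x. u x \<noteq> 0} \<union> {x. v x \<noteq> 0}" u] fu fv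
    by (simp add: mult.commute)
  assume w: "w \<in> carrier (finite_support_space G)"
  let ?F = "{x. u x \<noteq> 0} \<union> {x. v x \<noteq> 0}"
  have F: "finite ?F" using fu fv by simp
  have "finite {x. u x + v x \<noteq> 0}" by (rule finite_subset[OF _ F]) auto
  then show "cinner (finite_support_space G) (u \<oplus>\<^bsub>finite_support_space G\<^esub> v) w
      = cinner (finite_support_space G) u w + cinner (finite_support_space G) v w"
    using finite_support_cinner[of "\<lambda>x. u x + v x" ?F w] finite_support_cinner[of u ?F w]
      finite_support_cinner[of v ?F w] fu fv F
    by (fastforce simp: finite_support_ops sum.distrib distrib_right)
qed

lemma convolution_finite_support:
  assumes f: "f \<in> steinberg_algebra G" and \<xi>: "\<xi> \<in> carrier (finite_support_space G)"
  shows "convolution G f \<xi> \<in> carrier (finite_support_space G)"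
  using f
proof (induction f rule: steinberg_induct)
  case zero
  then show ?case by (simp add: carrier_finite_support_space)
next
  case (add B c f)
  have "{z. convolution G (indicator B) \<xi> z \<noteq> 0}
      \<subseteq> (\<lambda>w. gmult G (inv_into B (gsource G) (grange G w)) w) ` {w. \<xi> w \<noteq> 0}"
  proof
    fix z assume "z \<in> {z. convolution G (indicator B) \<xi> z \<noteq> 0}"
    then obtain b w where bw: "b \<in> B" "(b, w) \<in> gcomp G" "z = gmult G b w"
      using convolution_indicator_0[OF add(1)] by blast
    have "inv_into B (gsource G) (gsource G b) = b" using bisectionD(3)[OF add(1)] bw(1) by simp
    then have "z = gmult G (inv_into B (gsource G) (grange G w)) w"
      using bw by (simp add: comp_iff)
    moreover have "\<xi> w \<noteq> 0"
      using \<open>z \<in> _\<close> convolution_indicator[OF add(1) bw(1,2)] bw(3) by simp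
    ultimately show "z \<in> (\<lambda>w. gmult G (inv_into B (gsource G) (grange G w)) w) ` {w. \<xi> w \<noteq> 0}"
      by blast
  qed
  then have "finite {z. convolution G (indicator B) \<xi> z \<noteq> 0}"
    using \<xi> unfolding carrier_finite_support_space by (meson finite_imageI finite_subset)
  moreover have "{z. convolution G (indicator B) \<xi> z \<noteq> 0} \<subseteq> garrows G"
    using convolution_outside by blast
  ultimately have "convolution G (indicator B) \<xi> \<in> carrier (finite_support_space G)"
    by (simp add: carrier_finite_support_space)
  then show ?case
    using add(2,3) indicator_in_steinberg[OF add(1)]
    by (simp add: convolution_add_left convolution_scale_left steinberg_scale finite_support_closed)
qed

text \<open>Convolution by \<open>1\<^sub>B\<close> and by the characteristic function of \<open>B\<^sup>-\<^sup>1\<close> move values along mutually inverse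
  partial bijections, so the two inner products are sums over corresponding points.\<close>
lemma adjoint_indicator:
  assumes B: "B \<in> compact_open_bisections G"
    and \<xi>: "\<xi> \<in> carrier (finite_support_space G)"
  shows "cinner (finite_support_space G) (convolution G (indicator (bisection_inv B)) \<xi>) \<eta>
    = cinner (finite_support_space G) \<xi> (convolution G (indicator B) \<eta>)"
proof -
  define \<beta> where "\<beta> w = inv_into B (grange G) (grange G w)" for w
  \<comment> \<open>\<open>\<zeta>\<close> undoes left multiplication by points of \<open>B\<close>.\<close>
  define \<zeta> where "\<zeta> w = gmult G (ginv G (\<beta> w)) w" for w
  define W where "W = {w. \<xi> w \<noteq> 0 \<and> grange G w \<in> grange G ` B}"
  have arr: "w \<in> garrows G" if "\<xi> w \<noteq> 0" for w
    using \<xi> that unfolding carrier_finite_support_space by auto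
  have fin: "finite {w. \<xi> w \<noteq> 0}" using \<xi> unfolding carrier_finite_support_space by auto
  have W: "finite W" unfolding W_def by (rule finite_subset[OF _ fin]) auto
  note Binv = bisection_inv_closed[OF B]
  have \<beta>: "\<beta> w \<in> B" "ginv G (\<beta> w) \<in> bisection_inv B" "(ginv G (\<beta> w), w) \<in> gcomp G"
    "(\<beta> w, \<zeta> w) \<in> gcomp G" "gmult G (\<beta> w) (\<zeta> w) = w" if "w \<in> W" for w
  proof -
    have r: "grange G w \<in> grange G ` B" "w \<in> garrows G" using that arr by (auto simp: W_def)
    show b: "\<beta> w \<in> B" unfolding \<beta>_def by (rule inv_into_into[OF r(1)])
    have ar: "\<beta> w \<in> garrows G" using bisectionD(7)[OF B b] .
    have eq: "grange G (\<beta> w) = grange G w" unfolding \<beta>_def by (rule f_inv_into_f[OF r(1)])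
    show "ginv G (\<beta> w) \<in> bisection_inv B" using b by (simp add: bisection_inv_def)
    show "(ginv G (\<beta> w), w) \<in> gcomp G" by (rule comp_inv_left[OF ar r(2) eq])
    show "(\<beta> w, \<zeta> w) \<in> gcomp G" unfolding \<zeta>_def by (rule comp_inv_mult[OF ar r(2) eq])
    show "gmult G (\<beta> w) (\<zeta> w) = w" unfolding \<zeta>_def by (rule mult_inv_mult[OF ar r(2) eq])
  qed
  have inj: "inj_on \<zeta> W"
  proof (rule inj_onI)
    fix w w' assume w: "w \<in> W" "w' \<in> W" and eq: "\<zeta> w = \<zeta> w'"
    show "w = w'"
      by (rule left_mult_cancel(2)[OF Binv \<beta>(2)[OF w(1)] \<beta>(2)[OF w(2)] \<beta>(3)[OF w(1)] \<beta>(3)[OF w(2)]])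
        (rule eq[unfolded \<zeta>_def])
  qed
  have left: "convolution G (indicator (bisection_inv B)) \<xi> (\<zeta> w) = \<xi> w" if "w \<in> W" for w
    unfolding \<zeta>_def by (rule convolution_indicator[OF Binv \<beta>(2,3)]) fact+
  have right: "convolution G (indicator B) \<eta> w = \<eta> (\<zeta> w)" if "w \<in> W" for w
    using convolution_indicator[OF B \<beta>(1)[OF that] \<beta>(4)[OF that], of \<eta>] \<beta>(5)[OF that] by simp
  have supp_left: "z \<in> \<zeta> ` W" if nz: "convolution G (indicator (bisection_inv B)) \<xi> z \<noteq> 0" for z
  proof -
    obtain c w where cw: "c \<in> bisection_inv B" "(c, w) \<in> gcomp G" "z = gmult G c w"
      using nz convolution_indicator_0[OF Binv] by blast
    then obtain b where b: "b \<in> B" "c = ginv G b" by (auto simp: bisection_inv_def)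
    have "\<xi> w \<noteq> 0" using nz convolution_indicator[OF Binv cw(1,2)] cw(3) by simp
    moreover have eq: "grange G w = grange G b"
      using cw(2) b bisectionD(7)[OF B] by (simp add: comp_iff)
    moreover have "\<beta> w = b" unfolding \<beta>_def eq using bisectionD(4)[OF B] b by simp
    ultimately show ?thesis using cw b by (auto simp: \<zeta>_def W_def)
  qed
  have "cinner (finite_support_space G) (convolution G (indicator (bisection_inv B)) \<xi>) \<eta>
      = (\<Sum>z\<in>\<zeta> ` W. convolution G (indicator (bisection_inv B)) \<xi> z * cnj (\<eta> z))"
    using convolution_finite_support[OF indicator_in_steinberg[OF Binv] \<xi>] W supp_left
    unfolding carrier_finite_support_space by (intro finite_support_cinner) auto
  also have "\<dots> = (\<Sum>w\<in>W. \<xi> w * cnj (convolution G (indicator B) \<eta> w))"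
    unfolding sum.reindex[OF inj] by (rule sum.cong) (simp_all add: left right)
  also have "\<dots> = cinner (finite_support_space G) \<xi> (convolution G (indicator B) \<eta>)"
  proof (rule finite_support_cinner[OF fin W, symmetric])
    fix w assume "\<xi> w \<noteq> 0" and nz: "convolution G (indicator B) \<eta> w \<noteq> 0"
    then obtain b y where "b \<in> B" "(b, y) \<in> gcomp G" "w = gmult G b y"
      using convolution_indicator_0[OF B] by blast
    then show "w \<in> W" using \<open>\<xi> w \<noteq> 0\<close> by (simp add: W_def range_mult)
  qed
  finally show ?thesis .
qed

lemma regular_representation:
  assumes haus: "Hausdorff_space (unit_topology G)"
  shows "algebraic_star_hom G (finite_support_space G) (convolution G)"
proof -
  let ?S = "finite_support_space G"
  interpret S: semi_inner_space ?S by (rule semi_inner_finite_support)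
  have adj: "cinner ?S (convolution G (involution G f) \<xi>) \<eta> = cinner ?S \<xi> (convolution G f \<eta>)"
    if f: "f \<in> steinberg_algebra G" and \<xi>: "\<xi> \<in> carrier ?S" and \<eta>: "\<eta> \<in> carrier ?S" for f \<xi> \<eta>
    using f
  proof (induction f rule: steinberg_induct)
    case zero
    have "involution G (\<lambda>_. 0) = (\<lambda>_. 0)" by (auto simp: involution_def)
    then show ?case by (simp add: finite_support_space_def)
  next
    case (add B c f)
    note I = indicator_in_steinberg[OF add(1)] indicator_in_steinberg[OF bisection_inv_closed[OF add(1)]]
    note mem = convolution_finite_support[OF I(1) \<eta>] convolution_finite_support[OF I(2) \<xi>]
      convolution_finite_support[OF add(2) \<eta>] convolution_finite_support[OF steinberg_involution[OF add(2)] \<xi>]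
    have "cinner ?S (convolution G (involution G (\<lambda>x. c * indicator B x + f x)) \<xi>) \<eta>
        = cnj c * cinner ?S (convolution G (indicator (bisection_inv B)) \<xi>) \<eta>
          + cinner ?S (convolution G (involution G f) \<xi>) \<eta>"
      using S.cinner_add[OF finite_support_closed(1)[OF mem(2), of "cnj c"] mem(4) \<eta>]
        S.cinner_smult[OF mem(2) \<eta>, of "cnj c"]
      by (simp add: involution_add_scale involution_indicator[OF add(1)] finite_support_ops
          convolution_add_left convolution_scale_left steinberg_scale steinberg_involution I add(2))
    moreover have "cinner ?S \<xi> (convolution G (\<lambda>x. c * indicator B x + f x) \<eta>)
        = cnj c * cinner ?S \<xi> (convolution G (indicator B) \<eta>) + cinner ?S \<xi> (convolution G f \<eta>)"
      using S.cinner_add_right[OF \<xi> finite_support_closed(1)[OF mem(1), of c] mem(3)]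
        S.cinner_smult_right[OF \<xi> mem(1), of c]
      by (simp add: finite_support_ops convolution_add_left convolution_scale_left steinberg_scale I add(2))
    ultimately show ?case
      using add.IH adjoint_indicator[OF add(1) \<xi>] by simp
  qed
  show ?thesis
    unfolding algebraic_star_hom_def is_adjoint_def finite_support_ops
    by (auto simp: convolution_finite_support adj convolution_add_left convolution_add_right
        convolution_scale_left convolution_scale_right convolution_assoc[OF haus])
qed

text \<open>The vector is the point mass at the source of a point where \<open>f\<close> does not vanish.\<close>
lemma regular_representation_faithful:
  assumes f: "f \<in> steinberg_algebra G" and "f \<noteq> (\<lambda>x. 0)"
  obtains \<xi> where "\<xi> \<in> carrier (finite_support_space G)"
    "hnorm (finite_support_space G) (convolution G f \<xi>) > 0"
proof -
  obtain x where x: "f x \<noteq> 0" using assms(2) by auto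
  then have xG: "x \<in> garrows G" using steinberg_support[OF f] by blast
  let ?\<xi> = "indicator {gsource G x} :: 'a \<Rightarrow> complex"
  have supp: "{y. ?\<xi> y \<noteq> 0} = {gsource G x}" by (auto simp: indicator_def)
  have \<xi>: "?\<xi> \<in> carrier (finite_support_space G)"
    using xG unfolding carrier_finite_support_space supp by simp
  let ?g = "convolution G f ?\<xi>"
  have "?g x = f x"
    using convolution_unit_indicator[OF f, of "{gsource G x}" x] xG by simp
  moreover have fin: "finite {y. ?g y \<noteq> 0}"
    using convolution_finite_support[OF f \<xi>] by (simp add: carrier_finite_support_space)
  ultimately have "0 < (\<Sum>y | ?g y \<noteq> 0. (cmod (?g y))\<^sup>2)"
    using x by (intro sum_pos2[of _ x]) auto
  also have "\<dots> = Re (cinner (finite_support_space G) ?g ?g)"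
    by (simp add: finite_support_space_def complex_norm_square[symmetric] flip: of_real_power of_real_sum)
  finally have "hnorm (finite_support_space G) ?g > 0" by (simp add: hnorm_def)
  then show ?thesis using that \<xi> by blast
qed

end

section \<open>The full norm\<close>

context ample_groupoid
begin

context
  assumes haus: "Hausdorff_space (unit_topology G)"
begin

lemma full_norm_upper:
  assumes f: "f \<in> steinberg_algebra G"
    and "hilbert_space (H :: (nat \<Rightarrow> 'a \<Rightarrow> complex) hilbert)" "star_hom G H \<pi>"
  shows "operator_norm H (\<pi> f) \<le> full_norm G f"
  unfolding full_norm_def
proof (rule cSup_upper)
  show "operator_norm H (\<pi> f) \<in> rep_norms G TYPE(nat \<Rightarrow> 'a \<Rightarrow> complex) f"
    unfolding rep_norms_def using assms by (intro CollectI exI[of _ H] exI[of _ \<pi>]) simp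
qed (rule bdd_above_rep_norms[OF f])

lemma rep_norms_nonempty:
  assumes f: "f \<in> steinberg_algebra G"
  shows "rep_norms G TYPE(nat \<Rightarrow> 'a \<Rightarrow> complex) f \<noteq> {}"
proof -
  interpret S: semi_inner_space "finite_support_space G" by (rule semi_inner_finite_support)
  show ?thesis
    using rep_norm_dominates[OF haus semi_inner_finite_support regular_representation[OF haus] S.zero_closed f]
    by blast
qed

lemma full_norm_least:
  assumes f: "f \<in> steinberg_algebra G"
    and bound: "\<And>(H :: (nat \<Rightarrow> 'a \<Rightarrow> complex) hilbert) \<pi>. \<lbrakk>hilbert_space H; star_hom G H \<pi>\<rbrakk> \<Longrightarrow> operator_norm H (\<pi> f) \<le> C"
  shows "full_norm G f \<le> C"
  unfolding full_norm_def
proof (rule cSup_least[OF rep_norms_nonempty[OF f]])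
  fix t assume "t \<in> rep_norms G TYPE(nat \<Rightarrow> 'a \<Rightarrow> complex) f"
  then obtain H :: "(nat \<Rightarrow> 'a \<Rightarrow> complex) hilbert" and \<pi>
    where *: "hilbert_space H" "star_hom G H \<pi>" "t = operator_norm H (\<pi> f)"
    unfolding rep_norms_def by (elim CollectE exE conjE)
  show "t \<le> C" unfolding *(3) by (rule bound[OF *(1,2)])
qed

lemma full_norm_nonneg:
  assumes f: "f \<in> steinberg_algebra G"
  shows "0 \<le> full_norm G f"
proof -
  obtain t where t: "t \<in> rep_norms G TYPE(nat \<Rightarrow> 'a \<Rightarrow> complex) f"
    using rep_norms_nonempty[OF f] by (meson all_not_in_conv)
  then obtain H :: "(nat \<Rightarrow> 'a \<Rightarrow> complex) hilbert" and \<pi>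
    where *: "hilbert_space H" "star_hom G H \<pi>"
    unfolding rep_norms_def by (elim CollectE exE conjE)
  interpret H: semi_inner_space H using *(1) by (rule hilbert_space_imp_semi_inner_space)
  show ?thesis
    using H.operator_norm_nonneg[OF star_homD(1)[OF *(2) f]] full_norm_upper[OF f *] by linarith
qed

text \<open>Representations on vectors of any type, and on spaces with only a semi-inner product, obey the norm
  that was defined with a single type of vectors.\<close>
lemma full_norm_bound:
  assumes H: "semi_inner_space H" and \<pi>: "algebraic_star_hom G H \<pi>" and u: "u \<in> carrier H"
    and f: "f \<in> steinberg_algebra G"
  shows "hnorm H (\<pi> f u) \<le> full_norm G f * hnorm H u"
proof -
  interpret H: semi_inner_space H by fact
  obtain t where t: "t \<in> rep_norms G TYPE(nat \<Rightarrow> 'a \<Rightarrow> complex) f" "hnorm H (\<pi> f u) \<le> t * hnorm H u"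
    using rep_norm_dominates[OF haus H \<pi> u f] by (elim bexE)
  have "t \<le> full_norm G f"
    unfolding full_norm_def by (rule cSup_upper[OF t(1) bdd_above_rep_norms[OF f]])
  then show ?thesis
    using t(2) mult_right_mono[of t "full_norm G f" "hnorm H u"] u by simp
qed

lemma rep_norms_le_full_norm:
  assumes f: "f \<in> steinberg_algebra G" and t: "t \<in> rep_norms G TYPE('h) f"
  shows "t \<le> full_norm G f"
proof -
  obtain H :: "'h hilbert" and \<pi>
    where *: "hilbert_space H" "star_hom G H \<pi>" "t = operator_norm H (\<pi> f)"
    using t unfolding rep_norms_def by (elim CollectE exE conjE)
  interpret H: semi_inner_space H using *(1) by (rule hilbert_space_imp_semi_inner_space)
  have \<pi>: "algebraic_star_hom G H \<pi>" using *(2) by (simp add: star_hom_iff)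
  show ?thesis
    unfolding *(3)
  proof (rule H.operator_norm_least)
    fix u assume u: "u \<in> carrier H" "hnorm H u \<le> 1"
    have "hnorm H (\<pi> f u) \<le> full_norm G f * hnorm H u"
      by (rule full_norm_bound[OF H.semi_inner_space_axioms \<pi> u(1) f])
    also have "\<dots> \<le> full_norm G f * 1"
      using u full_norm_nonneg[OF f] by (intro mult_left_mono)
    finally show "hnorm H (\<pi> f u) \<le> full_norm G f" by simp
  qed
qed

lemma full_norm_scale_le:
  assumes f: "f \<in> steinberg_algebra G"
  shows "full_norm G (\<lambda>x. a * f x) \<le> cmod a * full_norm G f"
proof (rule full_norm_least[OF steinberg_scale[OF f]])
  fix H :: "(nat \<Rightarrow> 'a \<Rightarrow> complex) hilbert" and \<pi>
  assume *: "hilbert_space H" "star_hom G H \<pi>"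
  interpret H: semi_inner_space H using *(1) by (rule hilbert_space_imp_semi_inner_space)
  note D = star_homD[OF *(2) f]
  show "operator_norm H (\<pi> (\<lambda>x. a * f x)) \<le> cmod a * full_norm G f"
  proof (rule H.operator_norm_least)
    fix u assume u: "u \<in> carrier H" "hnorm H u \<le> 1"
    have "hnorm H (\<pi> (\<lambda>x. a * f x) u) = cmod a * hnorm H (\<pi> f u)"
      using D(3)[OF u(1), of a] H.hnorm_smult[OF bounded_operatorD(1)[OF D(1) u(1)]] by simp
    also have "\<dots> \<le> cmod a * full_norm G f"
      using H.operator_norm_upper[OF D(1) u] full_norm_upper[OF f *] by (intro mult_left_mono) auto
    finally show "hnorm H (\<pi> (\<lambda>x. a * f x) u) \<le> cmod a * full_norm G f" .
  qed
qed

text \<open>The opposite inequality is the one just proved, for the scalar \<open>a\<inverse>\<close> and the function \<open>a f\<close>.\<close>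
lemma full_norm_scale:
  assumes f: "f \<in> steinberg_algebra G"
  shows "full_norm G (\<lambda>x. a * f x) = cmod a * full_norm G f"
proof (cases "a = 0")
  case True
  then show ?thesis
    using full_norm_scale_le[OF f, of 0] full_norm_nonneg[OF steinberg_zero] by simp
next
  case False
  have "full_norm G f \<le> cmod (inverse a) * full_norm G (\<lambda>x. a * f x)"
    using full_norm_scale_le[OF steinberg_scale[OF f, of a], of "inverse a"] False
    by (simp add: mult.assoc[symmetric])
  then have "cmod a * full_norm G f \<le> full_norm G (\<lambda>x. a * f x)"
    using False by (simp add: norm_divide field_simps)
  then show ?thesis using full_norm_scale_le[OF f, of a] by linarith
qed

lemma full_norm_triangle:
  assumes f: "f \<in> steinberg_algebra G" and g: "g \<in> steinberg_algebra G"
  shows "full_norm G (\<lambda>x. f x + g x) \<le> full_norm G f + full_norm G g"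
proof (rule full_norm_least[OF steinberg_add[OF f g]])
  fix H :: "(nat \<Rightarrow> 'a \<Rightarrow> complex) hilbert" and \<pi>
  assume *: "hilbert_space H" "star_hom G H \<pi>"
  interpret H: semi_inner_space H using *(1) by (rule hilbert_space_imp_semi_inner_space)
  note F = star_homD[OF *(2) f] and B = star_homD(1)[OF *(2) g]
  show "operator_norm H (\<pi> (\<lambda>x. f x + g x)) \<le> full_norm G f + full_norm G g"
  proof (rule H.operator_norm_least)
    fix u assume u: "u \<in> carrier H" "hnorm H u \<le> 1"
    have "hnorm H (\<pi> (\<lambda>x. f x + g x) u) \<le> hnorm H (\<pi> f u) + hnorm H (\<pi> g u)"
      unfolding F(2)[OF g u(1)] by (intro H.hnorm_triangle bounded_operatorD(1)[OF F(1)] bounded_operatorD(1)[OF B] u)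
    also have "\<dots> \<le> full_norm G f + full_norm G g"
      using H.operator_norm_upper[OF F(1) u] full_norm_upper[OF f *] H.operator_norm_upper[OF B u] full_norm_upper[OF g *]
      by linarith
    finally show "hnorm H (\<pi> (\<lambda>x. f x + g x) u) \<le> full_norm G f + full_norm G g" .
  qed
qed

lemma full_norm_convolution:
  assumes f: "f \<in> steinberg_algebra G" and g: "g \<in> steinberg_algebra G"
  shows "full_norm G (convolution G f g) \<le> full_norm G f * full_norm G g"
proof (rule full_norm_least[OF steinberg_convolution[OF haus f g]])
  fix H :: "(nat \<Rightarrow> 'a \<Rightarrow> complex) hilbert" and \<pi>
  assume *: "hilbert_space H" "star_hom G H \<pi>"
  interpret H: semi_inner_space H using *(1) by (rule hilbert_space_imp_semi_inner_space)
  note F = star_homD[OF *(2) f] and B = star_homD(1)[OF *(2) g]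
  show "operator_norm H (\<pi> (convolution G f g)) \<le> full_norm G f * full_norm G g"
  proof (rule H.operator_norm_least)
    fix u assume u: "u \<in> carrier H" "hnorm H u \<le> 1"
    have gu: "\<pi> g u \<in> carrier H" using bounded_operatorD(1)[OF B u(1)] .
    have "hnorm H (\<pi> (convolution G f g) u) \<le> operator_norm H (\<pi> f) * hnorm H (\<pi> g u)"
      unfolding F(4)[OF g u(1)] by (rule H.operator_norm_bound[OF F(1) gu])
    also have "\<dots> \<le> full_norm G f * full_norm G g"
      using H.operator_norm_upper[OF B u] full_norm_upper[OF f *] full_norm_upper[OF g *] gu full_norm_nonneg[OF f]
      by (intro mult_mono) auto
    finally show "hnorm H (\<pi> (convolution G f g) u) \<le> full_norm G f * full_norm G g" .
  qed
qed

lemma full_norm_cstar: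
  assumes f: "f \<in> steinberg_algebra G"
  shows "full_norm G (convolution G (involution G f) f) = (full_norm G f)\<^sup>2"
proof -
  note i = steinberg_involution[OF f]
  note ff = steinberg_convolution[OF haus i f]
  have eq: "operator_norm H (\<pi> (convolution G (involution G f) f)) = (operator_norm H (\<pi> f))\<^sup>2"
    if "hilbert_space H" "star_hom G H \<pi>" for H :: "(nat \<Rightarrow> 'a \<Rightarrow> complex) hilbert" and \<pi>
  proof -
    interpret H: semi_inner_space H using that(1) by (rule hilbert_space_imp_semi_inner_space)
    have "operator_norm H (\<pi> (convolution G (involution G f) f)) = operator_norm H (\<lambda>u. \<pi> (involution G f) (\<pi> f u))"
      by (rule H.operator_norm_cong) (rule star_homD(4)[OF that(2) i f])
    also have "\<dots> = (operator_norm H (\<pi> f))\<^sup>2"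
      using star_homD(5)[OF that(2) f]
      by (intro H.operator_norm_adjoint_comp star_homD(1)[OF that(2)] i f) (simp add: is_adjoint_def)
    finally show ?thesis .
  qed
  have nonneg: "0 \<le> operator_norm H (\<pi> f)"
    if "hilbert_space H" "star_hom G H \<pi>" for H :: "(nat \<Rightarrow> 'a \<Rightarrow> complex) hilbert" and \<pi>
    using semi_inner_space.operator_norm_nonneg[OF hilbert_space_imp_semi_inner_space star_homD(1)] that f by blast
  show ?thesis
  proof (rule antisym)
    show "full_norm G (convolution G (involution G f) f) \<le> (full_norm G f)\<^sup>2"
      by (rule full_norm_least[OF ff]) (simp add: eq nonneg power_mono full_norm_upper[OF f])
    have "full_norm G f \<le> sqrt (full_norm G (convolution G (involution G f) f))"
    proof (rule full_norm_least[OF f])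
      fix H :: "(nat \<Rightarrow> 'a \<Rightarrow> complex) hilbert" and \<pi>
      assume *: "hilbert_space H" "star_hom G H \<pi>"
      show "operator_norm H (\<pi> f) \<le> sqrt (full_norm G (convolution G (involution G f) f))"
        using full_norm_upper[OF ff *] by (intro real_le_rsqrt) (simp add: eq[OF *])
    qed
    then have "(full_norm G f)\<^sup>2 \<le> (sqrt (full_norm G (convolution G (involution G f) f)))\<^sup>2"
      by (rule power_mono) (rule full_norm_nonneg[OF f])
    then show "(full_norm G f)\<^sup>2 \<le> full_norm G (convolution G (involution G f) f)"
      using full_norm_nonneg[OF ff] by simp
  qed
qed

lemma full_norm_eq_0_iff:
  assumes f: "f \<in> steinberg_algebra G"
  shows "full_norm G f = 0 \<longleftrightarrow> f = (\<lambda>x. 0)"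
proof
  assume "f = (\<lambda>x. 0)"
  then show "full_norm G f = 0" using full_norm_scale[OF f, of 0] by simp
next
  assume 0: "full_norm G f = 0"
  show "f = (\<lambda>x. 0)"
  proof (rule ccontr)
    assume "f \<noteq> (\<lambda>x. 0)"
    then obtain \<xi> where "\<xi> \<in> carrier (finite_support_space G)"
      "hnorm (finite_support_space G) (convolution G f \<xi>) > 0"
      using regular_representation_faithful[OF f] by metis
    then show False
      using full_norm_bound[OF semi_inner_finite_support regular_representation[OF haus] _ f] 0 by force
  qed
qed

end

end

theorem theorem4p7:
  fixes G :: "'g top_groupoid"
  assumes "ample_groupoid G"
    and "Hausdorff_space (unit_topology G)"
  shows "(\<forall>f\<in>steinberg_algebra G. bdd_above (rep_norms G TYPE(nat \<Rightarrow> 'g \<Rightarrow> complex) f))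
    \<and> (\<forall>f\<in>steinberg_algebra G. \<forall>t\<in>rep_norms G TYPE('h) f. t \<le> full_norm G f)
    \<and> cstar_norm_on (steinberg_algebra G) (convolution G) (involution G) (full_norm G)"
proof -
  interpret ample_groupoid G by fact
  note haus = assms(2)
  show ?thesis
    unfolding cstar_norm_on_def
    by (intro conjI ballI allI bdd_above_rep_norms rep_norms_le_full_norm full_norm_nonneg
        full_norm_eq_0_iff full_norm_scale full_norm_triangle full_norm_convolution full_norm_cstar haus)
qed

end
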